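(* Let $\tau \in \mathbb{C}$ with $\operatorname{Re}(\tau) \ge 0$, let $g \in H^2(\mathbb{S})$, and let $T$ be defined on monomials by $$T(x^n) = \frac{1+n+\tau}{1+n}\, g(n)\, x^{n+\tau}, \qquad n \in \mathbb{N}.$$ (i) If $\operatorname{Re}(\tau) > 0$, then $T$ extends to a bounded linear operator from $L^2[0,1]$ to $L^2[0,1]$ if and only if the Poisson integral $P[|g|^2]$ is bounded on every half-plane strictly contained in $\mathbb{S}$, i.e. on $\{ s \in \mathbb{C} : \operatorname{Re}(s) > \rho\}$ for every $\rho > -\tfrac12$. (ii) If $\operatorname{Re}(\tau) = 0$, then $T$ extends to a bounded linear operator on $L^2[0,1]$ if and only if $g$ is bounded on $\mathbb{S}$.
   Context: $\mathbb{N} = \{0,1,2,\dots\}$. $\mathbb{S} = \{ s \in \mathbb{C} : \operatorname{Re}(s) > -\tfrac12 \}$; for $s \in \mathbb{S}$, $x^s = e^{s\log x} \in L^2[0,1]$ (complex-valued functions, Lebesgue measure). $T$ is defined linearly on the span of the monomials $x^n$, $n \in \mathbb{N}$ (dense in $L^2[0,1]$). Let $H^2(\mathbb{D})$ be the Hardy space of the unit disk with norm $\|\phi\|^2 = \sup_{0<r<1} \frac{1}{2\pi}\int_0^{2\pi} |\phi(re^{i\theta})|^2 d\theta$, and let $\lambda(s) = \frac{s}{s+1}$, mapping $\mathbb{S}$ onto $\mathbb{D}$. The space $H^2(\mathbb{S})$ is $\{\phi \circ \lambda : \phi \in H^2(\mathbb{D})\}$, normed so that $\phi \mapsto \phi\circ\lambda$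 is unitary. Functions $g\in H^2(\mathbb{S})$ have boundary values $g(-\tfrac12+iy)$ for almost every $y\in\mathbb{R}$, and $\|g\|^2 = \frac{1}{2\pi}\int_{-\infty}^\infty \frac{|g(-\frac12+iy)|^2}{y^2+\frac14}\,dy$. For a function $f$ on the line $\{\operatorname{Re}(s) = -\tfrac12\}$, its Poisson integral is, for $\sigma>0$, $t\in\mathbb{R}$, $$P[f](-\tfrac12+\sigma+it) = \frac1\pi\int_{-\infty}^{\infty} \frac{\sigma}{\sigma^2+(y-t)^2}\, f(-\tfrac12+iy)\,dy;$$ $P[|g|^2]$ is formed from the boundary values of $g$. *)

theory Defs
  imports "HOL-Complex_Analysis.Complex_Analysis" "HOL-Computational_Algebra.Polynomial"
begin

text \<open>
  The space $L^2[0,1]$ is handled through representatives: its elements are functions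
  on the real line of which only the restriction to $[0,1]$ matters, and equality is equality
  almost everywhere on $[0,1]$.
\<close>

definition L2_unit :: "(real \<Rightarrow> complex) set" where
  "L2_unit = {f \<in> borel_measurable (lebesgue_on {0..1}).
     integrable (lebesgue_on {0..1}) (\<lambda>x. (cmod (f x))\<^sup>2)}"

definition L2_norm_unit :: "(real \<Rightarrow> complex) \<Rightarrow> real" where
  "L2_norm_unit f = sqrt (\<integral>x. (cmod (f x))\<^sup>2 \<partial>lebesgue_on {0..1})"

text \<open>
  Linearity and boundedness together imply that the operator respects equality almost
  everywhere, hence it descends to equivalence classes.
\<close>

definition bounded_L2_operator :: "((real \<Rightarrow> complex) \<Rightarrow> (real \<Rightarrow> complex)) \<Rightarrow> bool" where
  "bounded_L2_operator A \<longleftrightarrow>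
     (\<forall>f\<in>L2_unit. A f \<in> L2_unit) \<and>
     (\<forall>f\<in>L2_unit. \<forall>h\<in>L2_unit.
        AE x in lebesgue_on {0..1}. A (\<lambda>u. f u + h u) x = A f x + A h x) \<and>
     (\<forall>c. \<forall>f\<in>L2_unit. AE x in lebesgue_on {0..1}. A (\<lambda>u. c * f u) x = c * A f x) \<and>
     (\<exists>C. \<forall>f\<in>L2_unit. L2_norm_unit (A f) \<le> C * L2_norm_unit f)"

text \<open>
  An operator given on the span of the monomials is a function of complex polynomials; a
  polynomial is determined by its values on $[0,1]$.
\<close>

definition extends_to_bounded_L2_operator :: "(complex poly \<Rightarrow> real \<Rightarrow> complex) \<Rightarrow> bool" where
  "extends_to_bounded_L2_operator T \<longleftrightarrow>
     (\<exists>A. bounded_L2_operator A \<and>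
        (\<forall>p. AE x in lebesgue_on {0..1}. A (\<lambda>u. poly p (complex_of_real u)) x = T p x))"

text \<open>
  The linear extension of
  $x^n \mapsto \frac{1+n+\tau}{1+n}\, g(n)\, x^{n+\tau}$ to polynomials.
\<close>

definition monomial_operator ::
    "complex \<Rightarrow> (complex \<Rightarrow> complex) \<Rightarrow> complex poly \<Rightarrow> real \<Rightarrow> complex" where
  "monomial_operator \<tau> g p x =
     (\<Sum>n\<le>degree p. coeff p n *
        ((1 + of_nat n + \<tau>) / (1 + of_nat n) * g (of_nat n)
          * complex_of_real x powr (of_nat n + \<tau>)))"

definition half_plane :: "complex set" where
  "half_plane = {s. Re s > -1/2}"

definition Hardy2_disk :: "(complex \<Rightarrow> complex) set" where
  "Hardy2_disk = {\<phi>. \<phi> holomorphic_on ball 0 1 \<and>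
     bdd_above ((\<lambda>r. 1 / (2 * pi) *
       integral {0..2 * pi} (\<lambda>\<theta>. (cmod (\<phi> (of_real r * exp (\<i> * of_real \<theta>))))\<^sup>2)) ` {0<..<1})}"

definition Hardy2_half_plane :: "(complex \<Rightarrow> complex) set" where
  "Hardy2_half_plane = {g. \<exists>\<phi>\<in>Hardy2_disk. \<forall>s\<in>half_plane. g s = \<phi> (s / (s + 1))}"

text \<open>
  Boundary values are limits along horizontal lines from the right. The value is arbitrary
  on the (for functions in the Hardy space, null) set of boundary points where the limit does
  not exist.
\<close>

definition boundary_value :: "(complex \<Rightarrow> complex) \<Rightarrow> complex \<Rightarrow> complex" where
  "boundary_value g z = Lim (at_right 0) (\<lambda>\<sigma>. g (z + complex_of_real \<sigma>))"

text \<open>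
  Here \<open>s\<close> is $-\frac12+\sigma+it$, and \<open>f\<close> is evaluated only on the line
  $\mathrm{Re}\, z = -\frac12$.
\<close>

definition poisson_integral :: "(complex \<Rightarrow> real) \<Rightarrow> complex \<Rightarrow> real" where
  "poisson_integral f s = 1 / pi *
     (\<integral>y. (Re s + 1/2) / ((Re s + 1/2)\<^sup>2 + (y - Im s)\<^sup>2) * f (Complex (-1/2) y) \<partial>lborel)"

end

theory Submission
  imports Defs
begin

text \<open>The right variable is the Mellin transform $H(s) = \int_0^1 h(x)\, x^s\, dx$. The map $h \mapsto (1+s)H(s)$ is a unitary map
  from $L^2[0,1]$ onto $H^2(\mathbb{S})$, and Plancherel's formula reads
  $2\pi\|h\|^2 = \int |H(-\frac12+iy)|^2\,dy$. The transpose of $T$ for the bilinear pairing $\int f h$ sends $H$ to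
  \[ K(s) = \frac{1+s+\tau}{1+s}\; g(s)\, H(s+\tau), \]
  so $T$ is bounded if and only if $\|k\| \le C\|h\|$ for these pairs. The first factor and its inverse are bounded on the
  closed half-plane, which leaves the question when
  $\int |g(-\frac12+iy)|^2\, |H(-\frac12+\tau+iy)|^2\, dy \le C \|h\|^2$.

  If $\mathrm{Re}\,\tau = 0$, the translation by $\tau$ is unitary, and what remains is multiplication by $g$: it is bounded for
  bounded $g$, and conversely the functions $h = x^w$, whose transforms are reproducing kernels, recover $|g(s)|$ at each point.
  If $\mathrm{Re}\,\tau > 0$, then $|H(z+\tau)|^2$ is at most the Poisson average of $|H|^2$ at height $\mathrm{Re}\,\tau$, and
  Tonelli's theorem moves the average onto $|g|^2$; so boundedness of $P[|g|^2]$ on the line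
  $\mathrm{Re}\,s = -\frac12 + \mathrm{Re}\,\tau$ is sufficient. Conversely, for $h = x^w$ the function $|H(z+\tau)|^2$ is itself a multiple of a Poisson kernel,
  and the estimate bounds
  $P[|g|^2]$ on every smaller half-plane.

  The operator $T$ sees only the values $g(n)$, while the criteria speak about $g$ everywhere. The passage between
  the two is that $k$ is built from the whole function $g$ (\<open>Hardy2_half_plane_mellin\<close>, \<open>transpose_exists\<close>) and is paired with
  polynomials afterwards (\<open>transpose_pairing\<close>), where only $s = n$ enters. The analytic core is
  \<open>mellin_boundary_Plancherel\<close>: transforms of $L^2$ functions have limits along almost every horizontal line, and
  Plancherel's formula holds for these limits. It is proved for polynomials by explicit integrals of Cauchy kernels and
  extended by density, with a maximal inequality for Poisson averages controlling the limits.\<close>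

section \<open>The Hilbert space $L^2[0,1]$\<close>

abbreviation unit_leb :: "real measure" where "unit_leb \<equiv> lebesgue_on {0..1}"

lemma finite_measure_unit_leb: "finite_measure unit_leb"
  by (rule finite_measure_lebesgue_on) (simp add: lmeasurable_cbox)

lemma L2_unit_measurable [measurable_dest]: "f \<in> L2_unit \<Longrightarrow> f \<in> borel_measurable unit_leb"
  by (simp add: L2_unit_def)

lemma L2_unit_square_integrable: "f \<in> L2_unit \<Longrightarrow> integrable unit_leb (\<lambda>x. (cmod (f x))\<^sup>2)"
  by (simp add: L2_unit_def)

lemma L2_norm_unit_nonneg [simp]: "0 \<le> L2_norm_unit f"
  by (simp add: L2_norm_unit_def)

lemma L2_norm_unit_square: "(L2_norm_unit f)\<^sup>2 = (\<integral>x. (cmod (f x))\<^sup>2 \<partial>unit_leb)"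
  by (simp add: L2_norm_unit_def)

lemma nn_integral_L2_norm_unit:
  "f \<in> L2_unit \<Longrightarrow> (\<integral>\<^sup>+x. ennreal ((cmod (f x))\<^sup>2) \<partial>unit_leb) = ennreal ((L2_norm_unit f)\<^sup>2)"
  by (simp add: L2_norm_unit_square nn_integral_eq_integral L2_unit_square_integrable)

lemma L2_unitI_nn_integral:
  assumes [measurable]: "f \<in> borel_measurable unit_leb" and "0 \<le> c"
    and le: "(\<integral>\<^sup>+x. ennreal ((cmod (f x))\<^sup>2) \<partial>unit_leb) \<le> ennreal (c\<^sup>2)"
  shows "f \<in> L2_unit" "L2_norm_unit f \<le> c"
proof -
  have "integrable unit_leb (\<lambda>x. (cmod (f x))\<^sup>2)"
    using le_less_trans[OF le ennreal_less_top] by (intro integrableI_bounded) (auto simp: norm_power)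
  then show f: "f \<in> L2_unit" by (simp add: L2_unit_def)
  have "(L2_norm_unit f)\<^sup>2 \<le> c\<^sup>2"
    using le unfolding nn_integral_L2_norm_unit[OF f] by simp
  then show "L2_norm_unit f \<le> c" using \<open>0 \<le> c\<close> by (simp add: power2_le_iff_abs_le)
qed

lemma L2_unit_bounded:
  assumes [measurable]: "f \<in> borel_measurable unit_leb" and "\<And>x. x \<in> {0..1} \<Longrightarrow> cmod (f x) \<le> B"
  shows "f \<in> L2_unit" "L2_norm_unit f \<le> B"
proof -
  have B: "0 \<le> B" using assms(2)[of 0] norm_ge_zero[of "f 0"] by (simp del: norm_ge_zero)
  have "(\<integral>\<^sup>+x. ennreal ((cmod (f x))\<^sup>2) \<partial>unit_leb) \<le> (\<integral>\<^sup>+x. ennreal (B\<^sup>2) \<partial>unit_leb)"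
    using assms(2) by (intro nn_integral_mono ennreal_leI power_mono) auto
  also have "\<dots> = ennreal (B\<^sup>2)"
    by (simp add: emeasure_restrict_space)
  finally show "f \<in> L2_unit" "L2_norm_unit f \<le> B"
    using L2_unitI_nn_integral[OF assms(1) B] by auto
qed

lemma L2_unit_add: 
  assumes f: "f \<in> L2_unit" and h: "h \<in> L2_unit" shows "(\<lambda>x. f x + h x) \<in> L2_unit"
proof -
  note [measurable] = L2_unit_measurable[OF f] L2_unit_measurable[OF h]
  have "integrable unit_leb (\<lambda>x. (cmod (f x + h x))\<^sup>2)"
  proof (rule Bochner_Integration.integrable_bound)
    show "integrable unit_leb (\<lambda>x. 2 * (cmod (f x))\<^sup>2 + 2 * (cmod (h x))\<^sup>2)"
      using f h by (simp add: L2_unit_square_integrable)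
    have "(cmod (a + b))\<^sup>2 \<le> 2 * (cmod a)\<^sup>2 + 2 * (cmod b)\<^sup>2" for a b
    proof -
      have "(cmod (a + b))\<^sup>2 \<le> (cmod a + cmod b)\<^sup>2" by (intro power_mono norm_triangle_ineq) auto
      also have "\<dots> \<le> 2 * (cmod a)\<^sup>2 + 2 * (cmod b)\<^sup>2"
        using sum_squares_bound[of "cmod a" "cmod b"] by (simp add: power2_sum)
      finally show ?thesis .
    qed
    then show "AE x in unit_leb. norm ((cmod (f x + h x))\<^sup>2) \<le> norm (2 * (cmod (f x))\<^sup>2 + 2 * (cmod (h x))\<^sup>2)"
      by simp
  qed measurable
  then show ?thesis by (simp add: L2_unit_def)
qed

lemma L2_unit_scale: 
  assumes f: "f \<in> L2_unit" shows "(\<lambda>x. c * f x) \<in> L2_unit"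
proof -
  note [measurable] = L2_unit_measurable[OF f]
  show ?thesis using L2_unit_square_integrable[OF f] by (simp add: L2_unit_def norm_mult power_mult_distrib)
qed

lemma L2_norm_unit_scale: "L2_norm_unit (\<lambda>x. c * f x) = cmod c * L2_norm_unit f"
  by (simp add: L2_norm_unit_def norm_mult power_mult_distrib real_sqrt_mult)

lemma L2_unit_diff: 
  assumes "f \<in> L2_unit" "h \<in> L2_unit" shows "(\<lambda>x. f x - h x) \<in> L2_unit"
  using L2_unit_add[OF assms(1) L2_unit_scale[OF assms(2), of "-1"]] by simp

lemma L2_norm_unit_minus_commute: "L2_norm_unit (\<lambda>x. f x - h x) = L2_norm_unit (\<lambda>x. h x - f x)"
  by (simp add: L2_norm_unit_def norm_minus_commute)

lemma L2_unit_zero: "(\<lambda>x. 0) \<in> L2_unit"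
  by (simp add: L2_unit_def)

lemma L2_unit_sum: "(\<And>i. i \<in> I \<Longrightarrow> f i \<in> L2_unit) \<Longrightarrow> (\<lambda>x. \<Sum>i\<in>I. f i x) \<in> L2_unit"
  by (induction I rule: infinite_finite_induct) (auto simp: L2_unit_zero intro!: L2_unit_add)

lemma L2_unit_cnj: "f \<in> L2_unit \<Longrightarrow> (\<lambda>x. cnj (f x)) \<in> L2_unit"
  unfolding L2_unit_def
  by (auto intro!: measurable_compose[of _ _ borel cnj] borel_measurable_continuous_onI continuous_intros)

lemma L2_norm_unit_cnj: "L2_norm_unit (\<lambda>x. cnj (f x)) = L2_norm_unit f"
  by (simp add: L2_norm_unit_def)

lemma L2_unit_mult_integrable:
  assumes f: "f \<in> L2_unit" and h: "h \<in> L2_unit" shows "integrable unit_leb (\<lambda>x. f x * h x)"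
proof -
  note [measurable] = L2_unit_measurable[OF f] L2_unit_measurable[OF h]
  show ?thesis
  proof (rule Bochner_Integration.integrable_bound)
    show "integrable unit_leb (\<lambda>x. (cmod (f x))\<^sup>2 + (cmod (h x))\<^sup>2)"
      using f h by (simp add: L2_unit_square_integrable)
    have "a * b \<le> a\<^sup>2 + b\<^sup>2" if "a \<ge> 0" "b \<ge> 0" for a b :: real
      using sum_squares_bound[of a b] that mult_nonneg_nonneg[of a b] by linarith
    then show "AE x in unit_leb. norm (f x * h x) \<le> norm ((cmod (f x))\<^sup>2 + (cmod (h x))\<^sup>2)"
      by (simp add: norm_mult)
  qed measurable
qed

text \<open>The quadratic $t \mapsto \int (|f| - t|h|)^2$ is nonnegative, in particular at its minimum $t = \int |f||h| / \|h\|^2$. If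
  $\|h\| = 0$ it is an affine function of $t$ and must be constant.\<close>

lemma L2_unit_Cauchy_Schwarz_norm:
  assumes f: "f \<in> L2_unit" and h: "h \<in> L2_unit"
  shows "(\<integral>x. cmod (f x) * cmod (h x) \<partial>unit_leb) \<le> L2_norm_unit f * L2_norm_unit h"
proof -
  define P where "P = (\<integral>x. cmod (f x) * cmod (h x) \<partial>unit_leb)"
  have i: "integrable unit_leb (\<lambda>x. cmod (f x) * cmod (h x))"
    using integrable_norm[OF L2_unit_mult_integrable[OF f h]] by (simp add: norm_mult)
  note i' = i L2_unit_square_integrable[OF f] L2_unit_square_integrable[OF h]
  define a where "a = (L2_norm_unit f)\<^sup>2"
  define b where "b = (L2_norm_unit h)\<^sup>2"
  have P0: "P \<ge> 0" by (simp add: P_def)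
  have q: "2 * t * P \<le> a + t\<^sup>2 * b" for t
  proof -
    have "0 \<le> (\<integral>x. (cmod (f x) - t * cmod (h x))\<^sup>2 \<partial>unit_leb)" by simp
    also have "\<dots> = (\<integral>x. (cmod (f x))\<^sup>2 - (2 * t) * (cmod (f x) * cmod (h x)) + t\<^sup>2 * (cmod (h x))\<^sup>2 \<partial>unit_leb)"
      by (intro Bochner_Integration.integral_cong refl) (simp add: power2_diff power_mult_distrib algebra_simps)
    also have "\<dots> = a - 2 * t * P + t\<^sup>2 * b"
      using i' by (simp add: a_def b_def P_def L2_norm_unit_square)
    finally show ?thesis by simp
  qed
  have b0: "b \<ge> 0" and a0: "a \<ge> 0" by (auto simp: a_def b_def)
  have "P\<^sup>2 \<le> a * b"
  proof (cases "b = 0")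
    case True
    have "P = 0"
    proof (rule ccontr)
      assume "P \<noteq> 0"
      with P0 q[of "(a + 1) / P"] True a0 show False by simp
    qed
    then show ?thesis by (simp add: True)
  next
    case False
    with b0 q[of "P / b"] have "2 * P\<^sup>2 / b \<le> a + P\<^sup>2 / b" by (simp add: power2_eq_square)
    with False b0 show ?thesis by (simp add: field_simps)
  qed
  then have "P\<^sup>2 \<le> (L2_norm_unit f * L2_norm_unit h)\<^sup>2" by (simp add: a_def b_def power_mult_distrib)
  then show ?thesis unfolding P_def[symmetric]
    by (rule power2_le_imp_le) simp
qed

lemma L2_unit_Cauchy_Schwarz:
  assumes f: "f \<in> L2_unit" and h: "h \<in> L2_unit"
  shows "cmod (\<integral>x. f x * h x \<partial>unit_leb) \<le> L2_norm_unit f * L2_norm_unit h"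
proof -
  have "cmod (\<integral>x. f x * h x \<partial>unit_leb) \<le> (\<integral>x. cmod (f x * h x) \<partial>unit_leb)"
    by simp
  then show ?thesis using L2_unit_Cauchy_Schwarz_norm[OF f h] by (simp add: norm_mult)
qed

lemma L2_norm_unit_triangle:
  assumes f: "f \<in> L2_unit" and h: "h \<in> L2_unit"
  shows "L2_norm_unit (\<lambda>x. f x + h x) \<le> L2_norm_unit f + L2_norm_unit h"
proof -
  have i: "integrable unit_leb (\<lambda>x. cmod (f x) * cmod (h x))"
    using integrable_norm[OF L2_unit_mult_integrable[OF f h]] by (simp add: norm_mult)
  note i' = i L2_unit_square_integrable[OF f] L2_unit_square_integrable[OF h]
  have "(L2_norm_unit (\<lambda>x. f x + h x))\<^sup>2
      \<le> (\<integral>x. (cmod (f x))\<^sup>2 + 2 * (cmod (f x) * cmod (h x)) + (cmod (h x))\<^sup>2 \<partial>unit_leb)"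
    unfolding L2_norm_unit_square
  proof (intro integral_mono)
    show "integrable unit_leb (\<lambda>x. (cmod (f x + h x))\<^sup>2)"
      by (intro L2_unit_square_integrable L2_unit_add f h)
    show "(cmod (f x + h x))\<^sup>2 \<le> (cmod (f x))\<^sup>2 + 2 * (cmod (f x) * cmod (h x)) + (cmod (h x))\<^sup>2" for x
      using power_mono[OF norm_triangle_ineq[of "f x" "h x"], of 2] by (simp add: power2_sum)
  qed (use i' in simp)
  also have "\<dots> = (L2_norm_unit f)\<^sup>2 + 2 * (\<integral>x. cmod (f x) * cmod (h x) \<partial>unit_leb) + (L2_norm_unit h)\<^sup>2"
    using i' by (simp add: L2_norm_unit_square)
  also have "\<dots> \<le> (L2_norm_unit f + L2_norm_unit h)\<^sup>2"
    using L2_unit_Cauchy_Schwarz_norm[OF f h] by (simp add: power2_sum)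
  finally show ?thesis by (rule power2_le_imp_le) simp
qed

lemma L2_norm_unit_triangle_diff:
  assumes f: "f \<in> L2_unit" and h: "h \<in> L2_unit" and k: "k \<in> L2_unit"
  shows "L2_norm_unit (\<lambda>x. f x - k x) \<le> L2_norm_unit (\<lambda>x. f x - h x) + L2_norm_unit (\<lambda>x. h x - k x)"
  using L2_norm_unit_triangle[OF L2_unit_diff[OF f h] L2_unit_diff[OF h k]] by simp

lemma L2_norm_unit_triangle_sum:
  "(\<And>i. i \<in> I \<Longrightarrow> f i \<in> L2_unit) \<Longrightarrow> L2_norm_unit (\<lambda>x. \<Sum>i\<in>I. f i x) \<le> (\<Sum>i\<in>I. L2_norm_unit (f i))"
proof (induction I rule: infinite_finite_induct)
  case (insert i I)
  have "L2_norm_unit (\<lambda>x. f i x + (\<Sum>i\<in>I. f i x)) \<le> L2_norm_unit (f i) + L2_norm_unit (\<lambda>x. \<Sum>i\<in>I. f i x)"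
    using insert by (intro L2_norm_unit_triangle L2_unit_sum) auto
  with insert show ?case by force
qed (auto simp: L2_norm_unit_def)

lemma L2_norm_unit_eq_0_AE:
  assumes f: "f \<in> L2_unit" and "L2_norm_unit f = 0"
  shows "AE x in unit_leb. f x = 0"
  using integral_nonneg_eq_0_iff_AE[OF L2_unit_square_integrable[OF f]] assms(2)
  by (simp add: L2_norm_unit_def)

lemma L2_norm_unit_cong_AE:
  assumes "AE x in unit_leb. f x = h x" "f \<in> borel_measurable unit_leb" "h \<in> borel_measurable unit_leb"
  shows "L2_norm_unit f = L2_norm_unit h"
  unfolding L2_norm_unit_def using assms
  by (intro arg_cong[of _ _ sqrt] integral_cong_AE) auto

text \<open>Riesz--Fischer: a subsequence whose increments are summable in norm converges almost everywhere
  by monotone convergence, and Fatou's lemma turns pointwise into mean convergence.\<close>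

lemma L2_unit_complete:
  fixes F :: "nat \<Rightarrow> real \<Rightarrow> complex"
  assumes F: "\<And>n. F n \<in> L2_unit"
    and Cauchy: "\<And>e. e > 0 \<Longrightarrow> \<exists>M. \<forall>m\<ge>M. \<forall>n\<ge>M. L2_norm_unit (\<lambda>x. F m x - F n x) < e"
  shows "\<exists>f\<in>L2_unit. (\<lambda>n. L2_norm_unit (\<lambda>x. F n x - f x)) \<longlonglongrightarrow> 0"
proof -
  note [measurable] = L2_unit_measurable[OF F]
  have "\<exists>r::nat\<Rightarrow>nat. \<forall>k. (\<forall>m\<ge>r k. \<forall>n\<ge>r k. L2_norm_unit (\<lambda>x. F m x - F n x) < (1/2)^k) \<and> r k < r (Suc k)"
  proof (rule dependent_nat_choice)
    show "\<exists>x. \<forall>m\<ge>x. \<forall>n\<ge>x. L2_norm_unit (\<lambda>x. F m x - F n x) < (1 / 2) ^ 0"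
      using Cauchy[of 1] by simp
    fix x :: nat and k
    obtain M where "\<forall>m\<ge>M. \<forall>n\<ge>M. L2_norm_unit (\<lambda>x. F m x - F n x) < (1/2)^Suc k"
      using Cauchy[of "(1/2)^Suc k"] by auto
    then show "\<exists>y. (\<forall>m\<ge>y. \<forall>n\<ge>y. L2_norm_unit (\<lambda>x. F m x - F n x) < (1 / 2) ^ Suc k) \<and> x < y"
      by (intro exI[of _ "max M (Suc x)"]) auto
  qed
  then obtain r :: "nat \<Rightarrow> nat" where r: "\<And>k m n. m \<ge> r k \<Longrightarrow> n \<ge> r k \<Longrightarrow> L2_norm_unit (\<lambda>x. F m x - F n x) < (1/2)^k"
    and r_mono: "\<And>k. r k < r (Suc k)" by blast
  have sm: "strict_mono r" using r_mono by (simp add: strict_mono_Suc_iff)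
  define D where "D k x = F (r (Suc k)) x - F (r k) x" for k x
  have D: "D k \<in> L2_unit" for k unfolding D_def by (intro L2_unit_diff F)
  have DN: "L2_norm_unit (D k) \<le> (1/2)^k" for k
    unfolding D_def using r[of k "r (Suc k)" "r k"] r_mono[of k] by (simp add: less_imp_le)
  define S where "S K x = (\<Sum>k<K. cmod (D k x))" for K x
  have [measurable]: "D k \<in> borel_measurable unit_leb" for k by (rule L2_unit_measurable[OF D])
  have [measurable]: "S K \<in> borel_measurable unit_leb" for K unfolding S_def by measurable
  have Dr: "(\<lambda>x. of_real (cmod (D k x))) \<in> L2_unit" for k
    using L2_unit_square_integrable[OF D[of k]] by (simp add: L2_unit_def)
  have DrN: "L2_norm_unit (\<lambda>x. of_real (cmod (D k x))) = L2_norm_unit (D k)" for k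
    by (simp add: L2_norm_unit_def)
  have geo: "(\<Sum>k<K. (1/2::real)^k) \<le> 2" for K
    by (simp add: geometric_sum)
  have SN: "(\<integral>\<^sup>+x. ennreal ((S K x)\<^sup>2) \<partial>unit_leb) \<le> ennreal 4" for K
  proof -
    have Sl: "(\<lambda>x. \<Sum>k<K. complex_of_real (cmod (D k x))) \<in> L2_unit" by (intro L2_unit_sum Dr)
    have "L2_norm_unit (\<lambda>x. \<Sum>k<K. complex_of_real (cmod (D k x))) \<le> (\<Sum>k<K. L2_norm_unit (\<lambda>x. complex_of_real (cmod (D k x))))"
      by (intro L2_norm_unit_triangle_sum Dr)
    also have "\<dots> \<le> (\<Sum>k<K. (1/2)^k)" unfolding DrN by (intro sum_mono DN)
    also have "\<dots> \<le> 2" by (rule geo)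
    finally have "(L2_norm_unit (\<lambda>x. \<Sum>k<K. complex_of_real (cmod (D k x))))\<^sup>2 \<le> 2\<^sup>2"
      by (intro power_mono) auto
    moreover have "cmod (\<Sum>k<K. complex_of_real (cmod (D k x))) = S K x" for x
      unfolding of_real_sum[symmetric] norm_of_real S_def by (simp add: sum_nonneg)
    ultimately show ?thesis using nn_integral_L2_norm_unit[OF Sl] using ennreal_leI[of _ 4] by simp
  qed
  have "(\<integral>\<^sup>+x. (SUP K. ennreal ((S K x)\<^sup>2)) \<partial>unit_leb) = (SUP K. \<integral>\<^sup>+x. ennreal ((S K x)\<^sup>2) \<partial>unit_leb)"
  proof (rule nn_integral_monotone_convergence_SUP)
    show "incseq (\<lambda>K x. ennreal ((S K x)\<^sup>2))"
      by (rule incseq_SucI) (auto simp: S_def le_fun_def sum_nonneg intro!: ennreal_leI power_mono)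
  qed measurable
  also have "\<dots> \<le> ennreal 4" by (intro SUP_least SN)
  finally have "(\<integral>\<^sup>+x. (SUP K. ennreal ((S K x)\<^sup>2)) \<partial>unit_leb) \<noteq> \<infinity>"
    by (auto simp: top_unique)
  then have "AE x in unit_leb. (SUP K. ennreal ((S K x)\<^sup>2)) \<noteq> \<infinity>"
    by (intro nn_integral_noteq_infinite) auto
  then have conv: "AE x in unit_leb. convergent (\<lambda>k. F (r k) x)"
  proof eventually_elim
    case (elim x)
    then obtain B where B: "(SUP K. ennreal ((S K x)\<^sup>2)) = ennreal B" "B \<ge> 0" by (cases "SUP K. ennreal ((S K x)\<^sup>2)") auto
    have "S K x \<le> sqrt B" for K
    proof -
      have "ennreal ((S K x)\<^sup>2) \<le> ennreal B" unfolding B(1)[symmetric] by (rule SUP_upper) simp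
      then have "(S K x)\<^sup>2 \<le> B" using B(2) by simp
      then show ?thesis by (rule real_le_rsqrt)
    qed
    then have "summable (\<lambda>k. cmod (D k x))"
      by (intro bounded_imp_summable[where B="sqrt B"]) (auto simp: S_def simp flip: lessThan_Suc_atMost simp del: sum.lessThan_Suc)
    then have "summable (\<lambda>k. D k x)" by (rule summable_norm_cancel)
    then have "convergent (\<lambda>K. (\<Sum>k<K. D k x))" by (simp add: summable_iff_convergent)
    moreover have "(\<Sum>k<K. D k x) = F (r K) x - F (r 0) x" for K
      unfolding D_def by (rule sum_lessThan_telescope)
    ultimately have "convergent (\<lambda>K. F (r K) x - F (r 0) x)" by simp
    then have "convergent (\<lambda>K. F (r K) x - F (r 0) x + F (r 0) x)"
      by (intro convergent_add convergent_const)
    then show ?case by simp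
  qed
  define f where "f x = lim (\<lambda>k. F (r k) x)" for x
  have fm[measurable]: "f \<in> borel_measurable unit_leb" unfolding f_def by measurable
  have fl: "AE x in unit_leb. (\<lambda>k. F (r k) x) \<longlonglongrightarrow> f x"
    using conv by eventually_elim (simp add: f_def convergent_LIMSEQ_iff)
  have key: "(\<lambda>x. F n x - f x) \<in> L2_unit \<and> L2_norm_unit (\<lambda>x. F n x - f x) \<le> (1/2)^k" if n: "n \<ge> r k" for n k
  proof -
    have "(\<integral>\<^sup>+x. ennreal ((cmod (F n x - f x))\<^sup>2) \<partial>unit_leb)
        = (\<integral>\<^sup>+x. liminf (\<lambda>j. ennreal ((cmod (F n x - F (r j) x))\<^sup>2)) \<partial>unit_leb)"
    proof (intro nn_integral_cong_AE, use fl in eventually_elim)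
      fix x assume "(\<lambda>k. F (r k) x) \<longlonglongrightarrow> f x"
      then have "(\<lambda>j. ennreal ((cmod (F n x - F (r j) x))\<^sup>2)) \<longlonglongrightarrow> ennreal ((cmod (F n x - f x))\<^sup>2)"
        by (intro tendsto_intros)
      then show "ennreal ((cmod (F n x - f x))\<^sup>2) = liminf (\<lambda>j. ennreal ((cmod (F n x - F (r j) x))\<^sup>2))"
        using lim_imp_Liminf[OF sequentially_bot] by metis
    qed
    also have "\<dots> \<le> liminf (\<lambda>j. \<integral>\<^sup>+x. ennreal ((cmod (F n x - F (r j) x))\<^sup>2) \<partial>unit_leb)"
      by (rule nn_integral_liminf) measurable
    also have "\<dots> \<le> liminf (\<lambda>j. ennreal (((1/2)^k)\<^sup>2))"
    proof (rule Liminf_mono, rule eventually_sequentiallyI[of k])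
      fix j assume "k \<le> j"
      then have "r k \<le> r j" using sm by (simp add: strict_mono_less_eq)
      then have "L2_norm_unit (\<lambda>x. F n x - F (r j) x) \<le> (1/2)^k" using r[of k n "r j"] n by simp
      then show "(\<integral>\<^sup>+x. ennreal ((cmod (F n x - F (r j) x))\<^sup>2) \<partial>unit_leb) \<le> ennreal (((1/2)^k)\<^sup>2)"
        unfolding nn_integral_L2_norm_unit[OF L2_unit_diff[OF F F]]
        by (intro ennreal_leI power_mono) auto
    qed
    also have "\<dots> = ennreal (((1/2)^k)\<^sup>2)" by (simp add: Liminf_const)
    finally show ?thesis by (intro conjI L2_unitI_nn_integral) auto
  qed
  have "f \<in> L2_unit"
    using L2_unit_diff[OF F[of "r 0"] conjunct1[OF key[of 0 "r 0"]]] by simp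
  moreover have "(\<lambda>n. L2_norm_unit (\<lambda>x. F n x - f x)) \<longlonglongrightarrow> 0"
  proof (rule LIMSEQ_I)
    fix e :: real assume "e > 0"
    then obtain k where "(1/2)^k < e" using real_arch_pow_inv[of e "1/2"] by auto
    then have "norm (L2_norm_unit (\<lambda>x. F n x - f x) - 0) < e" if "n \<ge> r k" for n
      using key[OF that] by simp
    then show "\<exists>no. \<forall>n\<ge>no. norm (L2_norm_unit (\<lambda>x. F n x - f x) - 0) < e" by blast
  qed
  ultimately show ?thesis by blast
qed

lemma L2_unit_continuous:
  assumes "continuous_on {0..1} f" shows "f \<in> L2_unit"
proof -
  have "compact (f ` {0..1})" using assms by (intro compact_continuous_image) auto
  then obtain B where "\<forall>x\<in>{0..1}. cmod (f x) \<le> B"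
    using compact_imp_bounded[of "f ` {0..1}"] unfolding bounded_iff by auto
  then show ?thesis
    by (intro L2_unit_bounded(1)[of _ B] continuous_imp_measurable_on_sets_lebesgue[OF assms]) auto
qed

abbreviation poly_fun :: "complex poly \<Rightarrow> real \<Rightarrow> complex" where
  "poly_fun p \<equiv> (\<lambda>x. poly p (complex_of_real x))"

lemma L2_unit_poly: "(poly_fun p) \<in> L2_unit"
  by (intro L2_unit_continuous continuous_intros)

lemma continuous_approx_poly:
  assumes f: "continuous_on {0..1} (f :: real \<Rightarrow> complex)" and e: "e > 0"
  shows "\<exists>p. L2_norm_unit (\<lambda>u. f u - poly p (complex_of_real u)) < e"
proof -
  have real: "\<exists>p. \<forall>x\<in>{0..1}. cmod (of_real (r x) - poly p (complex_of_real x)) < e/4"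
    if r: "continuous_on {0..1} r" for r :: "real \<Rightarrow> real"
  proof -
    obtain q where q: "real_polynomial_function q" "\<And>x. x \<in> {0..1} \<Longrightarrow> \<bar>r x - q x\<bar> < e/4"
      by (rule Stone_Weierstrass_real_polynomial_function[OF _ r, of "e/4"]) (use e in auto)
    then obtain a n where an: "q = (\<lambda>x. \<Sum>i\<le>n. a i * x ^ i)"
      using real_polynomial_function_iff_sum by blast
    define p where "p = (\<Sum>i\<le>n. monom (complex_of_real (a i)) i)"
    have "poly p (of_real x) = of_real (q x)" for x
      by (simp add: p_def poly_sum poly_monom an)
    then have "cmod (of_real (r x) - poly p (complex_of_real x)) < e/4" if "x \<in> {0..1}" for x
      using q(2)[OF that] by (simp flip: of_real_diff)
    then show ?thesis by blast
  qed
  obtain p where p: "\<forall>x\<in>{0..1}. cmod (of_real (Re (f x)) - poly p (complex_of_real x)) < e/4"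
    using real[of "\<lambda>x. Re (f x)"] f by (auto intro: continuous_intros)
  obtain q where q: "\<forall>x\<in>{0..1}. cmod (of_real (Im (f x)) - poly q (complex_of_real x)) < e/4"
    using real[of "\<lambda>x. Im (f x)"] f by (auto intro: continuous_intros)
  have "cmod (f x - poly (p + smult \<i> q) (of_real x)) \<le> e/2" if x: "x \<in> {0..1}" for x
  proof -
    have "f x - poly (p + smult \<i> q) (of_real x)
        = (of_real (Re (f x)) - poly p (of_real x)) + \<i> * (of_real (Im (f x)) - poly q (of_real x))"
      by (subst complex_eq[of "f x"]) (simp add: algebra_simps)
    also have "cmod \<dots> \<le> cmod (of_real (Re (f x)) - poly p (complex_of_real x))
        + cmod (of_real (Im (f x)) - poly q (complex_of_real x))"
      by (metis norm_triangle_ineq norm_mult norm_ii mult_1)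
    also have "\<dots> \<le> e/2" using p q x by fastforce
    finally show ?thesis .
  qed
  then have "L2_norm_unit (\<lambda>u. f u - poly (p + smult \<i> q) (complex_of_real u)) \<le> e/2"
    by (intro L2_unit_bounded(2) continuous_imp_measurable_on_sets_lebesgue continuous_intros f) auto
  then show ?thesis using e by (intro exI[of _ "p + smult \<i> q"]) linarith
qed

lemma L2_norm_tendsto_0_dominated:
  assumes [measurable]: "\<And>n. h n \<in> borel_measurable unit_leb"
    and lim: "AE x in unit_leb. (\<lambda>n. h n x) \<longlonglongrightarrow> 0"
    and dom: "\<And>n x. x \<in> {0..1} \<Longrightarrow> cmod (h n x) \<le> w x"
    and w[measurable]: "w \<in> borel_measurable unit_leb" "integrable unit_leb (\<lambda>x. (w x)\<^sup>2)"
  shows "(\<lambda>n. L2_norm_unit (h n)) \<longlonglongrightarrow> 0"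
proof -
  have "(\<lambda>n. \<integral>x. (cmod (h n x))\<^sup>2 \<partial>unit_leb) \<longlonglongrightarrow> (\<integral>x. 0 \<partial>unit_leb)"
  proof (rule integral_dominated_convergence[where w="\<lambda>x. (w x)\<^sup>2"])
    show "AE x in unit_leb. (\<lambda>n. (cmod (h n x))\<^sup>2) \<longlonglongrightarrow> 0"
      using lim by eventually_elim (auto intro!: tendsto_eq_intros)
    show "AE x in unit_leb. norm ((cmod (h n x))\<^sup>2) \<le> (w x)\<^sup>2" for n
      by (rule AE_I2) (auto intro!: power_mono dom)
  qed (use w(2) in measurable)
  then have "(\<lambda>n. sqrt (\<integral>x. (cmod (h n x))\<^sup>2 \<partial>unit_leb)) \<longlonglongrightarrow> sqrt 0"
    by (intro tendsto_real_sqrt) simp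
  then show ?thesis by (simp add: L2_norm_unit_def)
qed

text \<open>A measurable function is an almost everywhere limit of continuous ones; the radial retraction
  onto a disc of the target makes the limit dominated, first for bounded functions and then, by
  truncating the values, for all square integrable ones.\<close>

lemma polynomials_dense_L2_unit:
  assumes f: "f \<in> L2_unit" and e: "e > 0"
  shows "\<exists>p. L2_norm_unit (\<lambda>u. f u - poly p (complex_of_real u)) < e"
proof -
  note fm[measurable] = L2_unit_measurable[OF f]
  define R where "R n z = closest_point (cball 0 (real n)) z" for n and z :: complex
  have Rc: "continuous_on UNIV (R n)" for n unfolding R_def by (rule continuous_on_closest_point) auto
  have Rb: "cmod (R n z) \<le> real n" for n z
    using closest_point_in_set[of "cball 0 (real n)" z] by (simp add: R_def)
  have Rid: "R n z = z" if "cmod z \<le> real n" for n z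
    unfolding R_def using that by (intro closest_point_self) auto
  have Rle: "cmod (z - R n z) \<le> cmod z" for n z
    using closest_point_le[of "cball 0 (real n)" 0 z] by (simp add: R_def dist_norm)
  have Rm[measurable]: "(\<lambda>x. R n (f x)) \<in> borel_measurable unit_leb" for n
    by (rule measurable_compose[OF fm]) (intro borel_measurable_continuous_onI Rc)
  have "(\<lambda>n. L2_norm_unit (\<lambda>x. f x - R n (f x))) \<longlonglongrightarrow> 0"
  proof (rule L2_norm_tendsto_0_dominated[where w="\<lambda>x. cmod (f x)"])
    show "AE x in unit_leb. (\<lambda>n. f x - R n (f x)) \<longlonglongrightarrow> 0"
    proof (rule AE_I2)
      fix x
      obtain M :: nat where "cmod (f x) \<le> real M" using real_arch_simple by blast
      then have "f x - R n (f x) = 0" if "n \<ge> M" for n using Rid[of "f x" n] that by simp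
      then show "(\<lambda>n. f x - R n (f x)) \<longlonglongrightarrow> 0"
        by (intro tendsto_eventually eventually_sequentiallyI[of M])
    qed
  qed (use f Rle in \<open>auto simp: L2_unit_square_integrable\<close>)
  then obtain n where n: "L2_norm_unit (\<lambda>x. f x - R n (f x)) < e/3"
    using LIMSEQ_D[of _ 0 "e/3"] e by fastforce
  have "f measurable_on {0..1}"
    using fm by (simp add: measurable_on_iff_borel_measurable)
  then have "\<exists>N (c :: nat \<Rightarrow> real \<Rightarrow> complex). negligible N \<and> (\<forall>j. continuous_on UNIV (c j)) \<and>
      (\<forall>x. x \<notin> N \<longrightarrow> (\<lambda>j. c j x) \<longlonglongrightarrow> (if x \<in> {0..1} then f x else 0))"
    by (simp only: measurable_on_def)
  then obtain N and c :: "nat \<Rightarrow> real \<Rightarrow> complex" where N: "negligible N" and c: "\<And>j. continuous_on UNIV (c j)"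
    and cl: "\<And>x. x \<notin> N \<Longrightarrow> (\<lambda>j. c j x) \<longlonglongrightarrow> (if x \<in> {0..1} then f x else 0)"
    by blast
  have cR: "continuous_on A (\<lambda>x. R n (c j x))" for j A
    by (rule continuous_on_compose2[OF Rc continuous_on_subset[OF c]]) auto
  have [measurable]: "(\<lambda>x. R n (c j x)) \<in> borel_measurable unit_leb" for j
    by (intro continuous_imp_measurable_on_sets_lebesgue cR) auto
  have "(\<lambda>j. L2_norm_unit (\<lambda>x. R n (f x) - R n (c j x))) \<longlonglongrightarrow> 0"
  proof (rule L2_norm_tendsto_0_dominated[where w="\<lambda>x. 2 * real n"])
    have "AE x in lebesgue. x \<notin> N" using N by (simp add: AE_not_in negligible_iff_null_sets)
    then have "AE x in unit_leb. x \<notin> N \<and> x \<in> {0..1}"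
      by (auto simp: AE_restrict_space_iff elim: eventually_mono)
    then show "AE x in unit_leb. (\<lambda>j. R n (f x) - R n (c j x)) \<longlonglongrightarrow> 0"
    proof eventually_elim
      case (elim x)
      then have "(\<lambda>j. c j x) \<longlonglongrightarrow> f x" using cl[of x] by simp
      moreover have "isCont (R n) (f x)" using Rc[of n] by (simp add: continuous_on_eq_continuous_at)
      ultimately have "(\<lambda>j. R n (c j x)) \<longlonglongrightarrow> R n (f x)" by (rule isCont_tendsto_compose[rotated])
      then show ?case by (auto intro!: tendsto_eq_intros)
    qed
    show "cmod (R n (f x) - R n (c j x)) \<le> 2 * real n" for j x
      using norm_triangle_ineq4[of "R n (f x)" "R n (c j x)"] Rb[of n "f x"] Rb[of n "c j x"] by linarith
    show "integrable unit_leb (\<lambda>x. (2 * real n)\<^sup>2)"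
      using finite_measure_unit_leb finite_measure.integrable_const by blast
  qed auto
  then obtain j where j: "L2_norm_unit (\<lambda>x. R n (f x) - R n (c j x)) < e/3"
    using LIMSEQ_D[of _ 0 "e/3"] e by fastforce
  obtain p where p: "L2_norm_unit (\<lambda>u. R n (c j u) - poly p (complex_of_real u)) < e/3"
    using continuous_approx_poly[OF cR, of "e/3"] e by (metis divide_pos_pos zero_less_numeral)
  have l: "(\<lambda>x. R n (f x)) \<in> L2_unit" "(\<lambda>x. R n (c j x)) \<in> L2_unit"
    by (rule L2_unit_bounded(1)[OF _ Rb], measurable)+
  have "L2_norm_unit (\<lambda>u. f u - poly p (complex_of_real u)) \<le> 
     L2_norm_unit (\<lambda>x. f x - R n (f x)) + L2_norm_unit (\<lambda>u. R n (f u) - poly p (complex_of_real u))"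
    by (intro L2_norm_unit_triangle_diff f l L2_unit_poly)
  also have "L2_norm_unit (\<lambda>u. R n (f u) - poly p (complex_of_real u)) \<le> 
     L2_norm_unit (\<lambda>x. R n (f x) - R n (c j x)) + L2_norm_unit (\<lambda>u. R n (c j u) - poly p (complex_of_real u))"
    by (intro L2_norm_unit_triangle_diff f l L2_unit_poly)
  finally show ?thesis using n j p by (intro exI[of _ p]) linarith
qed

section \<open>Mellin transforms and Hardy space functions\<close>

definition mellin :: "(real \<Rightarrow> complex) \<Rightarrow> complex \<Rightarrow> complex" where
  "mellin f s = (\<integral>x. f x * complex_of_real x powr s \<partial>unit_leb)"

text \<open>Up to factorials, the Mellin transforms of these functions for $z = 0$ are the powers of $\frac{1}{s+1}$. The value at $x = 0$ is $0$,
  also for $z = 0$.\<close>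

definition log_monomial :: "complex \<Rightarrow> nat \<Rightarrow> real \<Rightarrow> complex" where
  "log_monomial z j x = complex_of_real x powr z * complex_of_real ((- ln x) ^ j)"

lemma norm_log_monomial:
  "x \<in> {0..1} \<Longrightarrow> cmod (log_monomial z j x) = Re (log_monomial (of_real (Re z)) j x)"
proof (cases "x = 0")
  case False
  assume "x \<in> {0..1}"
  with False have x: "0 < x" "x \<le> 1" by auto
  then have "0 \<le> (- ln x) ^ j" by (intro zero_le_power) simp
  then have "\<bar>(- ln x) ^ j\<bar> = (- ln x) ^ j" by (rule abs_of_nonneg)
  then have "cmod (log_monomial z j x) = x powr Re z * (- ln x) ^ j"
    using x unfolding log_monomial_def norm_mult norm_of_real by (simp only: norm_powr_real_powr Reals_of_real Re_complex_of_real less_imp_le)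
  moreover have "log_monomial (of_real (Re z)) j x = of_real (x powr Re z * (- ln x) ^ j)"
    using x unfolding log_monomial_def of_real_mult by (simp add: powr_of_real)
  ultimately show ?thesis by simp
qed (simp add: log_monomial_def)

lemma log_monomial_mult:
  "log_monomial z i x * log_monomial w j x = log_monomial (z + w) (i + j) x"
  by (simp add: log_monomial_def powr_add power_add)

lemma tendsto_log_monomial_0:
  assumes "Re z > 0" shows "(log_monomial z j \<longlongrightarrow> 0) (at_right 0)"
proof (rule tendsto_norm_zero_cancel)
  define a where "a = Re z"
  have a: "a > 0" using assms by (simp add: a_def)
  have "filterlim (\<lambda>x::real. - a * ln x) at_top (at_right 0)"
    using filterlim_tendsto_pos_mult_at_bot[OF tendsto_const a ln_at_0]
    by (simp add: filterlim_uminus_at_bot)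
  then have "((\<lambda>x. (- a * ln x) ^ j / exp (- a * ln x)) \<longlongrightarrow> 0) (at_right 0)"
    by (rule filterlim_compose[OF tendsto_power_div_exp_0])
  then have "((\<lambda>x. (- a * ln x) ^ j / exp (- a * ln x) * (1 / a ^ j)) \<longlongrightarrow> 0 * (1 / a ^ j)) (at_right 0)"
    by (intro tendsto_mult tendsto_const)
  moreover have "\<forall>\<^sub>F x in at_right 0. (- a * ln x) ^ j / exp (- a * ln x) * (1 / a ^ j) = cmod (log_monomial z j x)"
    using eventually_at_right_real[of 0 1]
  proof (rule eventually_mono)
    fix x :: real assume x: "x \<in> {0<..<1}"
    then have "log_monomial (of_real a) j x = of_real (x powr a * (- ln x) ^ j)"
      unfolding log_monomial_def of_real_mult by (simp add: powr_of_real)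
    then have "cmod (log_monomial z j x) = x powr a * (- ln x) ^ j"
      using norm_log_monomial[of x z j] x by (simp add: a_def del: of_real_mult)
    also have "x powr a = 1 / exp (- a * ln x)" using x by (simp add: powr_def exp_minus field_simps)
    finally show "(- a * ln x) ^ j / exp (- a * ln x) * (1 / a ^ j) = cmod (log_monomial z j x)"
      using a by (simp add: power_mult_distrib field_simps power_minus[of "a * ln x"] power_minus[of "ln x"])
  qed simp
  ultimately show "((\<lambda>x. cmod (log_monomial z j x)) \<longlongrightarrow> 0) (at_right 0)"
    by (simp add: Lim_transform_eventually)
qed

lemma continuous_on_log_monomial:
  assumes "Re z > 0" shows "continuous_on {0..1} (log_monomial z j)"
proof -
  have "continuous (at x within {0..1}) (log_monomial z j)" if "x \<in> {0..1}" for x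
  proof (cases "x = 0")
    case True
    have "(log_monomial z j \<longlongrightarrow> log_monomial z j 0) (at 0 within {0..1})"
      using tendsto_log_monomial_0[OF assms]
      by (simp add: log_monomial_def[of _ _ 0] at_within_Icc_at_right)
    then show ?thesis by (simp add: True continuous_within)
  next
    case False
    with that have "x > 0" by simp
    then have "isCont (log_monomial z j) x" unfolding log_monomial_def
      by (intro continuous_intros) auto
    then show ?thesis by (rule continuous_at_imp_continuous_at_within)
  qed
  then show ?thesis by (simp add: continuous_on_eq_continuous_within)
qed

lemma has_vector_derivative_powr_of_real:
  assumes "x > 0"
  shows "((\<lambda>x. complex_of_real x powr z) has_vector_derivative z * complex_of_real x powr (z - 1)) (at x)"
  using has_vector_derivative_real_field[OF has_field_derivative_powr[of "complex_of_real x" z]] assms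
  by (simp add: complex_nonpos_Reals_iff)

lemma has_vector_derivative_log_monomial:
  assumes x: "x > 0"
  shows "(log_monomial (z + 1) (Suc j) has_vector_derivative
      (z + 1) * log_monomial z (Suc j) x - of_nat (Suc j) * log_monomial z j x) (at x)"
proof -
  have 1: "((\<lambda>x. (- ln x) ^ Suc j) has_real_derivative - real (Suc j) * (- ln x) ^ j / x) (at x)"
    by (rule DERIV_cong[OF DERIV_power_Suc[of _ "- (1 / x)"]])
       (use x in \<open>auto intro!: derivative_eq_intros simp: divide_simps algebra_simps\<close>)
  have 2: "((\<lambda>x. complex_of_real ((- ln x) ^ Suc j)) has_vector_derivative
      complex_of_real (- real (Suc j) * (- ln x) ^ j / x)) (at x)"
    by (rule has_vector_derivative_of_real[OF 1])
  have 3: "complex_of_real x powr (z + 1) = complex_of_real x powr z * of_real x"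
    using x by (simp add: powr_add)
  show ?thesis
    unfolding log_monomial_def
    by (rule has_vector_derivative_eq_rhs[OF has_vector_derivative_mult[OF has_vector_derivative_powr_of_real[OF x, of "z+1"] 2]])
       (use x 3 in \<open>simp add: field_simps\<close>)
qed

text \<open>For positive exponents of the logarithm the primitive \<open>log_monomial (z + 1) (Suc j)\<close> vanishes at both ends of the interval, so
  its derivative yields the recursion $(z+1)\, I_{j+1} = (j+1)\, I_j$.\<close>

lemma log_monomial_has_integral:
  "Re z > -1 \<Longrightarrow> (log_monomial z j has_integral fact j / (z + 1) ^ Suc j) {0..1}"
proof (induction j)
  case 0
  then have z: "z + 1 \<noteq> 0" by (auto simp: complex_eq_iff)
  have "(log_monomial z 0 has_integral (log_monomial (z + 1) 0 1 / (z + 1) - log_monomial (z + 1) 0 0 / (z + 1))) {0..1}"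
  proof (rule fundamental_theorem_of_calculus_interior)
    show "continuous_on {0..1} (\<lambda>x. log_monomial (z + 1) 0 x / (z + 1))"
      using 0 z by (intro continuous_intros continuous_on_log_monomial) auto
    fix x :: real assume "x \<in> {0<..<1}"
    then show "((\<lambda>x. log_monomial (z + 1) 0 x / (z + 1)) has_vector_derivative log_monomial z 0 x) (at x)"
      using has_vector_derivative_divide[OF has_vector_derivative_powr_of_real[of x "z + 1"], of "z+1"] z
      by (simp add: log_monomial_def)
  qed simp
  moreover have "log_monomial (z + 1) 0 1 / (z + 1) - log_monomial (z + 1) 0 0 / (z + 1) = fact 0 / (z + 1) ^ Suc 0"
    by (simp add: log_monomial_def)
  ultimately show ?case by (simp only:)
next
  case (Suc j)
  then have z: "z + 1 \<noteq> 0" by (auto simp: complex_eq_iff)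
  have "((\<lambda>x. (z + 1) * log_monomial z (Suc j) x - of_nat (Suc j) * log_monomial z j x) has_integral
      log_monomial (z + 1) (Suc j) 1 - log_monomial (z + 1) (Suc j) 0) {0..1}"
    using Suc.prems
    by (intro fundamental_theorem_of_calculus_interior continuous_on_log_monomial has_vector_derivative_log_monomial) auto
  moreover have "log_monomial (z + 1) (Suc j) 1 - log_monomial (z + 1) (Suc j) 0 = 0"
    by (simp add: log_monomial_def)
  ultimately have "((\<lambda>x. (z + 1) * log_monomial z (Suc j) x - of_nat (Suc j) * log_monomial z j x) has_integral 0) {0..1}"
    by simp
  moreover have "((\<lambda>x. of_nat (Suc j) * log_monomial z j x) has_integral of_nat (Suc j) * (fact j / (z + 1) ^ Suc j)) {0..1}"
    using Suc by (intro has_integral_mult_right) auto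
  ultimately have "((\<lambda>x. (z + 1) * log_monomial z (Suc j) x - of_nat (Suc j) * log_monomial z j x + of_nat (Suc j) * log_monomial z j x)
     has_integral 0 + of_nat (Suc j) * (fact j / (z + 1) ^ Suc j)) {0..1}"
    by (rule has_integral_add)
  then have "((\<lambda>x. (1 / (z + 1)) * ((z + 1) * log_monomial z (Suc j) x)) has_integral (1 / (z + 1)) * (of_nat (Suc j) * (fact j / (z + 1) ^ Suc j))) {0..1}"
    by (intro has_integral_mult_right) simp
  moreover have "(1 / (z + 1)) * ((z + 1) * log_monomial z (Suc j) x) = log_monomial z (Suc j) x" for x
    using z by simp
  ultimately show ?case using z by simp
qed

lemma log_monomial_integral:
  assumes "Re z > -1"
  shows "integrable unit_leb (log_monomial z j)"
    and "(\<integral>x. log_monomial z j x \<partial>unit_leb) = fact j / (z + 1) ^ Suc j"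
proof -
  have "log_monomial z j absolutely_integrable_on {0..1}"
  proof (rule absolutely_integrable_integrable_bound)
    show "cmod (log_monomial z j x) \<le> Re (log_monomial (of_real (Re z)) j x)" if "x \<in> {0..1}" for x
      using norm_log_monomial[OF that] by simp
    show "log_monomial z j integrable_on {0..1}"
      using log_monomial_has_integral[OF assms] by blast
    show "(\<lambda>x. Re (log_monomial (of_real (Re z)) j x)) integrable_on {0..1}"
      using has_integral_linear[OF log_monomial_has_integral bounded_linear_Re, of "of_real (Re z)" j] assms
      by (auto simp: o_def)
  qed
  then show i: "integrable unit_leb (log_monomial z j)"
    by (rule absolutely_integrable_imp_integrable) simp
  show "(\<integral>x. log_monomial z j x \<partial>unit_leb) = fact j / (z + 1) ^ Suc j"
    using lebesgue_integral_eq_integral[OF i] integral_unique[OF log_monomial_has_integral[OF assms]] by simp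
qed

lemma log_monomial_L2:
  assumes "Re z > -1/2" shows "log_monomial z j \<in> L2_unit"
proof -
  have "integrable unit_leb (\<lambda>x. (cmod (log_monomial z j x))\<^sup>2)"
  proof (rule Bochner_Integration.integrable_cong[THEN iffD1])
    show "integrable unit_leb (\<lambda>x. cmod (log_monomial (z + z) (j + j) x))"
      using assms by (intro integrable_norm log_monomial_integral(1)) simp
    show "cmod (log_monomial (z + z) (j + j) x) = (cmod (log_monomial z j x))\<^sup>2" for x
      by (simp only: log_monomial_mult[symmetric] norm_mult power2_eq_square)
  qed simp
  moreover have "log_monomial z j \<in> borel_measurable unit_leb"
    using assms by (intro borel_measurable_integrable log_monomial_integral(1)) simp
  ultimately show ?thesis by (simp add: L2_unit_def)
qed

lemma powr_eq_log_monomial: "complex_of_real x powr w = log_monomial w 0 x"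
  by (simp add: log_monomial_def)

lemma powr_L2: "Re w > -1/2 \<Longrightarrow> (\<lambda>x. complex_of_real x powr w) \<in> L2_unit"
  unfolding powr_eq_log_monomial by (rule log_monomial_L2)

lemma powr_L2_norm:
  assumes "Re w > -1/2"
  shows "(L2_norm_unit (\<lambda>x. complex_of_real x powr w))\<^sup>2 = 1 / (2 * Re w + 1)"
proof -
  have "complex_of_real ((L2_norm_unit (\<lambda>x. complex_of_real x powr w))\<^sup>2)
      = (\<integral>x. complex_of_real ((cmod (log_monomial w 0 x))\<^sup>2) \<partial>unit_leb)"
    by (simp only: L2_norm_unit_square powr_eq_log_monomial integral_complex_of_real)
  also have "\<dots> = (\<integral>x. log_monomial (of_real (2 * Re w)) 0 x \<partial>unit_leb)"
  proof (intro Bochner_Integration.integral_cong refl)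
    fix x assume "x \<in> space unit_leb"
    then have x: "x \<ge> 0" by simp
    have "(cmod (log_monomial w 0 x))\<^sup>2 = (x powr Re w)\<^sup>2"
      using x by (simp add: log_monomial_def norm_powr_real_powr)
    also have "\<dots> = x powr (2 * Re w)" by (simp only: power2_eq_square powr_add[symmetric] mult_2)
    finally show "complex_of_real ((cmod (log_monomial w 0 x))\<^sup>2) = log_monomial (of_real (2 * Re w)) 0 x"
      using x by (simp only: log_monomial_def powr_of_real) simp
  qed
  also have "\<dots> = complex_of_real (1 / (2 * Re w + 1))"
    using log_monomial_integral(2)[of "of_real (2 * Re w)" 0] assms by simp
  finally show ?thesis by (simp only: of_real_eq_iff)
qed

lemma mellin_powr:
  assumes "Re (w + s) > -1" shows "mellin (\<lambda>x. complex_of_real x powr w) s = 1 / (w + s + 1)"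
  using log_monomial_integral(2)[OF assms, of 0]
  by (simp add: mellin_def powr_eq_log_monomial log_monomial_mult)

lemma mellin_scale: "mellin (\<lambda>x. c * f x) s = c * mellin f s"
  by (simp add: mellin_def mult.assoc)

lemma mellin_sum:
  assumes "\<And>i. i \<in> I \<Longrightarrow> f i \<in> L2_unit" "Re s > -1/2"
  shows "mellin (\<lambda>x. \<Sum>i\<in>I. f i x) s = (\<Sum>i\<in>I. mellin (f i) s)"
  unfolding mellin_def sum_distrib_right
  by (intro Bochner_Integration.integral_sum L2_unit_mult_integrable assms powr_L2)

lemma mellin_diff:
  assumes "f \<in> L2_unit" "h \<in> L2_unit" "Re s > -1/2"
  shows "mellin (\<lambda>x. f x - h x) s = mellin f s - mellin h s"
  unfolding mellin_def left_diff_distrib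
  by (intro Bochner_Integration.integral_diff L2_unit_mult_integrable assms powr_L2)

lemma norm_mellin_le:
  assumes "f \<in> L2_unit" "Re s > -1/2"
  shows "cmod (mellin f s) \<le> L2_norm_unit f * L2_norm_unit (\<lambda>x. complex_of_real x powr s)"
  unfolding mellin_def by (intro L2_unit_Cauchy_Schwarz assms powr_L2)

lemma mellin_tendsto:
  assumes F: "\<And>n. F n \<in> L2_unit" "f \<in> L2_unit" and lim: "(\<lambda>n. L2_norm_unit (\<lambda>x. F n x - f x)) \<longlonglongrightarrow> 0"
    and s: "Re s > -1/2"
  shows "(\<lambda>n. mellin (F n) s) \<longlonglongrightarrow> mellin f s"
proof -
  have "(\<lambda>n. mellin (F n) s - mellin f s) \<longlonglongrightarrow> 0"
  proof (rule Lim_null_comparison)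
    show "(\<lambda>n. L2_norm_unit (\<lambda>x. F n x - f x) * L2_norm_unit (\<lambda>x. complex_of_real x powr s)) \<longlonglongrightarrow> 0"
      using tendsto_mult_right[OF lim] by simp
    show "\<forall>\<^sub>F n in sequentially. cmod (mellin (F n) s - mellin f s) \<le> L2_norm_unit (\<lambda>x. F n x - f x) * L2_norm_unit (\<lambda>x. complex_of_real x powr s)"
      using norm_mellin_le[OF L2_unit_diff[OF F] s] by (simp add: mellin_diff[OF F s])
  qed
  then show ?thesis by (simp add: LIM_zero_iff)
qed

subsection \<open>Laguerre polynomials in the logarithm\<close>

text \<open>\<open>laguerre_log k\<close> is the Laguerre polynomial $L_k$ evaluated at $-\log x$. These functions
  are orthonormal and their Mellin transforms are the functions $\lambda^k/(s+1)$, so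
  that the unitary map behind the Hardy space of the half-plane is visible on a basis.\<close>

definition laguerre_log :: "nat \<Rightarrow> real \<Rightarrow> complex" where
  "laguerre_log k x = (\<Sum>j\<le>k. (of_nat (k choose j) * (-1) ^ j / fact j) * log_monomial 0 j x)"

lemma laguerre_log_L2: "laguerre_log k \<in> L2_unit"
proof -
  have "(\<lambda>x. \<Sum>j\<le>k. (of_nat (k choose j) * (-1) ^ j / fact j) * log_monomial 0 j x) \<in> L2_unit"
    by (intro L2_unit_sum L2_unit_scale log_monomial_L2) simp
  then show ?thesis by (simp add: laguerre_log_def[abs_def])
qed

lemma mellin_log_monomial_0: "Re s > -1/2 \<Longrightarrow> mellin (log_monomial 0 j) s = fact j / (s + 1) ^ Suc j"
  using log_monomial_integral(2)[of s j]
  by (simp add: mellin_def powr_eq_log_monomial log_monomial_mult)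

lemma mellin_laguerre_log:
  assumes s: "Re s > -1/2"
  shows "(s + 1) * mellin (laguerre_log k) s = (s / (s + 1)) ^ k"
proof -
  have z: "s + 1 \<noteq> 0" using s by (auto simp: complex_eq_iff)
  have "mellin (laguerre_log k) s
      = (\<Sum>j\<le>k. (of_nat (k choose j) * (-1) ^ j / fact j) * (fact j / (s + 1) ^ Suc j))"
  proof -
    define c :: "nat \<Rightarrow> complex" where "c j = of_nat (k choose j) * (-1) ^ j / fact j" for j
    have "laguerre_log k = (\<lambda>x. \<Sum>j\<le>k. c j * log_monomial 0 j x)"
      by (simp add: fun_eq_iff laguerre_log_def c_def)
    then have "mellin (laguerre_log k) s = (\<Sum>j\<le>k. c j * (fact j / (s + 1) ^ Suc j))"
      using s by (simp add: mellin_sum L2_unit_scale log_monomial_L2 mellin_scale mellin_log_monomial_0)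
    then show ?thesis by (simp only: c_def)
  qed
  also have "(s + 1) * \<dots> = (\<Sum>j\<le>k. of_nat (k choose j) * (- 1 / (s + 1)) ^ j * 1 ^ (k - j))"
    unfolding sum_distrib_left power_one mult_1_right power_divide using z
    by (intro sum.cong refl) simp
  also have "\<dots> = (- 1 / (s + 1) + 1) ^ k" by (rule binomial_ring[symmetric])
  also have "- 1 / (s + 1) + 1 = s / (s + 1)" using z by (simp add: field_simps)
  finally show ?thesis .
qed

text \<open>The sum is a $k$-fold difference of the polynomial $m \mapsto \binom mi$, and one difference lowers $i$ by one.\<close>

lemma alternating_binomial_sum:
  "(\<Sum>l\<le>k. of_nat (k choose l) * (-1) ^ l * of_nat ((m + l) choose i))
    = (if k \<le> i then (-1) ^ k * of_nat (m choose (i - k)) else (0 :: complex))"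
proof (induction k arbitrary: m i)
  case (Suc k)
  let ?S = "\<lambda>k m i. \<Sum>l\<le>k. of_nat (k choose l) * (-1) ^ l * (of_nat ((m + l) choose i) :: complex)"
  have "?S (Suc k) m i = of_nat (m choose i) + (\<Sum>l\<le>k. (of_nat (k choose l) + of_nat (k choose Suc l)) * (-1) ^ Suc l * of_nat ((m + Suc l) choose i))"
    by (subst sum.atMost_Suc_shift) simp
  also have "\<dots> = (of_nat (m choose i) + (\<Sum>l\<le>k. of_nat (k choose Suc l) * (-1) ^ Suc l * of_nat ((m + Suc l) choose i)))
      - ?S k (Suc m) i"
    by (simp add: ring_distribs sum.distrib sum_negf sum_subtractf)
  also have "of_nat (m choose i) + (\<Sum>l\<le>k. of_nat (k choose Suc l) * (-1) ^ Suc l * (of_nat ((m + Suc l) choose i) :: complex))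
      = (\<Sum>l\<le>Suc k. of_nat (k choose l) * (-1) ^ l * of_nat ((m + l) choose i))"
    by (subst sum.atMost_Suc_shift) simp
  also have "\<dots> = ?S k m i" by simp
  also have "?S k m i - ?S k (Suc m) i = (if Suc k \<le> i then (-1) ^ Suc k * of_nat (m choose (i - Suc k)) else 0)"
  proof (cases "Suc k \<le> i")
    case True
    then obtain d where "i = k + Suc d" using less_iff_Suc_add[of k i] by auto
    then show ?thesis unfolding Suc.IH by (simp add: algebra_simps)
  next
    case False
    then show ?thesis unfolding Suc.IH by (cases "k = i") auto
  qed
  finally show ?case .
qed simp

text \<open>The value vanishes for $i < k$: $L_k(-\log x)$ is orthogonal to all lower powers of the logarithm.\<close>

lemma integral_laguerre_log_log_monomial:
  "(\<integral>x. laguerre_log k x * log_monomial 0 i x \<partial>unit_leb) = fact i * ((-1) ^ k * of_nat (i choose k))"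
proof -
  have "(\<integral>x. laguerre_log k x * log_monomial 0 i x \<partial>unit_leb)
      = (\<integral>x. (\<Sum>j\<le>k. (of_nat (k choose j) * (-1) ^ j / fact j) * log_monomial 0 (j + i) x) \<partial>unit_leb)"
    by (simp add: laguerre_log_def sum_distrib_right mult.assoc log_monomial_mult)
  also have "\<dots> = (\<Sum>j\<le>k. (of_nat (k choose j) * (-1) ^ j / fact j) * fact (j + i))"
    by (subst Bochner_Integration.integral_sum) (auto simp: log_monomial_integral)
  also have "\<dots> = fact i * (\<Sum>j\<le>k. of_nat (k choose j) * (-1) ^ j * of_nat ((i + j) choose i))"
    unfolding sum_distrib_left
    by (intro sum.cong refl) (simp add: binomial_fact add.commute field_simps)
  also have "\<dots> = fact i * ((-1) ^ k * of_nat (i choose k))"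
    unfolding alternating_binomial_sum by (auto simp: binomial_symmetric[symmetric] binomial_eq_0)
  finally show ?thesis .
qed

lemma laguerre_log_orthonormal:
  "(\<integral>x. laguerre_log k x * laguerre_log l x \<partial>unit_leb) = (if k = l then 1 else 0)"
proof -
  have *: "(\<integral>x. laguerre_log k x * laguerre_log l x \<partial>unit_leb) = (if k = l then 1 else 0)" if "l \<le> k" for k l
  proof -
    have "(\<integral>x. laguerre_log k x * laguerre_log l x \<partial>unit_leb)
        = (\<integral>x. (\<Sum>i\<le>l. (of_nat (l choose i) * (-1) ^ i / fact i) * (laguerre_log k x * log_monomial 0 i x)) \<partial>unit_leb)"
      unfolding laguerre_log_def[of l] sum_distrib_left by (simp add: mult_ac)
    also have "\<dots> = (\<Sum>i\<le>l. (of_nat (l choose i) * (-1) ^ i / fact i) * (fact i * ((-1) ^ k * of_nat (i choose k))))"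
      by (subst Bochner_Integration.integral_sum)
         (auto simp: integral_laguerre_log_log_monomial intro!: integrable_mult_right L2_unit_mult_integrable laguerre_log_L2 log_monomial_L2)
    also have "\<dots> = (\<Sum>i\<le>l. if i = k then 1 else 0)"
      using that by (intro sum.cong refl) (auto simp: binomial_eq_0 simp flip: power_add)
    also have "\<dots> = (if k = l then 1 else 0)" using that by auto
    finally show ?thesis .
  qed
  show ?thesis
    using *[of l k] *[of k l] by (cases "l \<le> k") (auto simp: mult.commute)
qed

lemma laguerre_log_real: "cnj (laguerre_log k x) = laguerre_log k x" if "x \<ge> 0"
  using that by (cases "x = 0") (simp_all add: laguerre_log_def log_monomial_def cnj_powr)

lemma L2_norm_laguerre_log_sum:
  assumes "finite I"
  shows "(L2_norm_unit (\<lambda>x. \<Sum>k\<in>I. a k * laguerre_log k x))\<^sup>2 = (\<Sum>k\<in>I. (cmod (a k))\<^sup>2)"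
proof -
  have "complex_of_real ((L2_norm_unit (\<lambda>x. \<Sum>k\<in>I. a k * laguerre_log k x))\<^sup>2)
      = (\<integral>x. complex_of_real ((cmod (\<Sum>k\<in>I. a k * laguerre_log k x))\<^sup>2) \<partial>unit_leb)"
    by (simp only: L2_norm_unit_square integral_complex_of_real)
  also have "\<dots> = (\<integral>x. (\<Sum>k\<in>I. \<Sum>l\<in>I. (a k * cnj (a l)) * (laguerre_log k x * laguerre_log l x)) \<partial>unit_leb)"
  proof (intro Bochner_Integration.integral_cong refl)
    fix x assume "x \<in> space unit_leb"
    then have "x \<ge> 0" by simp
    then show "complex_of_real ((cmod (\<Sum>k\<in>I. a k * laguerre_log k x))\<^sup>2)
        = (\<Sum>k\<in>I. \<Sum>l\<in>I. (a k * cnj (a l)) * (laguerre_log k x * laguerre_log l x))"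
      by (simp only: complex_norm_square cnj_sum complex_cnj_mult sum_product laguerre_log_real) (simp add: mult_ac)
  qed
  also have "\<dots> = (\<Sum>k\<in>I. \<Sum>l\<in>I. (a k * cnj (a l)) * (if k = l then 1 else 0))"
    by (subst Bochner_Integration.integral_sum, fastforce intro!: Bochner_Integration.integrable_sum integrable_mult_right L2_unit_mult_integrable laguerre_log_L2)
       (subst Bochner_Integration.integral_sum,
         auto simp: laguerre_log_orthonormal intro!: integrable_mult_right L2_unit_mult_integrable laguerre_log_L2)
  also have "\<dots> = (\<Sum>k\<in>I. a k * cnj (a k))"
    using assms by (simp add: if_distrib cong: if_cong)
  also have "\<dots> = complex_of_real (\<Sum>k\<in>I. (cmod (a k))\<^sup>2)"
    by (simp only: complex_norm_square of_real_sum)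
  finally show ?thesis by (simp only: of_real_eq_iff)
qed

subsection \<open>Taylor coefficients\<close>

lemma has_integral_exp_circle:
  "((\<lambda>\<theta>. exp (\<i> * of_int n * of_real \<theta>)) has_integral (if n = 0 then 2 * pi else 0)) {0..2 * pi}"
proof (cases "n = 0")
  case True
  then show ?thesis using has_integral_const_real[of "1::complex" 0 "2 * pi"] by (simp add: scaleR_conv_of_real)
next
  case False
  have "((\<lambda>\<theta>. exp (\<i> * of_int n * of_real \<theta>)) has_integral
     exp (\<i> * of_int n * of_real (2 * pi)) / (\<i> * of_int n) - exp (\<i> * of_int n * of_real 0) / (\<i> * of_int n)) {0..2 * pi}"
  proof (rule fundamental_theorem_of_calculus)
    fix x :: real
    have "((\<lambda>z. exp (\<i> * of_int n * z) / (\<i> * of_int n)) has_field_derivative exp (\<i> * of_int n * of_real x)) (at (of_real x))"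
      using False by (auto intro!: derivative_eq_intros)
    then show "((\<lambda>\<theta>. exp (\<i> * of_int n * of_real \<theta>) / (\<i> * of_int n)) has_vector_derivative exp (\<i> * of_int n * of_real x)) (at x within {0..2 * pi})"
      by (rule has_vector_derivative_at_within[OF has_vector_derivative_real_field])
  qed simp
  moreover have "exp (\<i> * of_int n * of_real (2 * pi)) = 1"
    using exp_integer_2pi[of "of_int n"] by (simp add: mult_ac)
  ultimately show ?thesis using False by simp
qed

lemma circle_mean_polynomial:
  "((\<lambda>\<theta>. (cmod (\<Sum>k<N. a k * (of_real r * exp (\<i> * of_real \<theta>)) ^ k))\<^sup>2) has_integral
     2 * pi * (\<Sum>k<N. (cmod (a k))\<^sup>2 * r ^ (2 * k))) {0..2 * pi}"
proof -
  have "((\<lambda>\<theta>. \<Sum>k<N. \<Sum>l<N. (a k * cnj (a l) * of_real r ^ (k + l)) * exp (\<i> * of_int (int k - int l) * of_real \<theta>)) has_integral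
     (\<Sum>k<N. \<Sum>l<N. (a k * cnj (a l) * of_real r ^ (k + l)) * (if int k - int l = 0 then 2 * pi else 0))) {0..2 * pi}"
    by (intro has_integral_sum has_integral_mult_right has_integral_exp_circle) auto
  also have "(\<lambda>\<theta>. \<Sum>k<N. \<Sum>l<N. (a k * cnj (a l) * of_real r ^ (k + l)) * exp (\<i> * of_int (int k - int l) * of_real \<theta>))
      = (\<lambda>\<theta>. complex_of_real ((cmod (\<Sum>k<N. a k * (of_real r * exp (\<i> * of_real \<theta>)) ^ k))\<^sup>2))"
  proof
    fix \<theta>
    have "exp (\<i> * of_int (int k - int l) * of_real \<theta>) = exp (\<i> * of_real \<theta>) ^ k * cnj (exp (\<i> * of_real \<theta>)) ^ l" for k l
    proof -
      have "\<i> * of_int (int k - int l) * of_real \<theta> = of_nat k * (\<i> * of_real \<theta>) + of_nat l * (- (\<i> * of_real \<theta>))"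
        by (simp add: algebra_simps)
      moreover have "cnj (exp (\<i> * of_real \<theta>)) = exp (- (\<i> * of_real \<theta>))" by (simp add: exp_cnj)
      ultimately show ?thesis by (simp only: exp_add exp_of_nat_mult)
    qed
    then show "(\<Sum>k<N. \<Sum>l<N. (a k * cnj (a l) * of_real r ^ (k + l)) * exp (\<i> * of_int (int k - int l) * of_real \<theta>))
      = complex_of_real ((cmod (\<Sum>k<N. a k * (of_real r * exp (\<i> * of_real \<theta>)) ^ k))\<^sup>2)"
      unfolding complex_norm_square
      by (simp only: cnj_sum complex_cnj_mult complex_cnj_power complex_cnj_complex_of_real sum_product)
         (simp add: power_add power_mult_distrib mult_ac)
  qed
  also have "(\<Sum>k<N. \<Sum>l<N. (a k * cnj (a l) * of_real r ^ (k + l)) * (if int k - int l = 0 then 2 * pi else 0))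
      = complex_of_real (2 * pi * (\<Sum>k<N. (cmod (a k))\<^sup>2 * r ^ (2 * k)))"
  proof -
    have "(\<Sum>l<N. (a k * cnj (a l) * of_real r ^ (k + l)) * (if int k - int l = 0 then 2 * pi else 0))
        = complex_of_real (2 * pi) * (complex_of_real ((cmod (a k))\<^sup>2) * of_real r ^ (k + k))" if "k < N" for k
    proof -
      have "(\<Sum>l<N. (a k * cnj (a l) * of_real r ^ (k + l)) * (if int k - int l = 0 then 2 * pi else 0))
          = (\<Sum>l<N. if l = k then (a k * cnj (a k)) * of_real r ^ (k + k) * complex_of_real (2 * pi) else 0)"
        by (intro sum.cong refl) auto
      also have "\<dots> = (a k * cnj (a k)) * of_real r ^ (k + k) * complex_of_real (2 * pi)" using that by simp
      finally show ?thesis by (simp only: complex_norm_square mult_ac)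
    qed
    then show ?thesis by (simp add: sum_distrib_left flip: mult_2)
  qed
  finally have "((\<lambda>\<theta>. complex_of_real ((cmod (\<Sum>k<N. a k * (of_real r * exp (\<i> * of_real \<theta>)) ^ k))\<^sup>2)) has_integral
      complex_of_real (2 * pi * (\<Sum>k<N. (cmod (a k))\<^sup>2 * r ^ (2 * k)))) {0..2 * pi}" .
  from has_integral_linear[OF this bounded_linear_Re] show ?thesis by (simp only: o_def Re_complex_of_real)
qed

text \<open>Parseval's identity for the Taylor polynomials on the circle of radius $r$, which converge uniformly there, bounds
  $\sum_{n<N} |a_n|^2 r^{2n}$ by the circle mean; then $r \to 1$.\<close>

lemma Hardy2_disk_coefficients:
  assumes \<phi>: "\<phi> \<in> Hardy2_disk"
  obtains a B where "\<And>z. cmod z < 1 \<Longrightarrow> (\<lambda>n. a n * z ^ n) sums \<phi> z"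
    and "\<And>N. (\<Sum>n<N. (cmod (a n))\<^sup>2) \<le> B"
proof -
  define a where "a n = (deriv ^^ n) \<phi> 0 / fact n" for n
  have hol: "\<phi> holomorphic_on ball 0 1" using \<phi> by (simp add: Hardy2_disk_def)
  have sums: "(\<lambda>n. a n * z ^ n) sums \<phi> z" if "cmod z < 1" for z
    using holomorphic_power_series[OF hol, of z] that by (simp add: a_def)
  obtain B where B: "\<And>r. r \<in> {0<..<1} \<Longrightarrow> 1 / (2 * pi) *
       integral {0..2 * pi} (\<lambda>\<theta>. (cmod (\<phi> (of_real r * exp (\<i> * of_real \<theta>))))\<^sup>2) \<le> B"
    using \<phi> unfolding Hardy2_disk_def bdd_above_def by blast
  have bound_r: "(\<Sum>n<N. (cmod (a n))\<^sup>2 * r ^ (2 * n)) \<le> B" if r: "0 < r" "r < 1" for r N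
  proof -
    let ?z = "\<lambda>\<theta>::real. of_real r * exp (\<i> * of_real \<theta>)"
    let ?S = "\<lambda>N \<theta>. (\<Sum>k<N. a k * ?z \<theta> ^ k)"
    have "ereal r < conv_radius a"
    proof -
      have "summable (\<lambda>n. a n * of_real ((r + 1) / 2) ^ n)"
        by (rule sums_summable[OF sums]) (use r in simp)
      from conv_radius_geI[OF this] have "ereal ((r + 1) / 2) \<le> conv_radius a" using r by simp
      moreover have "ereal r < ereal ((r + 1) / 2)" using r by simp
      ultimately show ?thesis by (rule less_le_trans[rotated])
    qed
    then have "uniform_limit (cball 0 r) (\<lambda>n x. \<Sum>i<n. a i * (x - 0) ^ i) (\<lambda>x. suminf (\<lambda>i. a i * (x - 0) ^ i)) sequentially"
      by (rule powser_uniform_limit)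
    then have "uniform_limit (cball 0 r) (\<lambda>n x. \<Sum>i<n. a i * x ^ i) \<phi> sequentially"
      by (rule uniform_limit_cong'[THEN iffD1, rotated -1]) (use r sums in \<open>auto simp: sums_iff\<close>)
    then have u: "uniform_limit {0..2 * pi} ?S (\<lambda>\<theta>. \<phi> (?z \<theta>)) sequentially"
      by (rule uniform_limit_compose') (use r in \<open>auto simp: norm_mult\<close>)
    have c: "continuous_on {0..2 * pi} (\<lambda>\<theta>. \<phi> (?z \<theta>))"
      by (rule uniform_limit_theorem[OF _ u]) (auto intro!: always_eventually continuous_intros)
    have bd: "bounded ((\<lambda>\<theta>. \<phi> (?z \<theta>)) ` {0..2 * pi})"
      by (intro compact_imp_bounded compact_continuous_image c) auto
    have "uniform_limit {0..2 * pi} (\<lambda>N \<theta>. (cmod (?S N \<theta>))\<^sup>2) (\<lambda>\<theta>. (cmod (\<phi> (?z \<theta>)))\<^sup>2) sequentially"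
      unfolding power2_eq_square
      by (intro uniform_lim_mult uniform_limit_intros u) (use bd in \<open>auto simp: bounded_iff\<close>)
    then obtain I J where IJ: "\<And>N. ((\<lambda>\<theta>. (cmod (?S N \<theta>))\<^sup>2) has_integral I N) {0..2 * pi}"
        "((\<lambda>\<theta>. (cmod (\<phi> (?z \<theta>)))\<^sup>2) has_integral J) {0..2 * pi}" "I \<longlonglongrightarrow> J"
      by (rule uniform_limit_integral) (auto intro!: continuous_intros)
    have I: "I N = 2 * pi * (\<Sum>k<N. (cmod (a k))\<^sup>2 * r ^ (2 * k))" for N
      by (rule has_integral_unique[OF IJ(1) circle_mean_polynomial])
    have "I N \<le> J"
    proof (rule incseq_le[OF _ IJ(3)])
      show "incseq I" unfolding I using r by (intro incseq_SucI) auto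
    qed
    moreover have "J \<le> 2 * pi * B"
      using B[of r] r integral_unique[OF IJ(2)] by (simp add: field_simps)
    ultimately have "2 * pi * (\<Sum>k<N. (cmod (a k))\<^sup>2 * r ^ (2 * k)) \<le> 2 * pi * B" unfolding I by linarith
    then show ?thesis by simp
  qed
  have "(\<Sum>n<N. (cmod (a n))\<^sup>2) \<le> B" for N
  proof (rule tendsto_upperbound)
    have "((\<lambda>r. \<Sum>n<N. (cmod (a n))\<^sup>2 * r ^ (2 * n)) \<longlongrightarrow> (\<Sum>n<N. (cmod (a n))\<^sup>2 * 1 ^ (2 * n))) (at_left 1)"
      by (intro tendsto_intros)
    then show "((\<lambda>r. \<Sum>n<N. (cmod (a n))\<^sup>2 * r ^ (2 * n)) \<longlongrightarrow> (\<Sum>n<N. (cmod (a n))\<^sup>2)) (at_left 1)" by simp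
    show "\<forall>\<^sub>F r in at_left 1. (\<Sum>n<N. (cmod (a n))\<^sup>2 * r ^ (2 * n)) \<le> B"
      using eventually_at_left_real[of 0 "1::real"] bound_r by (auto elim: eventually_mono)
  qed simp
  with sums show ?thesis by (rule that)
qed

lemma half_plane_to_disk: "s \<in> half_plane \<Longrightarrow> cmod (s / (s + 1)) < 1"
proof -
  assume s: "s \<in> half_plane"
  then have "s + 1 \<noteq> 0" by (auto simp: complex_eq_iff half_plane_def)
  moreover have "(cmod s)\<^sup>2 < (cmod (s + 1))\<^sup>2"
    using s unfolding cmod_power2 by (simp add: half_plane_def power2_eq_square algebra_simps)
  then have "cmod s < cmod (s + 1)" by (rule power2_less_imp_less) simp
  ultimately show ?thesis by (simp add: norm_divide)
qed

text \<open>The inverse of $\lambda$ is $z \mapsto \frac{z}{1-z}$, and $2\,\mathrm{Re}\frac{z}{1-z} + 1 = \mathrm{Re}\frac{1+z}{1-z}$ is the Poisson kernel of the disk.\<close>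

lemma disk_to_half_plane: "cmod z < 1 \<Longrightarrow> z / (1 - z) \<in> half_plane"
proof -
  assume z: "cmod z < 1"
  then have z1: "1 - z \<noteq> 0" by auto
  have "2 * Re (z / (1 - z)) + 1 = Re ((1 + z) / (1 - z))"
  proof -
    have "(1 + z) / (1 - z) = 2 * (z / (1 - z)) + 1" using z1 by (simp add: field_simps)
    moreover have "Re (2 * w + 1) = 2 * Re w + 1" for w by simp
    ultimately show ?thesis by (simp only:)
  qed
  also have "\<dots> = (1 - (cmod z)\<^sup>2) / (cmod (1 - z))\<^sup>2"
    by (simp add: Re_divide cmod_power2) (simp add: power2_eq_square algebra_simps)
  also have "\<dots> > 0" using z z1 by (simp add: power_less_one_iff abs_square_less_1)
  finally show ?thesis by (simp add: half_plane_def)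
qed

text \<open>Transplanting the Taylor expansion of $\phi$ along $z^k \mapsto L_k(-\log x)$ produces $k \in L^2[0,1]$ by Riesz--Fischer.\<close>

theorem Hardy2_half_plane_mellin:
  assumes g: "g \<in> Hardy2_half_plane"
  shows "\<exists>k\<in>L2_unit. \<forall>s\<in>half_plane. g s = (s + 1) * mellin k s"
proof -
  obtain \<phi> where \<phi>: "\<phi> \<in> Hardy2_disk" and g\<phi>: "\<And>s. s \<in> half_plane \<Longrightarrow> g s = \<phi> (s / (s + 1))"
    using g by (auto simp: Hardy2_half_plane_def)
  obtain a B where sums: "\<And>z. cmod z < 1 \<Longrightarrow> (\<lambda>n. a n * z ^ n) sums \<phi> z"
    and B: "\<And>N. (\<Sum>n<N. (cmod (a n))\<^sup>2) \<le> B"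
    using Hardy2_disk_coefficients[OF \<phi>] by metis
  define F where "F N x = (\<Sum>k<N. a k * laguerre_log k x)" for N x
  have F: "F N \<in> L2_unit" for N
    unfolding F_def by (intro L2_unit_sum L2_unit_scale laguerre_log_L2)
  have Cau: "Cauchy (\<lambda>N. \<Sum>n<N. (cmod (a n))\<^sup>2)"
  proof -
    have "(\<Sum>k\<le>n. (cmod (a k))\<^sup>2) \<le> B" for n using B[of "Suc n"] by (simp only: lessThan_Suc_atMost)
    then have "summable (\<lambda>n. (cmod (a n))\<^sup>2)" by (intro bounded_imp_summable[of _ B]) auto
    then show ?thesis by (simp only: summable_iff_convergent convergent_Cauchy)
  qed
  have diff: "(L2_norm_unit (\<lambda>x. F m x - F n x))\<^sup>2 = \<bar>(\<Sum>n<m. (cmod (a n))\<^sup>2) - (\<Sum>n<n. (cmod (a n))\<^sup>2)\<bar>" for m n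
  proof -
    have *: "(L2_norm_unit (\<lambda>x. F m x - F n x))\<^sup>2 = \<bar>(\<Sum>n<m. (cmod (a n))\<^sup>2) - (\<Sum>n<n. (cmod (a n))\<^sup>2)\<bar>" if "n \<le> m" for m n
    proof -
      have eq: "(\<Sum>k<m. w k) - (\<Sum>k<n. w k) = (\<Sum>k\<in>{n..<m}. w k)" for w :: "nat \<Rightarrow> 'z::ab_group_add"
        using that by (simp add: sum_diff_nat_ivl lessThan_atLeast0)
      show ?thesis unfolding F_def eq by (simp add: L2_norm_laguerre_log_sum sum_nonneg)
    qed
    show ?thesis
      using *[of n m] *[of m n] L2_norm_unit_minus_commute[of "F m" "F n"]
      by (cases "n \<le> m") (auto simp: abs_minus_commute)
  qed
  have "\<exists>M. \<forall>m\<ge>M. \<forall>n\<ge>M. L2_norm_unit (\<lambda>x. F m x - F n x) < e" if e: "e > 0" for e :: real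
  proof -
    obtain M where M: "\<forall>m\<ge>M. \<forall>n\<ge>M. norm ((\<Sum>n<m. (cmod (a n))\<^sup>2) - (\<Sum>n<n. (cmod (a n))\<^sup>2)) < e\<^sup>2"
      using CauchyD[OF Cau, of "e ^ 2"] zero_less_power[OF e, of 2] by blast
    show ?thesis
    proof (intro exI[of _ M] allI impI)
      fix m n assume "m \<ge> M" "n \<ge> M"
      then have "(L2_norm_unit (\<lambda>x. F m x - F n x))\<^sup>2 < e\<^sup>2" using M by (simp add: diff)
      then show "L2_norm_unit (\<lambda>x. F m x - F n x) < e" by (rule power2_less_imp_less) (use e in simp)
    qed
  qed
  from L2_unit_complete[OF F this] obtain k where k: "k \<in> L2_unit" and lim: "(\<lambda>n. L2_norm_unit (\<lambda>x. F n x - k x)) \<longlonglongrightarrow> 0"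
    by blast
  have "g s = (s + 1) * mellin k s" if s: "s \<in> half_plane" for s
  proof -
    have s': "Re s > -1/2" using s by (simp add: half_plane_def)
    have "(\<lambda>N. (s + 1) * mellin (F N) s) \<longlonglongrightarrow> (s + 1) * mellin k s"
      by (intro tendsto_mult_left mellin_tendsto F k lim s')
    moreover have "(s + 1) * mellin (F N) s = (\<Sum>k<N. a k * (s / (s + 1)) ^ k)" for N
      unfolding F_def using s'
      by (simp add: mellin_sum mellin_scale L2_unit_scale laguerre_log_L2 sum_distrib_left mult.left_commute mellin_laguerre_log)
    ultimately have "(\<lambda>n. a n * (s / (s + 1)) ^ n) sums ((s + 1) * mellin k s)"
      by (simp add: sums_def)
    with sums[OF half_plane_to_disk[OF s]] show ?thesis
      unfolding g\<phi>[OF s] by (rule sums_unique2)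
  qed
  with k show ?thesis by blast
qed

lemma Hardy2_half_plane_mult_bounded:
  assumes g: "g \<in> Hardy2_half_plane" and b: "b holomorphic_on half_plane"
    and bound: "\<And>s. s \<in> half_plane \<Longrightarrow> cmod (b s) \<le> M"
  shows "(\<lambda>s. g s * b s) \<in> Hardy2_half_plane"
proof -
  obtain \<phi> where \<phi>: "\<phi> \<in> Hardy2_disk" and g\<phi>: "\<And>s. s \<in> half_plane \<Longrightarrow> g s = \<phi> (s / (s + 1))"
    using g by (auto simp: Hardy2_half_plane_def)
  define \<beta> where "\<beta> z = b (z / (1 - z))" for z
  have hol: "\<phi> holomorphic_on ball 0 1" using \<phi> by (simp add: Hardy2_disk_def)
  have "b \<circ> (\<lambda>z. z / (1 - z)) holomorphic_on ball 0 1"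
    by (rule holomorphic_on_compose_gen[OF _ b])
       (auto intro!: holomorphic_intros disk_to_half_plane)
  then have \<beta>h: "\<beta> holomorphic_on ball 0 1" by (simp add: \<beta>_def[abs_def] o_def)
  have \<beta>b: "cmod (\<beta> z) \<le> M" if "cmod z < 1" for z
    unfolding \<beta>_def by (intro bound disk_to_half_plane that)
  obtain B where B: "\<And>r. r \<in> {0<..<1} \<Longrightarrow> 1 / (2 * pi) *
       integral {0..2 * pi} (\<lambda>\<theta>. (cmod (\<phi> (of_real r * exp (\<i> * of_real \<theta>))))\<^sup>2) \<le> B"
    using \<phi> unfolding Hardy2_disk_def bdd_above_def by blast
  have "(\<lambda>z. \<phi> z * \<beta> z) \<in> Hardy2_disk"
    unfolding Hardy2_disk_def
  proof (intro CollectI conjI holomorphic_intros hol \<beta>h bdd_aboveI2)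
    fix r :: real assume r: "r \<in> {0<..<1}"
    let ?z = "\<lambda>\<theta>::real. of_real r * exp (\<i> * of_real \<theta>)"
    have c: "continuous_on {0..2 * pi} (\<lambda>\<theta>. w (?z \<theta>))" if "w holomorphic_on ball 0 1" for w
      by (rule continuous_on_compose2[OF holomorphic_on_imp_continuous_on[OF that]])
         (use r in \<open>auto intro!: continuous_intros simp: norm_mult\<close>)
    have "integral {0..2 * pi} (\<lambda>\<theta>. (cmod (\<phi> (?z \<theta>) * \<beta> (?z \<theta>)))\<^sup>2)
        \<le> integral {0..2 * pi} (\<lambda>\<theta>. M\<^sup>2 * (cmod (\<phi> (?z \<theta>)))\<^sup>2)"
    proof (rule integral_le)
      show "(\<lambda>\<theta>. (cmod (\<phi> (?z \<theta>) * \<beta> (?z \<theta>)))\<^sup>2) integrable_on {0..2 * pi}"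
        by (intro integrable_continuous_interval continuous_intros c hol \<beta>h)
      show "(\<lambda>\<theta>. M\<^sup>2 * (cmod (\<phi> (?z \<theta>)))\<^sup>2) integrable_on {0..2 * pi}"
        by (intro integrable_continuous_interval continuous_intros c hol)
      show "(cmod (\<phi> (?z \<theta>) * \<beta> (?z \<theta>)))\<^sup>2 \<le> M\<^sup>2 * (cmod (\<phi> (?z \<theta>)))\<^sup>2" for \<theta>
        using r mult_right_mono[OF power_mono[OF \<beta>b[of "?z \<theta>"] norm_ge_zero, of 2], of "(cmod (\<phi> (?z \<theta>)))\<^sup>2"]
        by (simp add: norm_mult power_mult_distrib mult.commute)
    qed
    also have "\<dots> = M\<^sup>2 * integral {0..2 * pi} (\<lambda>\<theta>. (cmod (\<phi> (?z \<theta>)))\<^sup>2)" by simp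
    also have "\<dots> \<le> M\<^sup>2 * (2 * pi * B)"
      using B[OF r] by (intro mult_left_mono) (auto simp: field_simps)
    finally show "1 / (2 * pi) * integral {0..2 * pi} (\<lambda>\<theta>. (cmod (\<phi> (?z \<theta>) * \<beta> (?z \<theta>)))\<^sup>2) \<le> M\<^sup>2 * B"
      by (simp add: field_simps)
  qed
  moreover have "g s * b s = \<phi> (s / (s + 1)) * \<beta> (s / (s + 1))" if s: "s \<in> half_plane" for s
  proof -
    have "s + 1 \<noteq> 0" using s by (auto simp: complex_eq_iff half_plane_def)
    then have "s / (s + 1) / (1 - s / (s + 1)) = s" by (simp add: field_simps)
    then show ?thesis by (simp add: g\<phi>[OF s] \<beta>_def)
  qed
  ultimately show ?thesis
    unfolding Hardy2_half_plane_def by (intro CollectI bexI[of _ "\<lambda>z. \<phi> z * \<beta> z"] ballI)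
qed

section \<open>Cauchy kernels on a vertical line\<close>

lemma integral_line_FTC:
  fixes f F :: "real \<Rightarrow> 'a::euclidean_space"
  assumes F: "\<And>x. (F has_vector_derivative f x) (at x)" and "\<And>x. isCont f x"
    and f: "integrable lborel f" and "(F \<longlongrightarrow> A) at_bot" "(F \<longlongrightarrow> B) at_top"
  shows "(\<integral>x. f x \<partial>lborel) = B - A"
proof -
  have "(LBINT x=-\<infinity>..\<infinity>. f x) = B - A"
    using assms by (intro interval_integral_FTC_integrable[of "-\<infinity>" "\<infinity>" F])
      (auto simp: ereal_tendsto_simps set_integrable_def einterval_eq)
  then show ?thesis by (simp add: interval_lebesgue_integral_def set_lebesgue_integral_def)
qed

lemma cauchy_density_integral:
  assumes p: "p > 0"
  shows "integrable lborel (\<lambda>u. 1 / (p\<^sup>2 + (u - t)\<^sup>2))" (is "integrable _ ?f")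
    and "(\<integral>u. 1 / (p\<^sup>2 + (u - t)\<^sup>2) \<partial>lborel) = pi / p"
proof -
  define F where "F u = arctan ((u - t) / p) / p" for u
  have pos: "p\<^sup>2 + (u - t)\<^sup>2 > 0" for u using p by (simp add: add_pos_nonneg)
  have 1: "DERIV F u :> ?f u" for u
  proof -
    have "DERIV F u :> inverse (1 + ((u - t) / p)\<^sup>2) * (1 / p) / p"
      unfolding F_def using p by (auto intro!: derivative_eq_intros)
    moreover have "inverse (1 + a / p\<^sup>2) * (1 / p) / p = 1 / (p\<^sup>2 + a)" if "p\<^sup>2 + a > 0" for a
    proof -
      have "1 + a / p\<^sup>2 = (p\<^sup>2 + a) / p\<^sup>2" using p by (simp add: field_simps)
      then show ?thesis using p that by (simp add: power2_eq_square)
    qed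
    ultimately show ?thesis using pos[of u] by (simp add: power_divide)
  qed
  have 2: "isCont ?f u" for u
    using pos[of u] by (intro continuous_intros) auto
  have lt: "filterlim (\<lambda>u. (u - t) / p) at_top at_top" "filterlim (\<lambda>u. (u - t) / p) at_bot at_bot"
    using p by real_asymp+
  have top: "(F \<longlongrightarrow> (pi / 2) / p) at_top" and bot: "(F \<longlongrightarrow> (- (pi / 2)) / p) at_bot"
    unfolding F_def using p
    by (intro tendsto_divide tendsto_const filterlim_compose[OF tendsto_arctan_at_top lt(1)]
         filterlim_compose[OF tendsto_arctan_at_bot lt(2)]; simp)+
  have "set_integrable lborel (einterval (-\<infinity>) \<infinity>) ?f"
    by (rule interval_integral_FTC_nonneg(1)[of "-\<infinity>" "\<infinity>" F])
       (use 1 2 pos bot top in \<open>auto simp: ereal_tendsto_simps less_imp_le\<close>)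
  then show i: "integrable lborel ?f" by (simp add: set_integrable_def)
  have "(\<integral>u. ?f u \<partial>lborel) = (pi / 2) / p - (- (pi / 2)) / p"
    using 1 2 i bot top by (intro integral_line_FTC[of F]) (simp_all add: has_real_derivative_iff_has_vector_derivative)
  then show "(\<integral>u. ?f u \<partial>lborel) = pi / p" by (simp add: field_simps)
qed

text \<open>The factor $u$ can be pulled out of the logarithm, which leaves $\mathrm{Ln}(c/u + i) \to \mathrm{Ln}\, i$.\<close>

lemma Ln_vertical_at_top:
  fixes c :: complex
  assumes c: "Re c > 0"
  shows "((\<lambda>u. Ln (c + \<i> * of_real u) - of_real (ln u)) \<longlongrightarrow> \<i> * of_real (pi / 2)) at_top"
proof -
  have "((\<lambda>u. c / of_real u + \<i>) \<longlongrightarrow> 0 + \<i>) at_top"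
    by (intro tendsto_intros tendsto_divide_0[OF tendsto_const] filterlim_of_real_at_infinity)
  then have "((\<lambda>u::real. c / of_real u + \<i>) \<longlongrightarrow> \<i>) at_top" by simp
  then have "((\<lambda>u::real. Ln (c / of_real u + \<i>)) \<longlongrightarrow> Ln \<i>) at_top"
    by (intro tendsto_Ln) (auto simp: complex_nonpos_Reals_iff)
  moreover have "\<forall>\<^sub>F u in at_top. Ln (c / of_real u + \<i>) = Ln (c + \<i> * of_real u) - of_real (ln u)"
    using eventually_gt_at_top[of 0]
  proof eventually_elim
    case (elim u)
    have "Re (c / of_real u + \<i>) > 0" using c elim by simp
    then have "c / of_real u + \<i> \<noteq> 0" by (metis less_irrefl zero_complex.sel(1))
    moreover have "c + \<i> * of_real u = of_real u * (c / of_real u + \<i>)" using elim by (simp add: field_simps)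
    ultimately show ?case using elim by (simp add: Ln_times_of_real Ln_of_real)
  qed
  ultimately show ?thesis by (simp add: Lim_transform_eventually)
qed

lemma Ln_vertical_at_top':
  fixes c :: complex
  assumes c: "Re c > 0"
  shows "((\<lambda>u. Ln (c - \<i> * of_real u) - of_real (ln u)) \<longlongrightarrow> - \<i> * of_real (pi / 2)) at_top"
proof -
  have "((\<lambda>u. cnj (Ln (cnj c + \<i> * of_real u) - of_real (ln u))) \<longlongrightarrow> cnj (\<i> * of_real (pi / 2))) at_top"
    by (intro tendsto_cnj Ln_vertical_at_top) (use c in simp)
  moreover have "cnj (Ln (cnj c + \<i> * of_real u)) = Ln (c - \<i> * of_real u)" for u
  proof -
    have "cnj c + \<i> * of_real u \<notin> \<real>\<^sub>\<le>\<^sub>0" using c by (auto simp: complex_nonpos_Reals_iff)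
    from cnj_Ln[OF this] show ?thesis by simp
  qed
  ultimately show ?thesis by simp
qed

lemma has_vector_derivative_Ln_vertical:
  fixes c :: complex
  assumes c: "Re c > 0" and e: "e \<in> {1, -1}"
  shows "((\<lambda>u. Ln (c + of_real e * \<i> * of_real u)) has_vector_derivative of_real e * \<i> / (c + of_real e * \<i> * of_real u)) (at u)"
proof -
  have "c + of_real e * \<i> * of_real u \<notin> \<real>\<^sub>\<le>\<^sub>0" using c by (auto simp: complex_nonpos_Reals_iff)
  then have "((\<lambda>z. Ln (c + of_real e * \<i> * z)) has_field_derivative of_real e * \<i> / (c + of_real e * \<i> * of_real u)) (at (of_real u))"
    by (auto intro!: derivative_eq_intros simp: divide_inverse mult.commute)
  then show ?thesis by (rule has_vector_derivative_real_field)
qed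

lemma vertical_nonzero:
  fixes c :: complex
  shows "Re c > 0 \<Longrightarrow> c + \<i> * of_real u \<noteq> 0" "Re c > 0 \<Longrightarrow> c - \<i> * of_real u \<noteq> 0"
  by (auto simp: complex_eq_iff)

lemma norm_vertical_square:
  fixes c :: complex
  shows
  "(cmod (1 / (c + \<i> * of_real u)))\<^sup>2 = 1 / ((Re c)\<^sup>2 + (u - (- Im c))\<^sup>2)"
  "(cmod (1 / (c - \<i> * of_real u)))\<^sup>2 = 1 / ((Re c)\<^sup>2 + (u - Im c)\<^sup>2)"
  by (simp_all add: norm_divide power_divide cmod_power2 power2_commute add.commute)

lemma cauchy_kernel_integrable:
  fixes c d :: complex
  assumes c: "Re c > 0" and d: "Re d > 0"
  shows "integrable lborel (\<lambda>u. 1 / ((c + \<i> * of_real u) * (d - \<i> * of_real u)))"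
    and "integrable lborel (\<lambda>u. 1 / ((c + \<i> * of_real u) * (d + \<i> * of_real u)))"
proof -
  have *: "integrable lborel (\<lambda>u. f u * h u)"
    if [measurable]: "f \<in> borel_measurable borel" "h \<in> borel_measurable borel"
      and "integrable lborel (\<lambda>u. (cmod (f u))\<^sup>2)" "integrable lborel (\<lambda>u. (cmod (h u))\<^sup>2)" for f h :: "real \<Rightarrow> complex"
  proof (rule Bochner_Integration.integrable_bound)
    show "integrable lborel (\<lambda>u. (cmod (f u))\<^sup>2 + (cmod (h u))\<^sup>2)" using that by simp
    have "a * b \<le> a\<^sup>2 + b\<^sup>2" if "a \<ge> 0" "b \<ge> 0" for a b :: real
      using sum_squares_bound[of a b] that mult_nonneg_nonneg[of a b] by linarith
    then show "AE x in lborel. norm (f x * h x) \<le> norm ((cmod (f x))\<^sup>2 + (cmod (h x))\<^sup>2)"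
      by (simp add: norm_mult)
  qed simp
  have m: "(\<lambda>u. 1 / (a + \<i> * complex_of_real u)) \<in> borel_measurable borel"
          "(\<lambda>u. 1 / (a - \<i> * complex_of_real u)) \<in> borel_measurable borel" if "Re a > 0" for a :: complex
    using vertical_nonzero[OF that] by (auto intro!: borel_measurable_continuous_onI continuous_intros)
  have i: "integrable lborel (\<lambda>u. (cmod (1 / (a + \<i> * complex_of_real u)))\<^sup>2)"
          "integrable lborel (\<lambda>u. (cmod (1 / (a - \<i> * complex_of_real u)))\<^sup>2)" if "Re a > 0" for a :: complex
    unfolding norm_vertical_square using cauchy_density_integral(1)[OF that] by blast+
  show "integrable lborel (\<lambda>u. 1 / ((c + \<i> * of_real u) * (d - \<i> * of_real u)))"
    using *[OF m(1)[OF c] m(2)[OF d] i(1)[OF c] i(2)[OF d]] by simp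
  show "integrable lborel (\<lambda>u. 1 / ((c + \<i> * of_real u) * (d + \<i> * of_real u)))"
    using *[OF m(1)[OF c] m(1)[OF d] i(1)[OF c] i(1)[OF d]] by simp
qed

text \<open>Partial fractions. In the primitive the growing terms $\ln|u|$ cancel, and the increments of the two arguments, each $\pi$, add up.\<close>

lemma cauchy_kernel_integral:
  fixes c d :: complex
  assumes c: "Re c > 0" and d: "Re d > 0"
  shows "(\<integral>u. 1 / ((c + \<i> * of_real u) * (d - \<i> * of_real u)) \<partial>lborel) = 2 * pi / (c + d)"
proof -
  define F where "F u = (Ln (c + \<i> * of_real u) - Ln (d - \<i> * of_real u)) / (\<i> * (c + d))" for u
  have cd: "c + d \<noteq> 0" using c d by (auto simp: complex_eq_iff)
  have lim: "((\<lambda>u. (Ln (c + \<i> * of_real u) - of_real (ln u)) - (Ln (d - \<i> * of_real u) - of_real (ln u))) \<longlongrightarrow>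
      \<i> * of_real (pi / 2) - (- \<i> * of_real (pi / 2))) at_top"
    if "Re c > 0" "Re d > 0" for c d :: complex
    using that by (intro tendsto_diff Ln_vertical_at_top Ln_vertical_at_top')
  have 1: "(F has_vector_derivative 1 / ((c + \<i> * of_real u) * (d - \<i> * of_real u))) (at u)" for u
  proof -
    have "(F has_vector_derivative (\<i> / (c + \<i> * of_real u) - (- \<i>) / (d - \<i> * of_real u)) / (\<i> * (c + d))) (at u)"
      unfolding F_def
      using has_vector_derivative_Ln_vertical[OF c, of 1 u] has_vector_derivative_Ln_vertical[OF d, of "-1" u]
      by (intro has_vector_derivative_divide has_vector_derivative_diff) simp_all
    also have "(\<i> / (c + \<i> * of_real u) - (- \<i>) / (d - \<i> * of_real u)) / (\<i> * (c + d)) = 1 / ((c + \<i> * of_real u) * (d - \<i> * of_real u))"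
    proof -
      have "w \<noteq> 0 \<Longrightarrow> v \<noteq> 0 \<Longrightarrow> w + v \<noteq> 0 \<Longrightarrow> (\<i> / w - (- \<i>) / v) / (\<i> * (w + v)) = 1 / (w * v)" for w v
        by (simp add: divide_simps) (simp add: algebra_simps)
      from this[of "c + \<i> * of_real u" "d - \<i> * of_real u"] show ?thesis
        using vertical_nonzero(1)[OF c, of u] vertical_nonzero(2)[OF d, of u] cd by simp
    qed
    finally show ?thesis .
  qed
  have top: "(F \<longlongrightarrow> pi / (c + d)) at_top"
    using tendsto_divide[OF lim[OF c d] tendsto_const[of "\<i> * (c + d)"]] cd
    by (simp add: F_def[abs_def])
  have "((\<lambda>u. - ((Ln (d + \<i> * of_real u) - of_real (ln u)) - (Ln (c - \<i> * of_real u) - of_real (ln u))) / (\<i> * (c + d))) \<longlongrightarrow>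
      - (\<i> * of_real (pi / 2) - (- \<i> * of_real (pi / 2))) / (\<i> * (c + d))) at_top"
    using cd by (intro tendsto_divide tendsto_minus lim c d tendsto_const) auto
  also have "(\<lambda>u. - ((Ln (d + \<i> * of_real u) - of_real (ln u)) - (Ln (c - \<i> * of_real u) - of_real (ln u))) / (\<i> * (c + d))) = (\<lambda>u. F (- u))"
    by (simp add: F_def fun_eq_iff)
  finally have bot: "(F \<longlongrightarrow> - (pi / (c + d))) at_bot"
    using cd unfolding filterlim_at_bot_mirror by simp
  have "(\<integral>u. 1 / ((c + \<i> * of_real u) * (d - \<i> * of_real u)) \<partial>lborel) = pi / (c + d) - (- (pi / (c + d)))"
  proof (rule integral_line_FTC[OF 1 _ cauchy_kernel_integrable(1)[OF c d] bot top])
    show "isCont (\<lambda>u. 1 / ((c + \<i> * of_real u) * (d - \<i> * of_real u))) u" for u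
      using vertical_nonzero(1)[OF c, of u] vertical_nonzero(2)[OF d, of u] by (intro continuous_intros) auto
  qed
  then show ?thesis by simp
qed

text \<open>Here both poles lie on the same side of the line and the increments of the arguments cancel. For $c = d$ the partial fractions
  degenerate to a double pole with a rational primitive.\<close>

lemma cauchy_kernel_integral_0:
  fixes c d :: complex
  assumes c: "Re c > 0" and d: "Re d > 0"
  shows "(\<integral>u. 1 / ((c + \<i> * of_real u) * (d + \<i> * of_real u)) \<partial>lborel) = 0"
proof -
  have cont: "isCont (\<lambda>u. 1 / ((c + \<i> * of_real u) * (d + \<i> * of_real u))) u" for u
    using vertical_nonzero(1)[OF c, of u] vertical_nonzero(1)[OF d, of u] by (intro continuous_intros) auto
  show ?thesis
  proof (cases "c = d")
    case True
    define F where "F u = \<i> / (c + \<i> * of_real u)" for u :: real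
    have 1: "(F has_vector_derivative 1 / ((c + \<i> * of_real u) * (d + \<i> * of_real u))) (at u)" for u
    proof -
      have "((\<lambda>z. \<i> / (c + \<i> * z)) has_field_derivative 1 / ((c + \<i> * of_real u) * (d + \<i> * of_real u))) (at (of_real u))"
        using vertical_nonzero(1)[OF c, of u] True
        by (auto intro!: derivative_eq_intros simp: power2_eq_square)
      then show ?thesis unfolding F_def by (rule has_vector_derivative_real_field)
    qed
    have inf: "filterlim (\<lambda>u. c + \<i> * complex_of_real u) at_infinity G" if "filterlim (\<lambda>u. complex_of_real u) at_infinity G" for G
      by (intro tendsto_add_filterlim_at_infinity[OF tendsto_const] tendsto_mult_filterlim_at_infinity[OF tendsto_const] that) simp
    have "(F \<longlongrightarrow> 0) at_top" "(F \<longlongrightarrow> 0) at_bot" unfolding F_def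
      by (intro tendsto_divide_0[OF tendsto_const] inf;
          simp add: filterlim_at_infinity_conv_norm_at_top, real_asymp)+
    then show ?thesis
      using integral_line_FTC[OF 1 cont cauchy_kernel_integrable(2)[OF c d], of 0 0] by simp
  next
    case False
    then have dc: "d - c \<noteq> 0" by simp
    define F where "F u = (Ln (c + \<i> * of_real u) - Ln (d + \<i> * of_real u)) / (\<i> * (d - c))" for u
    have 1: "(F has_vector_derivative 1 / ((c + \<i> * of_real u) * (d + \<i> * of_real u))) (at u)" for u
    proof -
      have "(F has_vector_derivative (\<i> / (c + \<i> * of_real u) - \<i> / (d + \<i> * of_real u)) / (\<i> * (d - c))) (at u)"
        unfolding F_def
        using has_vector_derivative_Ln_vertical[OF c, of 1 u] has_vector_derivative_Ln_vertical[OF d, of 1 u]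
        by (intro has_vector_derivative_divide has_vector_derivative_diff) simp_all
      also have "(\<i> / (c + \<i> * of_real u) - \<i> / (d + \<i> * of_real u)) / (\<i> * (d - c)) = 1 / ((c + \<i> * of_real u) * (d + \<i> * of_real u))"
      proof -
        have "w \<noteq> 0 \<Longrightarrow> v \<noteq> 0 \<Longrightarrow> v - w \<noteq> 0 \<Longrightarrow> (\<i> / w - \<i> / v) / (\<i> * (v - w)) = 1 / (w * v)" for w v
          by (simp add: divide_simps) (simp add: algebra_simps)
        from this[of "c + \<i> * of_real u" "d + \<i> * of_real u"] show ?thesis
          using vertical_nonzero(1)[OF c, of u] vertical_nonzero(1)[OF d, of u] dc by simp
      qed
      finally show ?thesis .
    qed
    have "((\<lambda>u. ((Ln (c + \<i> * of_real u) - of_real (ln u)) - (Ln (d + \<i> * of_real u) - of_real (ln u))) / (\<i> * (d - c))) \<longlongrightarrow>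
       (\<i> * of_real (pi / 2) - \<i> * of_real (pi / 2)) / (\<i> * (d - c))) at_top"
      using dc by (intro tendsto_divide tendsto_diff Ln_vertical_at_top c d tendsto_const) auto
    then have top: "(F \<longlongrightarrow> 0) at_top" by (simp add: F_def[abs_def])
    have "((\<lambda>u. ((Ln (c - \<i> * of_real u) - of_real (ln u)) - (Ln (d - \<i> * of_real u) - of_real (ln u))) / (\<i> * (d - c))) \<longlongrightarrow>
       (- \<i> * of_real (pi / 2) - (- \<i> * of_real (pi / 2))) / (\<i> * (d - c))) at_top"
      using dc by (intro tendsto_divide tendsto_diff Ln_vertical_at_top' c d tendsto_const) auto
    then have bot: "(F \<longlongrightarrow> 0) at_bot"
      unfolding filterlim_at_bot_mirror by (simp add: F_def[abs_def])
    show ?thesis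
      using integral_line_FTC[OF 1 cont cauchy_kernel_integrable(2)[OF c d] bot top] by simp
  qed
qed

section \<open>Mellin transforms of polynomials\<close>

abbreviation line :: "real \<Rightarrow> complex" where
  "line y \<equiv> Complex (-1/2) y"

text \<open>The Mellin transform of a polynomial in closed form, so that boundary values on the line are values of a rational function.\<close>

definition poly_mellin :: "complex poly \<Rightarrow> complex \<Rightarrow> complex" where
  "poly_mellin p s = (\<Sum>m\<le>degree p. coeff p m / (of_nat m + 1 + s))"

lemma mellin_poly:
  assumes s: "Re s > -1/2"
  shows "mellin (poly_fun p) s = poly_mellin p s"
proof -
  have "mellin (poly_fun p) s
      = mellin (\<lambda>x. \<Sum>m\<le>degree p. coeff p m * complex_of_real x powr of_nat m) s"
    unfolding mellin_def
  proof (intro Bochner_Integration.integral_cong refl)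
    fix x :: real
    show "poly p (complex_of_real x) * complex_of_real x powr s
        = (\<Sum>m\<le>degree p. coeff p m * complex_of_real x powr of_nat m) * complex_of_real x powr s"
      by (cases "x = 0") (auto simp: poly_altdef)
  qed
  also have "\<dots> = (\<Sum>m\<le>degree p. coeff p m * mellin (\<lambda>x. complex_of_real x powr of_nat m) s)"
    using s by (subst mellin_sum) (auto simp: mellin_scale intro!: L2_unit_scale powr_L2)
  also have "\<dots> = poly_mellin p s"
    unfolding poly_mellin_def using s by (intro sum.cong refl) (simp add: mellin_powr add_ac)
  finally show ?thesis .
qed

lemma poly_mellin_vertical:
  "poly_mellin p (line y + of_real \<sigma>) = (\<Sum>m\<le>degree p. coeff p m * (1 / (of_real (real m + 1/2 + \<sigma>) + \<i> * of_real y)))"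
  unfolding poly_mellin_def
  by (intro sum.cong refl) (simp add: Complex_eq add_ac)

lemma continuous_on_poly_mellin_vertical:
  "\<sigma> \<ge> 0 \<Longrightarrow> continuous_on UNIV (\<lambda>y. poly_mellin p (line y + of_real \<sigma>))"
  unfolding poly_mellin_vertical
  by (intro continuous_intros) (auto simp: complex_eq_iff)

lemma poly_mellin_tendsto:
  "((\<lambda>\<sigma>. poly_mellin p (line y + of_real \<sigma>)) \<longlongrightarrow> poly_mellin p (line y)) (at_right 0)"
proof -
  have "((\<lambda>\<sigma>. poly_mellin p (line y + of_real \<sigma>)) \<longlongrightarrow> poly_mellin p (line y + of_real 0)) (at_right 0)"
    unfolding poly_mellin_vertical by (intro tendsto_intros) (auto simp: complex_eq_iff)
  then show ?thesis by simp
qed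

lemma L2_norm_poly:
  "complex_of_real ((L2_norm_unit (poly_fun p))\<^sup>2)
    = (\<Sum>m\<le>degree p. \<Sum>n\<le>degree p. (coeff p m * cnj (coeff p n)) / (of_nat m + of_nat n + 1))"
proof -
  have "complex_of_real ((L2_norm_unit (poly_fun p))\<^sup>2)
      = (\<integral>x. complex_of_real ((cmod (poly p (complex_of_real x)))\<^sup>2) \<partial>unit_leb)"
    by (simp only: L2_norm_unit_square integral_complex_of_real)
  also have "\<dots> = (\<integral>x. (\<Sum>m\<le>degree p. \<Sum>n\<le>degree p. (coeff p m * cnj (coeff p n)) * complex_of_real x ^ (m + n)) \<partial>unit_leb)"
    by (intro Bochner_Integration.integral_cong refl)
       (simp only: complex_norm_square poly_altdef cnj_sum complex_cnj_mult complex_cnj_power complex_cnj_complex_of_real sum_product power_add mult_ac)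
  also have "\<dots> = (\<Sum>m\<le>degree p. \<Sum>n\<le>degree p. (coeff p m * cnj (coeff p n)) * (1 / (of_nat (m + n) + 1)))"
  proof -
    have hi: "((\<lambda>x. complex_of_real x ^ k) has_integral 1 / (of_nat k + 1)) {0..1}" for k
    proof -
      have "((\<lambda>x. complex_of_real x ^ k) has_integral complex_of_real 1 ^ Suc k / (of_nat k + 1) - complex_of_real 0 ^ Suc k / (of_nat k + 1)) {0..1}"
      proof (rule fundamental_theorem_of_calculus)
        fix x :: real
        have "complex_of_nat k + 1 \<noteq> 0" by (auto simp: complex_eq_iff)
        then have "((\<lambda>z::complex. z ^ Suc k / (of_nat k + 1)) has_field_derivative complex_of_real x ^ k) (at (of_real x))"
          by (intro DERIV_cong[OF DERIV_cdivide[OF DERIV_power_Suc[OF DERIV_ident]]]) (simp add: add.commute)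
        then show "((\<lambda>x. complex_of_real x ^ Suc k / (of_nat k + 1)) has_vector_derivative complex_of_real x ^ k) (at x within {0..1})"
          by (rule has_vector_derivative_at_within[OF has_vector_derivative_real_field])
      qed simp
      then show ?thesis by simp
    qed
    have i: "integrable unit_leb (\<lambda>x. complex_of_real x ^ k)" for k
      by (intro absolutely_integrable_imp_integrable absolutely_integrable_continuous_real continuous_intros) simp
    have v: "(\<integral>x. complex_of_real x ^ k \<partial>unit_leb) = 1 / (of_nat k + 1)" for k
      using lebesgue_integral_eq_integral[OF i] integral_unique[OF hi] by simp
    show ?thesis
      by (simp add: Bochner_Integration.integral_sum i v)
  qed
  finally show ?thesis by simp
qed

text \<open>Plancherel for polynomials: both sides are the same quadratic form in the coefficients, because
  $\int \frac{dy}{(c+iy)(d-iy)} = \frac{2\pi}{c+d}$.\<close>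

lemma poly_mellin_Plancherel:
  shows "integrable lborel (\<lambda>y. (cmod (poly_mellin p (line y)))\<^sup>2)"
    and "(\<integral>y. (cmod (poly_mellin p (line y)))\<^sup>2 \<partial>lborel) = 2 * pi * (L2_norm_unit (poly_fun p))\<^sup>2"
proof -
  let ?c = "\<lambda>m::nat. complex_of_real (real m + 1/2)"
  have eq: "complex_of_real ((cmod (poly_mellin p (line y)))\<^sup>2)
     = (\<Sum>m\<le>degree p. \<Sum>n\<le>degree p. (coeff p m * cnj (coeff p n)) * (1 / ((?c m + \<i> * of_real y) * (?c n - \<i> * of_real y))))" for y
  proof -
    have "poly_mellin p (line y) = (\<Sum>m\<le>degree p. coeff p m * (1 / (?c m + \<i> * of_real y)))"
      using poly_mellin_vertical[of p y 0] by simp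
    then show ?thesis
      by (simp only: complex_norm_square cnj_sum complex_cnj_mult complex_cnj_divide complex_cnj_add complex_cnj_complex_of_real
            complex_cnj_i complex_cnj_one sum_product) (simp add: mult_ac)
  qed
  have i: "integrable lborel (\<lambda>y. 1 / ((?c m + \<i> * of_real y) * (?c n - \<i> * of_real y)))" for m n
    by (rule cauchy_kernel_integrable(1)) auto
  have "integrable lborel (\<lambda>y. complex_of_real ((cmod (poly_mellin p (line y)))\<^sup>2))"
    unfolding eq by (intro Bochner_Integration.integrable_sum integrable_mult_right i)
  then show *: "integrable lborel (\<lambda>y. (cmod (poly_mellin p (line y)))\<^sup>2)"
    by (simp only: complex_of_real_integrable_eq)
  have "complex_of_real (\<integral>y. (cmod (poly_mellin p (line y)))\<^sup>2 \<partial>lborel)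
      = (\<integral>y. complex_of_real ((cmod (poly_mellin p (line y)))\<^sup>2) \<partial>lborel)"
    by (simp only: integral_complex_of_real)
  also have "\<dots> = (\<Sum>m\<le>degree p. \<Sum>n\<le>degree p. (coeff p m * cnj (coeff p n)) * (2 * pi / (?c m + ?c n)))"
    unfolding eq
    by (subst Bochner_Integration.integral_sum, intro Bochner_Integration.integrable_sum integrable_mult_right i)
       (subst Bochner_Integration.integral_sum, intro integrable_mult_right i,
        subst integral_mult_right_zero, subst cauchy_kernel_integral, auto)
  also have "\<dots> = 2 * pi * complex_of_real ((L2_norm_unit (poly_fun p))\<^sup>2)"
    unfolding L2_norm_poly sum_distrib_left
    by (intro sum.cong refl) (simp add: add_ac)
  finally have "complex_of_real (\<integral>y. (cmod (poly_mellin p (line y)))\<^sup>2 \<partial>lborel)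
      = complex_of_real (2 * pi * (L2_norm_unit (poly_fun p))\<^sup>2)" by simp
  then show "(\<integral>y. (cmod (poly_mellin p (line y)))\<^sup>2 \<partial>lborel) = 2 * pi * (L2_norm_unit (poly_fun p))\<^sup>2"
    by (simp only: of_real_eq_iff)
qed

section \<open>Poisson kernels and the maximal inequality\<close>

definition poisson_kernel :: "real \<Rightarrow> real \<Rightarrow> real" where
  "poisson_kernel \<sigma> v = \<sigma> / (pi * (\<sigma>\<^sup>2 + v\<^sup>2))"

lemma poisson_kernel_nonneg: "\<sigma> > 0 \<Longrightarrow> poisson_kernel \<sigma> v \<ge> 0"
  by (simp add: poisson_kernel_def)

lemma poisson_kernel_minus: "poisson_kernel \<sigma> (- v) = poisson_kernel \<sigma> v"
  by (simp add: poisson_kernel_def)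

lemma poisson_kernel_le: "\<sigma> > 0 \<Longrightarrow> poisson_kernel \<sigma> v \<le> 1 / (pi * \<sigma>)"
  unfolding poisson_kernel_def by (simp add: divide_simps power2_eq_square add_pos_nonneg)

lemma poisson_kernel_measurable [measurable]: "poisson_kernel \<sigma> \<in> borel_measurable borel"
  unfolding poisson_kernel_def[abs_def] by measurable

lemma poisson_kernel_integral:
  assumes "\<sigma> > 0"
  shows "integrable lborel (\<lambda>u. poisson_kernel \<sigma> (u - y))" "(\<integral>u. poisson_kernel \<sigma> (u - y) \<partial>lborel) = 1"
proof -
  have eq: "poisson_kernel \<sigma> (u - y) = (\<sigma> / pi) * (1 / (\<sigma>\<^sup>2 + (u - y)\<^sup>2))" for u
    by (simp add: poisson_kernel_def)
  show "integrable lborel (\<lambda>u. poisson_kernel \<sigma> (u - y))" "(\<integral>u. poisson_kernel \<sigma> (u - y) \<partial>lborel) = 1"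
    unfolding eq using cauchy_density_integral[OF assms, of y] assms
    by (auto intro: integrable_mult_right simp only: integral_mult_right_zero) simp
qed

text \<open>The Poisson kernel is a product of two conjugate Cauchy kernels, of which only one has its pole on the
  side where $1/(c+iu)$ has none.\<close>

lemma poisson_reproduces_cauchy:
  assumes c: "c > 0" and \<sigma>: "\<sigma> > 0"
  shows "integrable lborel (\<lambda>u. poisson_kernel \<sigma> (u - y) * (1 / (of_real c + \<i> * of_real u)))"
    and "(\<integral>u. poisson_kernel \<sigma> (u - y) * (1 / (of_real c + \<i> * of_real u)) \<partial>lborel) = 1 / (of_real (c + \<sigma>) + \<i> * of_real y)"
proof -
  let ?c = "complex_of_real c" and ?d = "of_real \<sigma> - \<i> * of_real y" and ?e = "of_real \<sigma> + \<i> * of_real y"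
  have pk: "complex_of_real (poisson_kernel \<sigma> (u - y)) = of_real (\<sigma> / pi) * (1 / ((?d + \<i> * of_real u) * (?e - \<i> * of_real u)))" for u
  proof -
    have "(?d + \<i> * of_real u) * (?e - \<i> * of_real u) = of_real (\<sigma>\<^sup>2 + (u - y)\<^sup>2)"
      by (simp add: power2_eq_square algebra_simps)
    then show ?thesis by (simp add: poisson_kernel_def)
  qed
  have ce: "?c + ?e \<noteq> 0" using c \<sigma> by (auto simp: complex_eq_iff)
  have eq: "poisson_kernel \<sigma> (u - y) * (1 / (?c + \<i> * of_real u))
      = (of_real (\<sigma> / pi) / (?c + ?e)) * (1 / ((?c + \<i> * of_real u) * (?d + \<i> * of_real u)) + 1 / ((?d + \<i> * of_real u) * (?e - \<i> * of_real u)))" for u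
  proof -
    have "k * (1 / (q * r)) * (1 / p) = k / (p + r) * (1 / (p * q) + 1 / (q * r))"
      if "p \<noteq> 0" "q \<noteq> 0" "r \<noteq> 0" "p + r \<noteq> 0" for p q r k :: complex
      using that by (simp add: divide_simps)
    from this[of "?c + \<i> * of_real u" "?d + \<i> * of_real u" "?e - \<i> * of_real u" "of_real (\<sigma> / pi)"]
    show ?thesis unfolding pk
      using vertical_nonzero(1)[of ?c u] vertical_nonzero(1)[of ?d u] vertical_nonzero(2)[of ?e u] c \<sigma> ce by simp
  qed
  have i: "integrable lborel (\<lambda>u. 1 / ((?c + \<i> * of_real u) * (?d + \<i> * of_real u)))"
    "integrable lborel (\<lambda>u. 1 / ((?d + \<i> * of_real u) * (?e - \<i> * of_real u)))"
    using c \<sigma> cauchy_kernel_integrable(2)[of ?c ?d] cauchy_kernel_integrable(1)[of ?d ?e] by auto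
  show "integrable lborel (\<lambda>u. poisson_kernel \<sigma> (u - y) * (1 / (?c + \<i> * of_real u)))"
    unfolding eq by (intro integrable_mult_right Bochner_Integration.integrable_add i)
  have "(\<integral>u. poisson_kernel \<sigma> (u - y) * (1 / (?c + \<i> * of_real u)) \<partial>lborel)
     = (of_real (\<sigma> / pi) / (?c + ?e)) * (0 + 2 * pi / (?d + ?e))"
    unfolding eq
    by (subst integral_mult_right_zero, subst Bochner_Integration.integral_add[OF i],
        subst cauchy_kernel_integral_0, use c \<sigma> in simp, use \<sigma> in simp, subst cauchy_kernel_integral, use \<sigma> in auto)
  also have "\<dots> = 1 / (of_real (c + \<sigma>) + \<i> * of_real y)"
  proof -
    have "?d + ?e = 2 * of_real \<sigma>" "?c + ?e = of_real (c + \<sigma>) + \<i> * of_real y" by simp_all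
    moreover have "(of_real (\<sigma> / pi) / w) * (0 + complex_of_real (2 * pi) / (2 * of_real \<sigma>)) = 1 / w" for w
      using \<sigma> by simp
    ultimately show ?thesis by (simp only:)
  qed
  finally show "(\<integral>u. poisson_kernel \<sigma> (u - y) * (1 / (?c + \<i> * of_real u)) \<partial>lborel) = 1 / (of_real (c + \<sigma>) + \<i> * of_real y)" .
qed

lemma poisson_reproduces_poly_mellin:
  assumes \<sigma>: "\<sigma> > 0"
  shows "integrable lborel (\<lambda>u. poisson_kernel \<sigma> (u - y) * poly_mellin p (line u))"
    and "(\<integral>u. poisson_kernel \<sigma> (u - y) * poly_mellin p (line u) \<partial>lborel) = poly_mellin p (line y + of_real \<sigma>)"
proof -
  have eq: "poisson_kernel \<sigma> (u - y) * poly_mellin p (line u)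
     = (\<Sum>m\<le>degree p. coeff p m * (poisson_kernel \<sigma> (u - y) * (1 / (of_real (real m + 1/2) + \<i> * of_real u))))" for u
    using poly_mellin_vertical[of p u 0] by (simp add: sum_distrib_left mult_ac)
  have i: "integrable lborel (\<lambda>u. poisson_kernel \<sigma> (u - y) * (1 / (of_real (real m + 1/2) + \<i> * of_real u)))" for m
    by (rule poisson_reproduces_cauchy(1)) (use \<sigma> in auto)
  have v: "(\<integral>u. poisson_kernel \<sigma> (u - y) * (1 / (of_real (real m + 1/2) + \<i> * of_real u)) \<partial>lborel)
      = 1 / (of_real (real m + 1/2 + \<sigma>) + \<i> * of_real y)" for m
    by (rule poisson_reproduces_cauchy(2)) (use \<sigma> in auto)
  show "integrable lborel (\<lambda>u. poisson_kernel \<sigma> (u - y) * poly_mellin p (line u))"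
    unfolding eq by (intro Bochner_Integration.integrable_sum integrable_mult_right i)
  show "(\<integral>u. poisson_kernel \<sigma> (u - y) * poly_mellin p (line u) \<partial>lborel) = poly_mellin p (line y + of_real \<sigma>)"
    unfolding eq poly_mellin_vertical
    by (subst Bochner_Integration.integral_sum, intro integrable_mult_right i)
       (simp only: integral_mult_right_zero v)
qed

text \<open>Jensen's inequality for the square: the Poisson average of $|P - c|^2$ with $c$ the Poisson average of $P$ is nonnegative.\<close>

lemma poly_mellin_square_le_poisson:
  assumes \<sigma>: "\<sigma> > 0"
  shows "ennreal ((cmod (poly_mellin p (line y + of_real \<sigma>)))\<^sup>2)
    \<le> (\<integral>\<^sup>+u. ennreal (poisson_kernel \<sigma> (u - y) * (cmod (poly_mellin p (line u)))\<^sup>2) \<partial>lborel)"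
proof -
  define P where "P u = poly_mellin p (line u)" for u
  define k where "k u = poisson_kernel \<sigma> (u - y)" for u
  define C where "C = poly_mellin p (line y + of_real \<sigma>)"
  have [measurable]: "P \<in> borel_measurable borel"
    using borel_measurable_continuous_onI[OF continuous_on_poly_mellin_vertical[of 0 p]] by (simp add: P_def[abs_def])
  have [measurable]: "k \<in> borel_measurable borel" unfolding k_def by measurable
  have k0: "k u \<ge> 0" for u unfolding k_def by (rule poisson_kernel_nonneg[OF \<sigma>])
  have iP2: "integrable lborel (\<lambda>u. (cmod (P u))\<^sup>2)" unfolding P_def by (rule poly_mellin_Plancherel(1))
  have i2: "integrable lborel (\<lambda>u. k u * (cmod (P u))\<^sup>2)"
  proof (rule Bochner_Integration.integrable_bound)
    show "integrable lborel (\<lambda>u. (1 / (pi * \<sigma>)) * (cmod (P u))\<^sup>2)" by (intro integrable_mult_right iP2)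
    show "AE u in lborel. norm (k u * (cmod (P u))\<^sup>2) \<le> norm ((1 / (pi * \<sigma>)) * (cmod (P u))\<^sup>2)"
      using poisson_kernel_le[OF \<sigma>] k0 \<sigma> unfolding k_def
      by (intro AE_I2) (auto simp: abs_mult intro!: mult_right_mono simp del: times_divide_eq_left)
  qed measurable
  have i1: "integrable lborel (\<lambda>u. of_real (k u) * P u)" and v1: "(\<integral>u. of_real (k u) * P u \<partial>lborel) = C"
    unfolding k_def P_def C_def by (rule poisson_reproduces_poly_mellin[OF \<sigma>])+
  have ik: "integrable lborel k" and vk: "(\<integral>u. k u \<partial>lborel) = 1"
    unfolding k_def[abs_def] by (rule poisson_kernel_integral[OF \<sigma>])+
  have i1r: "integrable lborel (\<lambda>u. Re (cnj C * (of_real (k u) * P u)))"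
    and v1r: "(\<integral>u. Re (cnj C * (of_real (k u) * P u)) \<partial>lborel) = (cmod C)\<^sup>2"
  proof -
    have i: "integrable lborel (\<lambda>u. cnj C * (of_real (k u) * P u))" by (intro integrable_mult_right i1)
    then show "integrable lborel (\<lambda>u. Re (cnj C * (of_real (k u) * P u)))" by (rule integrable_Re)
    have "(\<integral>u. Re (cnj C * (of_real (k u) * P u)) \<partial>lborel) = Re (\<integral>u. cnj C * (of_real (k u) * P u) \<partial>lborel)"
      using i by (rule integral_Re)
    also have "\<dots> = Re (cnj C * C)" by (simp only: integral_mult_right_zero v1)
    also have "\<dots> = (cmod C)\<^sup>2" unfolding cmod_power2 by (simp add: power2_eq_square)
    finally show "(\<integral>u. Re (cnj C * (of_real (k u) * P u)) \<partial>lborel) = (cmod C)\<^sup>2" .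
  qed
  have "0 \<le> (\<integral>u. k u * (cmod (P u - C))\<^sup>2 \<partial>lborel)" using k0 by simp
  also have "\<dots> = (\<integral>u. k u * (cmod (P u))\<^sup>2 - 2 * Re (cnj C * (of_real (k u) * P u)) + (cmod C)\<^sup>2 * k u \<partial>lborel)"
  proof (intro Bochner_Integration.integral_cong refl)
    fix u
    have 1: "(cmod (P u - C))\<^sup>2 = (cmod (P u))\<^sup>2 - 2 * Re (cnj C * P u) + (cmod C)\<^sup>2"
      unfolding cmod_power2 by (simp add: power2_eq_square algebra_simps)
    have 2: "Re (cnj C * (of_real (k u) * P u)) = k u * Re (cnj C * P u)" by (simp add: algebra_simps)
    have "k' * (a - 2 * b + d) = k' * a - 2 * (k' * b) + d * k'" for k' a b d :: real by (simp add: algebra_simps)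
    then show "k u * (cmod (P u - C))\<^sup>2 = k u * (cmod (P u))\<^sup>2 - 2 * Re (cnj C * (of_real (k u) * P u)) + (cmod C)\<^sup>2 * k u"
      unfolding 1 2 .
  qed
  also have "\<dots> = (\<integral>u. k u * (cmod (P u))\<^sup>2 \<partial>lborel) - 2 * (cmod C)\<^sup>2 + (cmod C)\<^sup>2"
    using i2 i1r ik by (simp only: Bochner_Integration.integral_add Bochner_Integration.integral_diff
        integrable_mult_right integral_mult_right_zero v1r vk Bochner_Integration.integrable_diff mult_1_right)
  finally have "(cmod C)\<^sup>2 \<le> (\<integral>u. k u * (cmod (P u))\<^sup>2 \<partial>lborel)" by simp
  then have "ennreal ((cmod C)\<^sup>2) \<le> ennreal (\<integral>u. k u * (cmod (P u))\<^sup>2 \<partial>lborel)" by (rule ennreal_leI)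
  also have "\<dots> = (\<integral>\<^sup>+u. ennreal (k u * (cmod (P u))\<^sup>2) \<partial>lborel)"
    by (rule nn_integral_eq_integral[symmetric, OF i2]) (use k0 in auto)
  finally show ?thesis unfolding C_def k_def P_def .
qed

text \<open>The weak-type $(1,1)$ inequality for the maximal Poisson average. A point outside the $5$-fold enlargement of a disjoint family of bad intervals lies in no bad interval;
  there the Poisson kernel is dominated by a geometric superposition of normalised indicators of dyadic
  intervals.\<close>

lemma poisson_maximal_inequality:
  fixes \<phi> :: "real \<Rightarrow> real"
  assumes \<phi>0: "\<And>u. \<phi> u \<ge> 0" and \<phi>: "integrable lborel \<phi>" and l: "l > 0"
  obtains W where "W \<in> sets borel" "emeasure lborel W \<le> ennreal (80 * (\<integral>u. \<phi> u \<partial>lborel) / l)"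
    and "\<And>y \<sigma>. y \<notin> W \<Longrightarrow> \<sigma> > 0 \<Longrightarrow> (\<integral>\<^sup>+u. ennreal (poisson_kernel \<sigma> (u - y) * \<phi> u) \<partial>lborel) \<le> ennreal l"
proof -
  have [measurable]: "\<phi> \<in> borel_measurable borel" using \<phi> by auto
  have [measurable]: "cball a b \<in> sets borel" for a b :: real by (intro borel_closed closed_cball)
  have cb: "(\<lambda>x. indicator (cball a b) x) \<in> borel_measurable borel" for a b :: real by measurable
  define \<Phi> where "\<Phi> = (\<integral>u. \<phi> u \<partial>lborel)"
  have \<Phi>: "(\<integral>\<^sup>+u. ennreal (\<phi> u) \<partial>lborel) = ennreal \<Phi>"
    unfolding \<Phi>_def by (rule nn_integral_eq_integral[OF \<phi>]) (simp add: \<phi>0)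
  \<comment> \<open>Intervals in which the mean of \<open>\<phi>\<close> exceeds \<open>l/16\<close> are bad. Enlarged five times, such an interval has
    length \<open>10 r < (80/l)\<close> times its mass, and for \<open>l/8\<close> the geometric sum at the end stays below \<open>l\<close>.\<close>
  define mass where "mass y r = (\<integral>\<^sup>+u. ennreal (\<phi> u) * indicator (cball y r) u \<partial>lborel)" for y r
  define K where "K = {i. snd i > 0 \<and> ennreal (l * snd i / 8) < mass (fst i) (snd i)}"
  have r: "0 < snd i \<and> snd i \<le> 8 * \<Phi> / l" if "i \<in> K" for i
  proof -
    have "ennreal (l * snd i / 8) < mass (fst i) (snd i)" using that by (simp add: K_def)
    also have "\<dots> \<le> ennreal \<Phi>" unfolding mass_def \<Phi>[symmetric]
      by (intro nn_integral_mono) (auto simp: indicator_def)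
    finally have "l * snd i / 8 < \<Phi>" using that l by (subst (asm) ennreal_less_iff) (auto simp: K_def)
    then show ?thesis using that l by (auto simp: K_def field_simps)
  qed
  have "fst ` K \<subseteq> (\<Union>i\<in>K. cball (fst i) (snd i))" by (force simp: K_def)
  from Vitali_covering_lemma_cballs[OF this r]
  obtain C where C: "countable C" "C \<subseteq> K"
     "pairwise (\<lambda>i j. disjnt (cball (fst i) (snd i)) (cball (fst j) (snd j))) C"
     "fst ` K \<subseteq> (\<Union>i\<in>C. cball (fst i) (5 * snd i))" .
  define W where "W = (\<Union>i\<in>C. cball (fst i) (5 * snd i))"
  have W: "W \<in> sets borel" unfolding W_def using C(1) by (intro sets.countable_UN'') auto
  have "emeasure lborel W = (\<integral>\<^sup>+x. indicator W x \<partial>lborel)" using W by simp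
  also have "\<dots> \<le> (\<integral>\<^sup>+x. (\<integral>\<^sup>+i. indicator (cball (fst i) (5 * snd i)) x \<partial>count_space C) \<partial>lborel)"
  proof (intro nn_integral_mono)
    fix x :: real
    show "indicator W x \<le> (\<integral>\<^sup>+i. indicator (cball (fst i) (5 * snd i)) x \<partial>count_space C)"
    proof (cases "x \<in> W")
      case True
      then obtain i where "i \<in> C" "x \<in> cball (fst i) (5 * snd i)" by (auto simp: W_def)
      then show ?thesis
        using nn_integral_ge_point[of i C "\<lambda>i. indicator (cball (fst i) (5 * snd i)) x"] True by simp
    qed simp
  qed
  also have "\<dots> = (\<integral>\<^sup>+i. (\<integral>\<^sup>+x. indicator (cball (fst i) (5 * snd i)) x \<partial>lborel) \<partial>count_space C)"
    by (rule nn_integral_count_space_nn_integral[OF C(1)]) (simp add: cb)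
  also have "\<dots> \<le> (\<integral>\<^sup>+i. (\<integral>\<^sup>+x. ennreal (80 / l) * (ennreal (\<phi> x) * indicator (cball (fst i) (snd i)) x) \<partial>lborel) \<partial>count_space C)"
  proof (rule nn_integral_mono)
    fix i assume "i \<in> space (count_space C)"
    then have iK: "i \<in> K" using C(2) by auto
    then have i: "snd i > 0" "ennreal (l * snd i / 8) \<le> mass (fst i) (snd i)" by (auto simp: K_def)
    have "(\<integral>\<^sup>+x. indicator (cball (fst i) (5 * snd i)) x \<partial>lborel) = ennreal (10 * snd i)"
      using i(1) by (simp add: cball_eq_atLeastAtMost)
    also have "\<dots> = ennreal (80 / l) * ennreal (l * snd i / 8)"
      using l i(1) by (simp flip: ennreal_mult)
    also have "\<dots> \<le> ennreal (80 / l) * mass (fst i) (snd i)" by (intro mult_left_mono i(2)) simp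
    also have "\<dots> = (\<integral>\<^sup>+x. ennreal (80 / l) * (ennreal (\<phi> x) * indicator (cball (fst i) (snd i)) x) \<partial>lborel)"
      unfolding mass_def by (rule nn_integral_cmult[symmetric]) measurable
    finally show "(\<integral>\<^sup>+x. indicator (cball (fst i) (5 * snd i)) x \<partial>lborel)
        \<le> (\<integral>\<^sup>+x. ennreal (80 / l) * (ennreal (\<phi> x) * indicator (cball (fst i) (snd i)) x) \<partial>lborel)" .
  qed
  also have "\<dots> = (\<integral>\<^sup>+x. (\<integral>\<^sup>+i. ennreal (80 / l) * (ennreal (\<phi> x) * indicator (cball (fst i) (snd i)) x) \<partial>count_space C) \<partial>lborel)"
    by (rule nn_integral_count_space_nn_integral[OF C(1), symmetric]) measurable
  also have "\<dots> \<le> (\<integral>\<^sup>+x. ennreal (80 / l) * ennreal (\<phi> x) \<partial>lborel)"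
  proof (intro nn_integral_mono)
    fix x :: real
    have "(\<integral>\<^sup>+i. indicator (cball (fst i) (snd i)) x \<partial>count_space C) \<le> (1 :: ennreal)"
    proof (cases "\<exists>i\<in>C. x \<in> cball (fst i) (snd i)")
      case True
      then obtain i where i: "i \<in> C" "x \<in> cball (fst i) (snd i)" by blast
      have "(\<integral>\<^sup>+j. indicator (cball (fst j) (snd j)) x \<partial>count_space C) \<le> (\<integral>\<^sup>+j. indicator {i} j \<partial>count_space C)"
      proof (intro nn_integral_mono)
        fix j assume "j \<in> space (count_space C)"
        then have "x \<notin> cball (fst j) (snd j)" if "j \<noteq> i"
          using C(3) i that by (auto simp: pairwise_def disjnt_iff)
        then show "(indicator (cball (fst j) (snd j)) x :: ennreal) \<le> indicator {i} j" by (auto simp: indicator_def)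
      qed
      also have "\<dots> \<le> 1" using i(1) by (simp add: emeasure_count_space_finite)
      finally show ?thesis .
    next
      case False
      then have "(\<integral>\<^sup>+i. indicator (cball (fst i) (snd i)) x \<partial>count_space C) = (\<integral>\<^sup>+i. 0 \<partial>count_space C)"
        by (intro nn_integral_cong) auto
      then show ?thesis by simp
    qed
    then have "ennreal (80 / l) * (ennreal (\<phi> x) * (\<integral>\<^sup>+i. indicator (cball (fst i) (snd i)) x \<partial>count_space C))
        \<le> ennreal (80 / l) * (ennreal (\<phi> x) * 1)" by (intro mult_left_mono) auto
    then show "(\<integral>\<^sup>+i. ennreal (80 / l) * (ennreal (\<phi> x) * indicator (cball (fst i) (snd i)) x) \<partial>count_space C)
        \<le> ennreal (80 / l) * ennreal (\<phi> x)"
      by (simp add: nn_integral_cmult)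
  qed
  also have "\<dots> = ennreal (80 / l) * ennreal \<Phi>" by (simp add: nn_integral_cmult \<Phi>)
  also have "\<dots> = ennreal (80 * \<Phi> / l)" using l by (simp flip: ennreal_mult')
  finally have Wm: "emeasure lborel W \<le> ennreal (80 * \<Phi> / l)" .
  have bound: "(\<integral>\<^sup>+u. ennreal (poisson_kernel \<sigma> (u - y) * \<phi> u) \<partial>lborel) \<le> ennreal l" if y: "y \<notin> W" and \<sigma>: "\<sigma> > 0" for y \<sigma>
  proof -
    have m: "mass y r \<le> ennreal (l * r / 8)" if "r > 0" for r
    proof (rule ccontr)
      assume "\<not> mass y r \<le> ennreal (l * r / 8)"
      then have "(y, r) \<in> K" using that by (simp add: K_def)
      then have "y \<in> fst ` K" by force
      then show False using C(4) y unfolding W_def by blast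
    qed
    \<comment> \<open>\<open>c j\<close> bounds the kernel for \<open>2^(j-1) \<sigma> < \<bar>u - y\<bar>\<close>, and everywhere if \<open>j = 0\<close>.\<close>
    define c where "c j = 4 / (pi * \<sigma> * 4 ^ j)" for j :: nat
    have c0: "c j \<ge> 0" for j using \<sigma> by (simp add: c_def)
    have dom: "ennreal (poisson_kernel \<sigma> (u - y)) \<le> (\<Sum>j. ennreal (c j) * indicator (cball y (2 ^ j * \<sigma>)) u)" for u
    proof -
      have ex: "\<exists>j. \<bar>u - y\<bar> \<le> 2 ^ j * \<sigma>"
      proof -
        obtain j where "\<bar>u - y\<bar> / \<sigma> < 2 ^ j" using real_arch_pow[of 2 "\<bar>u - y\<bar> / \<sigma>"] by auto
        then show ?thesis using \<sigma> by (intro exI[of _ j]) (simp add: field_simps)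
      qed
      define j where "j = (LEAST j. \<bar>u - y\<bar> \<le> 2 ^ j * \<sigma>)"
      have j: "\<bar>u - y\<bar> \<le> 2 ^ j * \<sigma>" unfolding j_def using ex by (rule LeastI_ex)
      have least: "\<not> \<bar>u - y\<bar> \<le> 2 ^ i * \<sigma>" if "i < j" for i
        using that unfolding j_def by (rule not_less_Least)
      have "poisson_kernel \<sigma> (u - y) \<le> c j"
      proof (cases j)
        case 0
        have "1 / (pi * \<sigma>) \<le> c j" using \<sigma> by (simp add: 0 c_def divide_simps)
        then show ?thesis using poisson_kernel_le[OF \<sigma>, of "u - y"] by linarith
      next
        case (Suc i)
        have "2 ^ i * \<sigma> \<le> \<bar>u - y\<bar>" using least[of i] Suc by simp
        then have "(2 ^ i * \<sigma>)\<^sup>2 \<le> \<bar>u - y\<bar>\<^sup>2" using \<sigma> by (intro power_mono) auto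
        also have "(2 ^ i * \<sigma>)\<^sup>2 = 4 ^ i * \<sigma>\<^sup>2"
          by (simp add: power_mult_distrib power2_eq_square flip: power_mult_distrib[of 2 2])
        finally have "4 ^ i * \<sigma>\<^sup>2 \<le> \<sigma>\<^sup>2 + (u - y)\<^sup>2" by (simp add: add_increasing)
        then have "poisson_kernel \<sigma> (u - y) \<le> \<sigma> / (pi * (4 ^ i * \<sigma>\<^sup>2))"
          unfolding poisson_kernel_def using \<sigma> by (intro divide_left_mono mult_left_mono) (auto simp: add_pos_nonneg)
        also have "\<dots> = c j" using \<sigma> by (simp add: c_def Suc power2_eq_square)
        finally show ?thesis .
      qed
      then have "ennreal (poisson_kernel \<sigma> (u - y)) \<le> ennreal (c j) * indicator (cball y (2 ^ j * \<sigma>)) u"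
        using j by (simp add: ennreal_leI dist_real_def abs_minus_commute)
      also have "\<dots> \<le> (\<Sum>j. ennreal (c j) * indicator (cball y (2 ^ j * \<sigma>)) u)"
      proof -
        have "a j \<le> (\<Sum>j. a j)" for a :: "nat \<Rightarrow> ennreal" using sum_le_suminf[of a "{j}"] by simp
        then show ?thesis .
      qed
      finally show ?thesis .
    qed
    have "(\<integral>\<^sup>+u. ennreal (poisson_kernel \<sigma> (u - y) * \<phi> u) \<partial>lborel)
        \<le> (\<integral>\<^sup>+u. (\<Sum>j. ennreal (c j) * (ennreal (\<phi> u) * indicator (cball y (2 ^ j * \<sigma>)) u)) \<partial>lborel)"
    proof (intro nn_integral_mono)
      fix u
      have "ennreal (poisson_kernel \<sigma> (u - y) * \<phi> u) = ennreal (poisson_kernel \<sigma> (u - y)) * ennreal (\<phi> u)"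
        using \<phi>0 by (simp add: ennreal_mult'')
      also have "\<dots> \<le> (\<Sum>j. ennreal (c j) * indicator (cball y (2 ^ j * \<sigma>)) u) * ennreal (\<phi> u)"
        by (intro mult_right_mono dom) simp
      also have "\<dots> = (\<Sum>j. ennreal (c j) * (ennreal (\<phi> u) * indicator (cball y (2 ^ j * \<sigma>)) u))"
        by (simp add: ennreal_suminf_multc[symmetric] mult_ac)
      finally show "ennreal (poisson_kernel \<sigma> (u - y) * \<phi> u) \<le> \<dots>" .
    qed
    also have "\<dots> = (\<Sum>j. ennreal (c j) * mass y (2 ^ j * \<sigma>))"
      by (simp add: nn_integral_suminf nn_integral_cmult mass_def)
    also have "\<dots> \<le> (\<Sum>j. ennreal (l / (2 * pi) * (1/2) ^ j))"
    proof (intro suminf_le)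
      fix j
      have "ennreal (c j) * mass y (2 ^ j * \<sigma>) \<le> ennreal (c j) * ennreal (l * (2 ^ j * \<sigma>) / 8)"
        by (intro mult_left_mono m) (use \<sigma> in auto)
      also have "\<dots> = ennreal (c j * (l * (2 ^ j * \<sigma>) / 8))"
        by (rule ennreal_mult[symmetric]) (use c0 l \<sigma> in auto)
      also have "c j * (l * (2 ^ j * \<sigma>) / 8) = l / (2 * pi) * (1/2) ^ j"
      proof -
        have "(4::real) ^ j = 2 ^ j * 2 ^ j" by (simp flip: power_mult_distrib)
        then show ?thesis using \<sigma> by (simp add: c_def field_simps)
      qed
      finally show "ennreal (c j) * mass y (2 ^ j * \<sigma>) \<le> ennreal (l / (2 * pi) * (1/2) ^ j)" .
    qed auto
    also have "\<dots> = ennreal (l / (2 * pi) * 2)"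
      using l sums_mult[OF geometric_sums[of "1/2::real"], of "l / (2 * pi)"]
      by (intro suminf_ennreal_eq) auto
    also have "\<dots> \<le> ennreal l"
      using l pi_ge_two by (intro ennreal_leI) (simp add: field_simps)
    finally show ?thesis .
  qed
  from W Wm bound show ?thesis unfolding \<Phi>_def by (rule that)
qed

section \<open>Boundary values of Mellin transforms\<close>

lemma poly_mellin_altdef:
  "degree p \<le> N \<Longrightarrow> poly_mellin p s = (\<Sum>m\<le>N. coeff p m / (of_nat m + 1 + s))"
  unfolding poly_mellin_def by (rule sum.mono_neutral_left) (auto simp: coeff_eq_0)

lemma poly_mellin_diff: "poly_mellin (p - q) s = poly_mellin p s - poly_mellin q s"
proof -
  define N where "N = max (degree p) (degree q)"
  have "degree (p - q) \<le> N" unfolding N_def by (rule degree_diff_le) auto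
  then show ?thesis
    by (simp add: poly_mellin_altdef[of _ N] N_def diff_divide_distrib sum_subtractf)
qed

lemma geometric_increments_converge:
  fixes a :: "nat \<Rightarrow> complex"
  assumes inc: "\<And>k. k \<ge> N \<Longrightarrow> cmod (a (Suc k) - a k) \<le> (1/2) ^ k"
  shows "convergent a" and "\<And>n l. n \<ge> N \<Longrightarrow> a \<longlonglongrightarrow> l \<Longrightarrow> cmod (l - a n) \<le> 2 * (1/2) ^ n"
proof -
  have step: "cmod (a (n + d) - a n) \<le> 2 * (1/2) ^ n - 2 * (1/2) ^ (n + d)" if "n \<ge> N" for n d
  proof (induction d)
    case (Suc d)
    have "cmod (a (n + Suc d) - a n) \<le> cmod (a (Suc (n + d)) - a (n + d)) + cmod (a (n + d) - a n)"
      using norm_triangle_ineq[of "a (Suc (n + d)) - a (n + d)" "a (n + d) - a n"] by simp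
    also have "\<dots> \<le> (1/2) ^ (n + d) + (2 * (1/2) ^ n - 2 * (1/2) ^ (n + d))"
      using inc[of "n + d"] that Suc by linarith
    finally show ?case by simp
  qed simp
  then have step': "cmod (a m - a n) \<le> 2 * (1/2) ^ n" if "n \<ge> N" "m \<ge> n" for n m
  proof -
    have "(0::real) \<le> 2 * (1/2) ^ m" by simp
    then show ?thesis using step[OF that(1), of "m - n"] that(2) by (simp del: zero_le_power)
  qed
  have "summable (\<lambda>k. a (Suc k) - a k)"
    by (rule summable_comparison_test'[of "\<lambda>k. (1/2::real) ^ k" N]) (use inc in \<open>auto simp: summable_geometric\<close>)
  then have "convergent (\<lambda>n. a n - a 0)"
    by (simp only: summable_iff_convergent sum_lessThan_telescope)
  from convergent_add[OF this convergent_const[of "a 0"]] show "convergent a" by simp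
  show "cmod (l - a n) \<le> 2 * (1/2) ^ n" if "n \<ge> N" "a \<longlonglongrightarrow> l" for n l
  proof (rule tendsto_upperbound)
    show "(\<lambda>m. cmod (a m - a n)) \<longlonglongrightarrow> cmod (l - a n)" by (intro tendsto_intros that)
    show "\<forall>\<^sub>F m in sequentially. cmod (a m - a n) \<le> 2 * (1/2) ^ n"
      using step'[OF that(1)] by (intro eventually_sequentiallyI[of n]) auto
  qed simp
qed

text \<open>The triangle inequality in squared form. With $t \to 0$ it compares two square integrals with asymptotically sharp constants,
  provided that the integral of the squared difference tends to $0$ faster than $t$.\<close>

lemma norm_square_le_split:
  assumes t: "t > 0"
  shows "(cmod x)\<^sup>2 \<le> (1 + t) * (cmod y)\<^sup>2 + (1 + 1 / t) * (cmod (x - y))\<^sup>2"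
proof -
  define b where "b = cmod y"
  define d where "d = cmod (x - y)"
  have "cmod x \<le> b + d" unfolding b_def d_def using norm_triangle_ineq[of y "x - y"] by simp
  then have "(cmod x)\<^sup>2 \<le> (b + d)\<^sup>2" by (intro power_mono) auto
  also have "\<dots> = b\<^sup>2 + d\<^sup>2 + 2 * b * d" by (simp add: power2_sum)
  also have "2 * b * d \<le> t * b\<^sup>2 + d\<^sup>2 / t"
  proof -
    have "0 \<le> (t * b - d)\<^sup>2 / t" using t by simp
    also have "\<dots> = t * b\<^sup>2 + d\<^sup>2 / t - 2 * b * d" using t by (simp add: power2_diff field_simps power2_eq_square)
    finally show ?thesis by simp
  qed
  finally show ?thesis unfolding b_def[symmetric] d_def[symmetric] by (simp add: algebra_simps)
qed

text \<open>Fatou's theorem together with Plancherel's. Polynomials $p_n$ converging to $f$ at a geometric rate have increments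
  whose maximal functions exceed $2^{-n}$ only on sets of summable measure; by Borel--Cantelli the
  convergence of the transforms along almost every horizontal line is uniform, so limits may be interchanged.\<close>

theorem mellin_boundary_Plancherel:
  assumes f: "f \<in> L2_unit"
  obtains F where "F \<in> borel_measurable borel"
    and "AE y in lborel. ((\<lambda>\<sigma>. mellin f (line y + of_real \<sigma>)) \<longlongrightarrow> F y) (at_right 0)"
    and "(\<integral>\<^sup>+y. ennreal ((cmod (F y))\<^sup>2) \<partial>lborel) = ennreal (2 * pi * (L2_norm_unit f)\<^sup>2)"
proof -
  define pf where "pf p = (poly_fun p)" for p
  have pfL: "pf p \<in> L2_unit" for p unfolding pf_def by (rule L2_unit_poly)
  have "\<exists>p. L2_norm_unit (\<lambda>u. f u - pf p u) < (1/4) ^ n" for n :: nat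
    unfolding pf_def by (rule polynomials_dense_L2_unit[OF f]) simp
  then obtain p where p: "\<And>n. L2_norm_unit (\<lambda>u. f u - pf (p n) u) < (1/4) ^ n" by metis
  have pdiff: "L2_norm_unit (pf (p m - p n)) \<le> 2 * (1/4) ^ n" if "m \<ge> n" for m n
  proof -
    have "L2_norm_unit (pf (p m - p n)) \<le> L2_norm_unit (\<lambda>u. pf (p m) u - f u) + L2_norm_unit (\<lambda>u. f u - pf (p n) u)"
      using L2_norm_unit_triangle_diff[OF pfL f pfL] by (simp add: pf_def)
    also have "\<dots> \<le> (1/4) ^ m + (1/4) ^ n"
      using p[of m] p[of n] L2_norm_unit_minus_commute[of f "pf (p m)"] by simp
    also have "(1/4::real) ^ m \<le> (1/4) ^ n" using that by (intro power_decreasing) auto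
    finally show ?thesis by simp
  qed
  define P where "P n y = poly_mellin (p n) (line y)" for n y
  have PL: "(\<integral>\<^sup>+y. ennreal ((cmod (poly_mellin q (line y)))\<^sup>2) \<partial>lborel) = ennreal (2 * pi * (L2_norm_unit (pf q))\<^sup>2)" for q
    unfolding pf_def poly_mellin_Plancherel(2)[symmetric]
    by (rule nn_integral_eq_integral[OF poly_mellin_Plancherel(1)]) simp
  have [measurable]: "P n \<in> borel_measurable borel" for n
    using borel_measurable_continuous_onI[OF continuous_on_poly_mellin_vertical[of 0 "p n"]] by (simp add: P_def[abs_def])
  have "\<exists>W. W \<in> sets borel \<and> emeasure lborel W \<le> ennreal (640 * pi * (1/4) ^ n) \<and>
      (\<forall>y \<sigma>. y \<notin> W \<longrightarrow> \<sigma> > 0 \<longrightarrow> cmod (poly_mellin (p (Suc n) - p n) (line y + of_real \<sigma>)) \<le> (1/2) ^ n)" for n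
  proof -
    define q where "q = p (Suc n) - p n"
    obtain W where W: "W \<in> sets borel"
      and Wm: "emeasure lborel W \<le> ennreal (80 * (\<integral>y. (cmod (poly_mellin q (line y)))\<^sup>2 \<partial>lborel) / (1/4) ^ n)"
      and Wb: "\<And>y \<sigma>. y \<notin> W \<Longrightarrow> \<sigma> > 0 \<Longrightarrow> (\<integral>\<^sup>+u. ennreal (poisson_kernel \<sigma> (u - y) * (cmod (poly_mellin q (line u)))\<^sup>2) \<partial>lborel) \<le> ennreal ((1/4) ^ n)"
      by (rule poisson_maximal_inequality[OF _ poly_mellin_Plancherel(1)[of q], of "(1/4) ^ n"]) auto
    have "80 * (2 * pi * (L2_norm_unit (pf q))\<^sup>2) / (1/4) ^ n \<le> 80 * (2 * pi * (2 * (1/4) ^ n)\<^sup>2) / (1/4) ^ n"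
      unfolding q_def by (intro divide_right_mono mult_left_mono power_mono pdiff) auto
    also have "\<dots> = 640 * pi * (1/4) ^ n" by (simp add: power2_eq_square)
    finally have "emeasure lborel W \<le> ennreal (640 * pi * (1/4) ^ n)"
      using Wm unfolding poly_mellin_Plancherel(2) pf_def by (meson ennreal_leI order_trans)
    moreover have "cmod (poly_mellin q (line y + of_real \<sigma>)) \<le> (1/2) ^ n" if "y \<notin> W" "\<sigma> > 0" for y \<sigma>
    proof -
      have "ennreal ((cmod (poly_mellin q (line y + of_real \<sigma>)))\<^sup>2) \<le> ennreal ((1/4) ^ n)"
        by (rule order_trans[OF poly_mellin_square_le_poisson[OF that(2)] Wb[OF that]])
      then have "(cmod (poly_mellin q (line y + of_real \<sigma>)))\<^sup>2 \<le> (1/4) ^ n" by simp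
      also have "(1/4 :: real) ^ n = ((1/2) ^ n)\<^sup>2" by (simp add: power2_eq_square flip: power_mult_distrib)
      finally show ?thesis by (rule power2_le_imp_le) simp
    qed
    ultimately show ?thesis using W unfolding q_def by blast
  qed
  then obtain W where W[measurable]: "\<And>n. W n \<in> sets borel"
    and Wm: "\<And>n. emeasure lborel (W n) \<le> ennreal (640 * pi * (1/4) ^ n)"
    and Wb: "\<And>n y \<sigma>. y \<notin> W n \<Longrightarrow> \<sigma> > 0 \<Longrightarrow> cmod (poly_mellin (p (Suc n) - p n) (line y + of_real \<sigma>)) \<le> (1/2) ^ n"
    by metis
  have fin: "emeasure lborel (W n) < \<infinity>" for n
    using le_less_trans[OF Wm ennreal_less_top] by simp
  have "AE y in lborel. eventually (\<lambda>n. y \<in> space lborel - W n) sequentially"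
  proof (rule borel_cantelli_AE1)
    show "summable (\<lambda>n. measure lborel (W n))"
    proof (rule summable_comparison_test'[of "\<lambda>n. 640 * pi * (1/4) ^ n" 0])
      show "summable (\<lambda>n. 640 * pi * (1/4::real) ^ n)" by (intro summable_mult summable_geometric) simp
      show "norm (measure lborel (W n)) \<le> 640 * pi * (1/4) ^ n" for n
        using Wm[of n] fin[of n] by (simp add: emeasure_eq_ennreal_measure less_top)
    qed
  qed (use fin in auto)
  then have AE1: "AE y in lborel. \<exists>N. \<forall>n\<ge>N. y \<notin> W n"
    by eventually_elim (auto simp: eventually_sequentially)
  define F where "F y = lim (\<lambda>n. P n y)" for y
  have Fm[measurable]: "F \<in> borel_measurable borel" unfolding F_def by measurable
  have AE2: "AE y in lborel. (\<lambda>n. P n y) \<longlonglongrightarrow> F y \<and>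
      ((\<lambda>\<sigma>. mellin f (line y + of_real \<sigma>)) \<longlongrightarrow> F y) (at_right 0)"
    using AE1
  proof eventually_elim
    case (elim y)
    then obtain N where N: "\<And>n. n \<ge> N \<Longrightarrow> y \<notin> W n" by blast
    define z where "z = line y"
    have inc: "cmod (poly_mellin (p (Suc n)) (z + of_real \<sigma>) - poly_mellin (p n) (z + of_real \<sigma>)) \<le> (1/2) ^ n" if "n \<ge> N" "\<sigma> > 0" for n \<sigma>
      using Wb[OF N[OF that(1)] that(2)] unfolding z_def poly_mellin_diff .
    have inc0: "cmod (P (Suc n) y - P n y) \<le> (1/2) ^ n" if "n \<ge> N" for n
    proof (rule tendsto_upperbound)
      show "((\<lambda>\<sigma>. cmod (poly_mellin (p (Suc n)) (z + of_real \<sigma>) - poly_mellin (p n) (z + of_real \<sigma>))) \<longlongrightarrow> cmod (P (Suc n) y - P n y)) (at_right 0)"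
        unfolding P_def z_def by (intro tendsto_norm tendsto_diff poly_mellin_tendsto)
      show "\<forall>\<^sub>F \<sigma> in at_right 0. cmod (poly_mellin (p (Suc n)) (z + of_real \<sigma>) - poly_mellin (p n) (z + of_real \<sigma>)) \<le> (1/2) ^ n"
        using inc[OF that] by (auto simp: eventually_at_filter)
    qed simp
    have lim0: "(\<lambda>n. P n y) \<longlonglongrightarrow> F y"
      unfolding F_def using geometric_increments_converge(1)[of N "\<lambda>n. P n y"] inc0
      by (simp add: convergent_LIMSEQ_iff)
    have pt: "(\<lambda>n. poly_mellin (p n) (z + of_real \<sigma>)) \<longlonglongrightarrow> mellin f (z + of_real \<sigma>)" if "\<sigma> > 0" for \<sigma>
    proof -
      have s: "Re (z + of_real \<sigma>) > -1/2" using that by (simp add: z_def)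
      have "(\<lambda>n. L2_norm_unit (\<lambda>x. pf (p n) x - f x)) \<longlonglongrightarrow> 0"
      proof (rule Lim_null_comparison)
        show "\<forall>\<^sub>F n in sequentially. norm (L2_norm_unit (\<lambda>x. pf (p n) x - f x)) \<le> (1/4) ^ n"
          using p L2_norm_unit_minus_commute[of f] by (auto simp: less_imp_le)
        show "(\<lambda>n. (1/4::real) ^ n) \<longlonglongrightarrow> 0" by (rule LIMSEQ_realpow_zero) auto
      qed
      from mellin_tendsto[OF pfL f this s] show ?thesis unfolding pf_def mellin_poly[OF s] .
    qed
    have u: "uniform_limit {0<..} (\<lambda>n \<sigma>. poly_mellin (p n) (z + of_real \<sigma>)) (\<lambda>\<sigma>. mellin f (z + of_real \<sigma>)) sequentially"
    proof (rule uniform_limitI)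
      fix e :: real assume "e > 0"
      then obtain M where M: "(1/2::real) ^ M < e / 2" using real_arch_pow_inv[of "e/2" "1/2"] by auto
      show "\<forall>\<^sub>F n in sequentially. \<forall>\<sigma>\<in>{0<..}. dist (poly_mellin (p n) (z + of_real \<sigma>)) (mellin f (z + of_real \<sigma>)) < e"
      proof (rule eventually_sequentiallyI[of "max M N"], intro ballI)
        fix n and \<sigma> :: real assume n: "max M N \<le> n" and \<sigma>: "\<sigma> \<in> {0<..}"
        have "cmod (mellin f (z + of_real \<sigma>) - poly_mellin (p n) (z + of_real \<sigma>)) \<le> 2 * (1/2) ^ n"
          by (rule geometric_increments_converge(2)[of N "\<lambda>n. poly_mellin (p n) (z + of_real \<sigma>)"])
             (use n \<sigma> inc pt in auto)
        also have "(1/2::real) ^ n \<le> (1/2) ^ M" using n by (intro power_decreasing) auto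
        finally show "dist (poly_mellin (p n) (z + of_real \<sigma>)) (mellin f (z + of_real \<sigma>)) < e"
          using M by (simp add: dist_norm norm_minus_commute)
      qed
    qed
    have "((\<lambda>\<sigma>. mellin f (z + of_real \<sigma>)) \<longlongrightarrow> F y) (at_right 0)"
    proof (rule swap_uniform_limit'[OF _ lim0 u])
      show "\<forall>\<^sub>F n in sequentially. ((\<lambda>\<sigma>. poly_mellin (p n) (z + of_real \<sigma>)) \<longlongrightarrow> P n y) (at_right 0)"
        unfolding P_def z_def by (intro always_eventually allI poly_mellin_tendsto)
      show "\<forall>\<^sub>F \<sigma> in at_right 0. \<sigma> \<in> {0<..}" by (auto simp: eventually_at_filter)
    qed simp
    with lim0 show ?case by (simp add: z_def)
  qed
  have err: "(\<integral>\<^sup>+y. ennreal ((cmod (F y - P n y))\<^sup>2) \<partial>lborel) \<le> ennreal (8 * pi * (1/16) ^ n)" for n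
  proof -
    have "(\<integral>\<^sup>+y. ennreal ((cmod (F y - P n y))\<^sup>2) \<partial>lborel)
        = (\<integral>\<^sup>+y. liminf (\<lambda>m. ennreal ((cmod (P m y - P n y))\<^sup>2)) \<partial>lborel)"
    proof (intro nn_integral_cong_AE, use AE2 in eventually_elim)
      case (elim y)
      then have "(\<lambda>m. ennreal ((cmod (P m y - P n y))\<^sup>2)) \<longlonglongrightarrow> ennreal ((cmod (F y - P n y))\<^sup>2)"
        by (intro tendsto_intros) auto
      then show ?case using lim_imp_Liminf[OF sequentially_bot] by metis
    qed
    also have "\<dots> \<le> liminf (\<lambda>m. \<integral>\<^sup>+y. ennreal ((cmod (P m y - P n y))\<^sup>2) \<partial>lborel)"
      by (rule nn_integral_liminf) measurable
    also have "\<dots> \<le> liminf (\<lambda>m. ennreal (8 * pi * (1/16) ^ n))"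
    proof (rule Liminf_mono, rule eventually_sequentiallyI[of n])
      fix m assume "n \<le> m"
      have "(\<integral>\<^sup>+y. ennreal ((cmod (P m y - P n y))\<^sup>2) \<partial>lborel) = ennreal (2 * pi * (L2_norm_unit (pf (p m - p n)))\<^sup>2)"
        unfolding P_def PL[symmetric] poly_mellin_diff ..
      also have "\<dots> \<le> ennreal (2 * pi * (2 * (1/4) ^ n)\<^sup>2)"
        by (intro ennreal_leI mult_left_mono power_mono pdiff \<open>n \<le> m\<close>) auto
      also have "2 * pi * (2 * (1/4) ^ n)\<^sup>2 = 8 * pi * (1/16) ^ n"
        by (simp add: power2_eq_square flip: power_mult_distrib)
      finally show "(\<integral>\<^sup>+y. ennreal ((cmod (P m y - P n y))\<^sup>2) \<partial>lborel) \<le> ennreal (8 * pi * (1/16) ^ n)" .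
    qed
    also have "\<dots> = ennreal (8 * pi * (1/16) ^ n)" by (simp add: Liminf_const)
    finally show ?thesis .
  qed
  have split: "(\<integral>\<^sup>+y. ennreal ((cmod (G y))\<^sup>2) \<partial>lborel)
      \<le> ennreal (1 + t) * (\<integral>\<^sup>+y. ennreal ((cmod (H y))\<^sup>2) \<partial>lborel) + ennreal (1 + 1 / t) * (\<integral>\<^sup>+y. ennreal ((cmod (G y - H y))\<^sup>2) \<partial>lborel)"
    if [measurable]: "G \<in> borel_measurable borel" "H \<in> borel_measurable borel" and t: "t > 0" for G H :: "real \<Rightarrow> complex" and t
  proof -
    have "(\<integral>\<^sup>+y. ennreal ((cmod (G y))\<^sup>2) \<partial>lborel)
      \<le> (\<integral>\<^sup>+y. ennreal (1 + t) * ennreal ((cmod (H y))\<^sup>2) + ennreal (1 + 1 / t) * ennreal ((cmod (G y - H y))\<^sup>2) \<partial>lborel)"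
      using norm_square_le_split[OF t] t
      by (intro nn_integral_mono) (simp add: ennreal_mult[symmetric] ennreal_plus[symmetric] del: ennreal_plus)
    also have "\<dots> = ennreal (1 + t) * (\<integral>\<^sup>+y. ennreal ((cmod (H y))\<^sup>2) \<partial>lborel) + ennreal (1 + 1 / t) * (\<integral>\<^sup>+y. ennreal ((cmod (G y - H y))\<^sup>2) \<partial>lborel)"
      by (simp add: nn_integral_add nn_integral_cmult)
    finally show ?thesis .
  qed
  \<comment> \<open>With the weight \<open>t = 2^-n\<close> the error \<open>8 pi 16^-n\<close> still tends to \<open>0\<close> after multiplication by \<open>1 + 1/t\<close>.\<close>
  define I where "I = (\<integral>\<^sup>+y. ennreal ((cmod (F y))\<^sup>2) \<partial>lborel)"
  define A where "A n = 2 * pi * (L2_norm_unit (pf (p n)))\<^sup>2" for n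
  define A' where "A' = 2 * pi * (L2_norm_unit f)\<^sup>2"
  define E where "E n = (1 + 2 ^ n) * (8 * pi * (1/16::real) ^ n)" for n :: nat
  have A0: "A n \<ge> 0" and A'0: "A' \<ge> 0" and E0: "E n \<ge> 0" for n by (simp_all add: A_def A'_def E_def)
  have up: "I \<le> ennreal ((1 + (1/2) ^ n) * A n + E n)" for n
  proof -
    have "I \<le> ennreal (1 + (1/2) ^ n) * ennreal (A n) + ennreal (1 + 1 / (1/2) ^ n) * ennreal (8 * pi * (1/16) ^ n)"
      unfolding I_def A_def PL[symmetric] P_def[symmetric]
      by (rule order_trans[OF split[of F "P n" "(1/2) ^ n"]]) (auto intro!: add_left_mono mult_left_mono err)
    also have "\<dots> = ennreal ((1 + (1/2) ^ n) * A n + E n)"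
      using A0 E0 by (simp add: E_def power_one_over ennreal_mult[symmetric] ennreal_plus[symmetric] del: ennreal_plus)
    finally show ?thesis .
  qed
  have "I < \<infinity>" using le_less_trans[OF up[of 0] ennreal_less_top] by simp
  then obtain J where J: "I = ennreal J" "J \<ge> 0" by (cases I) auto
  have upJ: "J \<le> (1 + (1/2) ^ n) * A n + E n" for n
    using up[of n] A0[of n] E0[of n] unfolding J(1) by (subst (asm) ennreal_le_iff) (auto intro!: add_nonneg_nonneg mult_nonneg_nonneg)
  have lowJ: "A n \<le> (1 + (1/2) ^ n) * J + E n" for n
  proof -
    have "ennreal (A n) \<le> ennreal (1 + (1/2) ^ n) * I + ennreal (1 + 1 / (1/2) ^ n) * ennreal (8 * pi * (1/16) ^ n)"
      unfolding I_def A_def PL[symmetric] P_def[symmetric]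
      by (rule order_trans[OF split[of "P n" F "(1/2) ^ n"]])
         (use err[of n] in \<open>auto intro!: add_left_mono mult_left_mono simp: norm_minus_commute\<close>)
    also have "\<dots> = ennreal ((1 + (1/2) ^ n) * J + E n)"
      using J E0 by (simp add: E_def power_one_over ennreal_mult[symmetric] ennreal_plus[symmetric] del: ennreal_plus)
    finally show ?thesis using J E0[of n] by (subst (asm) ennreal_le_iff) (auto intro!: add_nonneg_nonneg mult_nonneg_nonneg)
  qed
  have limN: "(\<lambda>n. L2_norm_unit (pf (p n))) \<longlonglongrightarrow> L2_norm_unit f"
  proof -
    have *: "\<bar>L2_norm_unit (pf (p n)) - L2_norm_unit f\<bar> \<le> (1/4) ^ n" for n
      using L2_norm_unit_triangle[OF pfL[of "p n"] L2_unit_diff[OF f pfL[of "p n"]]]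
        L2_norm_unit_triangle[OF f L2_unit_diff[OF pfL[of "p n"] f]]
        p[of n] L2_norm_unit_minus_commute[of f "pf (p n)"] by (simp add: abs_le_iff)
    have "(\<lambda>n. L2_norm_unit (pf (p n)) - L2_norm_unit f) \<longlonglongrightarrow> 0"
    proof (rule Lim_null_comparison)
      show "\<forall>\<^sub>F n in sequentially. norm (L2_norm_unit (pf (p n)) - L2_norm_unit f) \<le> (1/4) ^ n"
        using * by simp
      show "(\<lambda>n. (1/4::real) ^ n) \<longlonglongrightarrow> 0" by (rule LIMSEQ_realpow_zero) auto
    qed
    then show ?thesis by (simp add: LIM_zero_iff)
  qed
  have limA: "A \<longlonglongrightarrow> A'" unfolding A_def A'_def by (intro tendsto_intros limN)
  have limE: "E \<longlonglongrightarrow> 0"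
  proof -
    have "(\<lambda>n. 8 * pi * ((1/16::real) ^ n + (1/8) ^ n)) \<longlonglongrightarrow> 8 * pi * (0 + 0)"
      by (intro tendsto_intros LIMSEQ_realpow_zero) auto
    moreover have "8 * pi * ((1/16::real) ^ n + (1/8) ^ n) = E n" for n
    proof -
      have "(2::real) ^ n * (1/16) ^ n = (1/8) ^ n" by (simp flip: power_mult_distrib)
      then show ?thesis unfolding E_def by (simp add: algebra_simps)
    qed
    ultimately show ?thesis by simp
  qed
  have lim2: "(\<lambda>n. (1 + (1/2::real) ^ n)) \<longlonglongrightarrow> 1 + 0"
    by (intro tendsto_intros LIMSEQ_realpow_zero) auto
  have "J \<le> (1 + 0) * A' + 0"
    by (rule LIMSEQ_le_const[OF tendsto_add[OF tendsto_mult[OF lim2 limA] limE]]) (use upJ in blast)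
  moreover have "A' \<le> (1 + 0) * J + 0"
    by (rule LIMSEQ_le[OF limA tendsto_add[OF tendsto_mult[OF lim2 tendsto_const] limE]]) (use lowJ in blast)
  ultimately have "J = A'" by simp
  then have "(\<integral>\<^sup>+y. ennreal ((cmod (F y))\<^sup>2) \<partial>lborel) = ennreal (2 * pi * (L2_norm_unit f)\<^sup>2)"
    using J by (simp add: I_def A'_def)
  moreover have "AE y in lborel. ((\<lambda>\<sigma>. mellin f (line y + of_real \<sigma>)) \<longlongrightarrow> F y) (at_right 0)"
    using AE2 by eventually_elim simp
  ultimately show ?thesis using that Fm by blast
qed

section \<open>Boundary values of Hardy space functions\<close>

text \<open>Convergence from the right is a Cauchy condition, and by continuity it may be tested on rational points only. Where it
  fails, \<open>Lim\<close> has one and the same arbitrary value.\<close>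

lemma boundary_value_borel_measurable:
  assumes g: "continuous_on half_plane g"
  shows "(\<lambda>y. boundary_value g (line y)) \<in> borel_measurable borel"
proof -
  define h where "h y \<sigma> = (if \<sigma> > 0 then g (line y + complex_of_real \<sigma>) else 0)" for y \<sigma>
  have hm[measurable]: "(\<lambda>y. h y \<sigma>) \<in> borel_measurable borel" for \<sigma>
  proof (cases "\<sigma> > 0")
    case True
    have "continuous_on UNIV (\<lambda>y. g (line y + complex_of_real \<sigma>))"
      by (rule continuous_on_compose2[OF g])
         (use True in \<open>auto simp: half_plane_def Complex_eq intro!: continuous_intros\<close>)
    then show ?thesis using True by (simp add: h_def borel_measurable_continuous_onI)
  qed (simp add: h_def)
  have hc: "continuous_on {0<..} (h y)" for y
  proof -
    have "continuous_on {0<..} (\<lambda>\<sigma>. g (line y + complex_of_real \<sigma>))"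
      by (rule continuous_on_compose2[OF g]) (auto simp: half_plane_def intro!: continuous_intros)
    then show ?thesis by (rule continuous_on_eq) (simp add: h_def)
  qed
  define E where "E y \<longleftrightarrow> (\<forall>m::nat. \<exists>n::nat. \<forall>p q::rat. 0 < p \<and> real_of_rat p < 1 / (real n + 1) \<and> 0 < q \<and> real_of_rat q < 1 / (real n + 1)
      \<longrightarrow> dist (h y (real_of_rat p)) (h y (real_of_rat q)) \<le> 1 / (real m + 1))" for y
  have Em[measurable]: "Measurable.pred borel E" unfolding E_def by measurable
  define c0 :: complex where "c0 = (THE l. False)"
  have eq_h: "((\<lambda>\<sigma>. g (line y + complex_of_real \<sigma>)) \<longlongrightarrow> l) (at_right 0) \<longleftrightarrow> (h y \<longlongrightarrow> l) (at_right 0)" for y l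
    by (rule filterlim_cong) (auto simp: h_def eventually_at_filter)
  have conv_imp: "E y" if lim: "(h y \<longlongrightarrow> l) (at_right 0)" for y l
    unfolding E_def
  proof (intro allI)
    fix m :: nat
    have "\<forall>\<^sub>F \<sigma> in at_right 0. dist (h y \<sigma>) l < 1 / (2 * (real m + 1))"
      by (rule tendstoD[OF lim]) simp
    then obtain b where b: "b > 0" "\<And>\<sigma>. 0 < \<sigma> \<Longrightarrow> \<sigma> < b \<Longrightarrow> dist (h y \<sigma>) l < 1 / (2 * (real m + 1))"
      unfolding eventually_at_right_field by blast
    obtain n :: nat where n: "1 / (real n + 1) < b" using reals_Archimedean[OF b(1)] by (auto simp: inverse_eq_divide add.commute)
    have "dist (h y (real_of_rat p)) (h y (real_of_rat q)) \<le> 1 / (real m + 1)"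
      if "0 < p \<and> real_of_rat p < 1 / (real n + 1) \<and> 0 < q \<and> real_of_rat q < 1 / (real n + 1)" for p q
    proof -
      have "dist (h y (real_of_rat p)) l < 1 / (2 * (real m + 1))" "dist (h y (real_of_rat q)) l < 1 / (2 * (real m + 1))"
        by (intro b(2); use that n in simp)+
      then have "dist (h y (real_of_rat p)) (h y (real_of_rat q)) < 1 / (2 * (real m + 1)) + 1 / (2 * (real m + 1))"
        using dist_triangle2[of "h y (real_of_rat p)" "h y (real_of_rat q)" l] by linarith
      also have "\<dots> = 1 / (real m + 1)" by (simp add: field_simps)
      finally show ?thesis by simp
    qed
    then show "\<exists>n::nat. \<forall>p q::rat. 0 < p \<and> real_of_rat p < 1 / (real n + 1) \<and> 0 < q \<and> real_of_rat q < 1 / (real n + 1)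
      \<longrightarrow> dist (h y (real_of_rat p)) (h y (real_of_rat q)) \<le> 1 / (real m + 1)" by blast
  qed
  have imp_conv: "(h y \<longlongrightarrow> lim (\<lambda>k. h y (1 / (real k + 1)))) (at_right 0)" if Ey: "E y" for y
  proof -
    have real_osc: "\<exists>n::nat. \<forall>a b. 0 < a \<and> a < 1 / (real n + 1) \<and> 0 < b \<and> b < 1 / (real n + 1) \<longrightarrow> dist (h y a) (h y b) \<le> 1 / (real m + 1)" for m :: nat
    proof -
      obtain n :: nat where n: "\<And>p q::rat. 0 < p \<Longrightarrow> real_of_rat p < 1 / (real n + 1) \<Longrightarrow> 0 < q \<Longrightarrow> real_of_rat q < 1 / (real n + 1)
        \<Longrightarrow> dist (h y (real_of_rat p)) (h y (real_of_rat q)) \<le> 1 / (real m + 1)"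
        using Ey unfolding E_def by metis
      have approx: "\<exists>s. (\<forall>i. 0 < s i \<and> real_of_rat (s i) < 1 / (real n + 1)) \<and> (\<lambda>i. h y (real_of_rat (s i))) \<longlonglongrightarrow> h y a"
        if a: "0 < a" "a < 1 / (real n + 1)" for a
      proof -
        have "\<exists>r::rat. a < real_of_rat r \<and> real_of_rat r < min (1 / (real n + 1)) (a + 1 / (real i + 1))" for i :: nat
          using a of_rat_dense[of a "min (1 / (real n + 1)) (a + 1 / (real i + 1))"] by auto
        then obtain s :: "nat \<Rightarrow> rat" where s: "\<And>i. a < real_of_rat (s i)" "\<And>i. real_of_rat (s i) < 1 / (real n + 1)"
            "\<And>i. real_of_rat (s i) < a + 1 / (real i + 1)" by (metis min_less_iff_conj)
        have "(\<lambda>i. real_of_rat (s i)) \<longlonglongrightarrow> a"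
        proof (rule tendsto_sandwich[of "\<lambda>_. a" _ _ "\<lambda>i. a + 1 / (real i + 1)"])
          show "(\<lambda>i. a + 1 / (real i + 1)) \<longlonglongrightarrow> a" by real_asymp
        qed (use s in \<open>auto simp: less_imp_le\<close>)
        moreover have "isCont (h y) a" using hc[of y] a by (simp add: continuous_on_eq_continuous_at)
        ultimately have "(\<lambda>i. h y (real_of_rat (s i))) \<longlonglongrightarrow> h y a" by (rule isCont_tendsto_compose[rotated])
        moreover have "0 < s i" for i
        proof -
          have "0 < real_of_rat (s i)" using s(1)[of i] a by linarith
          then show ?thesis by simp
        qed
        ultimately show ?thesis using s by blast
      qed
      have "dist (h y a) (h y b) \<le> 1 / (real m + 1)" if ab: "0 < a" "a < 1 / (real n + 1)" "0 < b" "b < 1 / (real n + 1)" for a b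
      proof -
        obtain s where s: "\<And>i. 0 < s i" "\<And>i. real_of_rat (s i) < 1 / (real n + 1)" "(\<lambda>i. h y (real_of_rat (s i))) \<longlonglongrightarrow> h y a"
          using approx[OF ab(1,2)] by blast
        obtain t where t: "\<And>i. 0 < t i" "\<And>i. real_of_rat (t i) < 1 / (real n + 1)" "(\<lambda>i. h y (real_of_rat (t i))) \<longlonglongrightarrow> h y b"
          using approx[OF ab(3,4)] by blast
        show ?thesis
          by (rule LIMSEQ_le_const2[OF tendsto_dist[OF s(3) t(3)]]) (use n s t in blast)
      qed
      then show ?thesis by blast
    qed
    define x where "x k = h y (1 / (real k + 1))" for k :: nat
    have "Cauchy x"
    proof (rule metric_CauchyI)
      fix e :: real assume "e > 0"
      then obtain m :: nat where m: "1 / (real m + 1) < e" using reals_Archimedean by (auto simp: inverse_eq_divide add.commute)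
      obtain n where n: "\<And>a b. 0 < a \<Longrightarrow> a < 1 / (real n + 1) \<Longrightarrow> 0 < b \<Longrightarrow> b < 1 / (real n + 1) \<Longrightarrow> dist (h y a) (h y b) \<le> 1 / (real m + 1)"
        using real_osc[of m] by blast
      have "dist (x i) (x j) < e" if "i \<ge> Suc n" "j \<ge> Suc n" for i j
        unfolding x_def using that m
        by (intro le_less_trans[OF n]) (auto simp: field_simps)
      then show "\<exists>M. \<forall>m\<ge>M. \<forall>n\<ge>M. dist (x m) (x n) < e" by blast
    qed
    then have xl: "x \<longlonglongrightarrow> lim x" by (simp add: Cauchy_convergent_iff convergent_LIMSEQ_iff)
    have "(h y \<longlongrightarrow> lim x) (at_right 0)"
    proof (rule tendstoI)
      fix e :: real assume "e > 0"
      then obtain m :: nat where m: "1 / (real m + 1) < e" using reals_Archimedean by (auto simp: inverse_eq_divide add.commute)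
      obtain n where n: "\<And>a b. 0 < a \<Longrightarrow> a < 1 / (real n + 1) \<Longrightarrow> 0 < b \<Longrightarrow> b < 1 / (real n + 1) \<Longrightarrow> dist (h y a) (h y b) \<le> 1 / (real m + 1)"
        using real_osc[of m] by blast
      have "dist (h y \<sigma>) (lim x) < e" if "0 < \<sigma>" "\<sigma> < 1 / (real n + 1)" for \<sigma>
      proof -
        have "dist (h y \<sigma>) (lim x) \<le> 1 / (real m + 1)"
        proof (rule LIMSEQ_le_const2[OF tendsto_dist[OF tendsto_const xl]], intro exI[of _ "Suc n"] allI impI)
          fix k assume "Suc n \<le> k"
          then show "dist (h y \<sigma>) (x k) \<le> 1 / (real m + 1)"
            unfolding x_def by (intro n that) (auto simp: field_simps)
        qed
        then show ?thesis using m by linarith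
      qed
      then show "\<forall>\<^sub>F \<sigma> in at_right 0. dist (h y \<sigma>) (lim x) < e"
        unfolding eventually_at_right_field by (intro exI[of _ "1 / (real n + 1)"]) auto
    qed
    then show ?thesis by (simp add: x_def[abs_def])
  qed
  have "boundary_value g (line y) = (if E y then lim (\<lambda>k. h y (1 / (real k + 1))) else c0)" for y
  proof (cases "E y")
    case True
    have "boundary_value g (line y) = lim (\<lambda>k. h y (1 / (real k + 1)))"
      unfolding boundary_value_def
      by (rule tendsto_Lim) (simp, simp only: eq_h, rule imp_conv[OF True])
    then show ?thesis using True by simp
  next
    case False
    then have "\<not> ((\<lambda>\<sigma>. g (line y + complex_of_real \<sigma>)) \<longlongrightarrow> l) (at_right 0)" for l
      using eq_h conv_imp by blast
    then show ?thesis using False by (simp only: boundary_value_def c0_def t2_space_class.Lim_def if_False)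
  qed
  then show ?thesis by simp
qed

lemma Hardy2_half_plane_continuous_on:
  assumes g: "g \<in> Hardy2_half_plane" shows "continuous_on half_plane g"
proof -
  obtain \<phi> where \<phi>: "\<phi> \<in> Hardy2_disk" and g\<phi>: "\<And>s. s \<in> half_plane \<Longrightarrow> g s = \<phi> (s / (s + 1))"
    using g by (auto simp: Hardy2_half_plane_def)
  have nz: "s + 1 \<noteq> 0" if "s \<in> half_plane" for s
    using that by (auto simp: half_plane_def complex_eq_iff)
  have "continuous_on (ball 0 1) \<phi>" using \<phi> by (auto simp: Hardy2_disk_def intro: holomorphic_on_imp_continuous_on)
  then have "continuous_on half_plane (\<lambda>s. \<phi> (s / (s + 1)))"
    by (rule continuous_on_compose2) (use nz half_plane_to_disk in \<open>auto intro!: continuous_intros\<close>)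
  then show ?thesis by (rule continuous_on_eq) (simp add: g\<phi>)
qed

lemma Hardy2_half_plane_boundary:
  assumes g: "g \<in> Hardy2_half_plane"
  shows "AE y in lborel. ((\<lambda>\<sigma>. g (line y + of_real \<sigma>)) \<longlongrightarrow> boundary_value g (line y)) (at_right 0)"
    and "(\<integral>\<^sup>+y. ennreal ((cmod (boundary_value g (line y)))\<^sup>2 / (1/4 + y\<^sup>2)) \<partial>lborel) < \<infinity>"
proof -
  obtain k where k: "k \<in> L2_unit" and gk: "\<And>s. s \<in> half_plane \<Longrightarrow> g s = (s + 1) * mellin k s"
    using Hardy2_half_plane_mellin[OF g] by blast
  obtain F where F: "F \<in> borel_measurable borel"
    and lim: "AE y in lborel. ((\<lambda>\<sigma>. mellin k (line y + of_real \<sigma>)) \<longlongrightarrow> F y) (at_right 0)"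
    and I: "(\<integral>\<^sup>+y. ennreal ((cmod (F y))\<^sup>2) \<partial>lborel) = ennreal (2 * pi * (L2_norm_unit k)\<^sup>2)"
    by (rule mellin_boundary_Plancherel[OF k])
  have *: "AE y in lborel. ((\<lambda>\<sigma>. g (line y + of_real \<sigma>)) \<longlongrightarrow> (line y + 1) * F y) (at_right 0)"
    using lim
  proof eventually_elim
    case (elim y)
    have "((\<lambda>\<sigma>. (line y + of_real \<sigma> + 1) * mellin k (line y + of_real \<sigma>)) \<longlongrightarrow> (line y + of_real 0 + 1) * F y) (at_right 0)"
      by (intro tendsto_intros elim)
    moreover have "\<forall>\<^sub>F \<sigma> in at_right 0. (line y + of_real \<sigma> + 1) * mellin k (line y + of_real \<sigma>) = g (line y + of_real \<sigma>)"
      unfolding eventually_at_filter by (auto simp: gk half_plane_def)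
    ultimately show ?case by (simp add: Lim_transform_eventually)
  qed
  have bv: "boundary_value g (line y) = l" if "((\<lambda>\<sigma>. g (line y + of_real \<sigma>)) \<longlongrightarrow> l) (at_right 0)" for y l
    unfolding boundary_value_def by (rule tendsto_Lim[OF _ that]) simp
  show "AE y in lborel. ((\<lambda>\<sigma>. g (line y + of_real \<sigma>)) \<longlongrightarrow> boundary_value g (line y)) (at_right 0)"
    using *
  proof eventually_elim
    case (elim y)
    then show ?case by (simp only: bv[OF elim])
  qed
  have "(\<integral>\<^sup>+y. ennreal ((cmod (boundary_value g (line y)))\<^sup>2 / (1/4 + y\<^sup>2)) \<partial>lborel) = (\<integral>\<^sup>+y. ennreal ((cmod (F y))\<^sup>2) \<partial>lborel)"
  proof (intro nn_integral_cong_AE, use * in eventually_elim)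
    case (elim y)
    have sq: "(cmod (line y + 1))\<^sup>2 = 1/4 + y\<^sup>2" unfolding cmod_power2 by (simp add: power2_eq_square)
    have "1/4 + y\<^sup>2 > 0" by (simp add: add_pos_nonneg)
    then show ?case unfolding bv[OF elim] norm_mult power_mult_distrib sq by simp
  qed
  then show "(\<integral>\<^sup>+y. ennreal ((cmod (boundary_value g (line y)))\<^sup>2 / (1/4 + y\<^sup>2)) \<partial>lborel) < \<infinity>"
    using I by simp
qed

section \<open>The transposed operator\<close>

text \<open>On the closed half-plane $|1+s|$ and $|1+s+\tau|$ are at least $\frac12$, so adding $\tau$ changes either by a bounded factor.\<close>

lemma shift_factor_bounds:
  assumes \<tau>: "Re \<tau> \<ge> 0" and s: "Re s \<ge> -1/2"
  shows "cmod ((1 + s + \<tau>) / (1 + s)) \<le> 1 + 2 * cmod \<tau>" "cmod ((1 + s) / (1 + s + \<tau>)) \<le> 1 + 2 * cmod \<tau>"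
    "1 + s \<noteq> 0" "1 + s + \<tau> \<noteq> 0"
proof -
  have *: "cmod (w / v) \<le> 1 + 2 * cmod \<tau>" if "Re v \<ge> 1/2" "w - v = \<tau> \<or> v - w = \<tau>" for v w
  proof -
    have v: "cmod v \<ge> 1/2" using that(1) complex_Re_le_cmod[of v] by linarith
    have "cmod w \<le> cmod v + cmod \<tau>"
      using that(2) norm_triangle_ineq[of v "w - v"] by (auto simp: norm_minus_commute)
    also have "cmod \<tau> \<le> 2 * cmod \<tau> * cmod v" using mult_left_mono[OF v, of "2 * cmod \<tau>"] by simp
    finally have "cmod w \<le> (1 + 2 * cmod \<tau>) * cmod v" by (simp add: algebra_simps)
    then show ?thesis using v by (simp add: norm_divide divide_le_eq)
  qed
  show "cmod ((1 + s + \<tau>) / (1 + s)) \<le> 1 + 2 * cmod \<tau>" "cmod ((1 + s) / (1 + s + \<tau>)) \<le> 1 + 2 * cmod \<tau>"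
    using \<tau> s by (auto intro!: *)
  show "1 + s \<noteq> 0" "1 + s + \<tau> \<noteq> 0" using \<tau> s by (auto simp: complex_eq_iff)
qed

text \<open>In terms of Mellin transforms the transpose of $T$ maps $H(s)$ to $\frac{1+s+\tau}{1+s}\, g(s) H(s+\tau)$. When $(1+s+\tau)H(s+\tau)$ is
  bounded, this is visibly $\frac{1}{1+s}$ times a function in the Hardy space, so its preimage $k$ in $L^2[0,1]$
  exists; the integral identity computes the norm of $k$ on the boundary.\<close>

lemma transpose_exists:
  assumes g: "g \<in> Hardy2_half_plane" and \<tau>: "Re \<tau> \<ge> 0"
    and b: "(\<lambda>s. (1 + s + \<tau>) * H (s + \<tau>)) holomorphic_on half_plane"
    and bound: "\<And>s. s \<in> half_plane \<Longrightarrow> cmod ((1 + s + \<tau>) * H (s + \<tau>)) \<le> M"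
    and Hlim: "\<And>y. ((\<lambda>\<sigma>. H (line y + of_real \<sigma> + \<tau>)) \<longlongrightarrow> H (line y + \<tau>)) (at_right 0)"
  shows "\<exists>k\<in>L2_unit. (\<forall>s\<in>half_plane. mellin k s = (1 + s + \<tau>) / (1 + s) * g s * H (s + \<tau>))
    \<and> (\<integral>\<^sup>+y. ennreal ((cmod ((1 + line y + \<tau>) / (1 + line y) * boundary_value g (line y) * H (line y + \<tau>)))\<^sup>2) \<partial>lborel)
       = ennreal (2 * pi * (L2_norm_unit k)\<^sup>2)"
proof -
  have "(\<lambda>s. g s * ((1 + s + \<tau>) * H (s + \<tau>))) \<in> Hardy2_half_plane"
    by (rule Hardy2_half_plane_mult_bounded[OF g b bound])
  from Hardy2_half_plane_mellin[OF this]
  obtain k where k: "k \<in> L2_unit" and kg: "\<And>s. s \<in> half_plane \<Longrightarrow> g s * ((1 + s + \<tau>) * H (s + \<tau>)) = (s + 1) * mellin k s"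
    by blast
  have K: "mellin k s = (1 + s + \<tau>) / (1 + s) * g s * H (s + \<tau>)" if "s \<in> half_plane" for s
  proof -
    have "1 + s \<noteq> 0" using that by (auto simp: half_plane_def complex_eq_iff)
    then show ?thesis using kg[OF that] by (simp add: field_simps)
  qed
  obtain F where F: "F \<in> borel_measurable borel"
    and lim: "AE y in lborel. ((\<lambda>\<sigma>. mellin k (line y + of_real \<sigma>)) \<longlongrightarrow> F y) (at_right 0)"
    and I: "(\<integral>\<^sup>+y. ennreal ((cmod (F y))\<^sup>2) \<partial>lborel) = ennreal (2 * pi * (L2_norm_unit k)\<^sup>2)"
    by (rule mellin_boundary_Plancherel[OF k])
  have "AE y in lborel. F y = (1 + line y + \<tau>) / (1 + line y) * boundary_value g (line y) * H (line y + \<tau>)"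
    using lim Hardy2_half_plane_boundary(1)[OF g]
  proof eventually_elim
    case (elim y)
    define z where "z = line y"
    have nz: "1 + z \<noteq> 0" by (auto simp: z_def complex_eq_iff)
    have "((\<lambda>\<sigma>. (1 + (z + of_real \<sigma>) + \<tau>) / (1 + (z + of_real \<sigma>)) * g (z + of_real \<sigma>) * H (z + of_real \<sigma> + \<tau>)) \<longlongrightarrow>
        (1 + (z + of_real 0) + \<tau>) / (1 + (z + of_real 0)) * boundary_value g z * H (z + \<tau>)) (at_right 0)"
      using nz by (intro tendsto_intros elim(2)[folded z_def] Hlim[of y, folded z_def]) auto
    moreover have "\<forall>\<^sub>F \<sigma> in at_right 0. (1 + (z + of_real \<sigma>) + \<tau>) / (1 + (z + of_real \<sigma>)) * g (z + of_real \<sigma>) * H (z + of_real \<sigma> + \<tau>)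
        = mellin k (z + of_real \<sigma>)"
      unfolding eventually_at_filter by (auto simp: K half_plane_def z_def)
    ultimately have "((\<lambda>\<sigma>. mellin k (z + of_real \<sigma>)) \<longlongrightarrow> (1 + z + \<tau>) / (1 + z) * boundary_value g z * H (z + \<tau>)) (at_right 0)"
      by (simp add: Lim_transform_eventually)
    then show ?case using tendsto_unique[OF _ elim(1)] by (simp add: z_def)
  qed
  then have eq: "(\<integral>\<^sup>+y. ennreal ((cmod ((1 + line y + \<tau>) / (1 + line y) * boundary_value g (line y) * H (line y + \<tau>)))\<^sup>2) \<partial>lborel)
     = (\<integral>\<^sup>+y. ennreal ((cmod (F y))\<^sup>2) \<partial>lborel)"
    by (intro nn_integral_cong_AE) (auto elim: eventually_mono)
  show ?thesis
    using k K trans[OF eq I] by (intro bexI[of _ k] conjI ballI)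
qed

lemma monomial_operator_altdef:
  "degree p \<le> N \<Longrightarrow> monomial_operator \<tau> g p x = (\<Sum>n\<le>N. coeff p n *
        ((1 + of_nat n + \<tau>) / (1 + of_nat n) * g (of_nat n) * complex_of_real x powr (of_nat n + \<tau>)))"
  unfolding monomial_operator_def by (rule sum.mono_neutral_left) (auto simp: coeff_eq_0)

lemma monomial_operator_add: "monomial_operator \<tau> g (p + q) x = monomial_operator \<tau> g p x + monomial_operator \<tau> g q x"
proof -
  define N where "N = max (degree p) (degree q)"
  have "degree (p + q) \<le> N" unfolding N_def by (rule degree_add_le) auto
  moreover have "degree p \<le> N" "degree q \<le> N" by (simp_all add: N_def)
  ultimately show ?thesis
    by (simp only: monomial_operator_altdef[of _ N] coeff_add distrib_right sum.distrib)
qed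

lemma monomial_operator_smult: "monomial_operator \<tau> g (smult c p) x = c * monomial_operator \<tau> g p x"
  using monomial_operator_altdef[OF degree_smult_le[of c p], of \<tau> g x]
  by (simp add: monomial_operator_def sum_distrib_left mult.assoc)

lemma monomial_operator_L2: "Re \<tau> \<ge> 0 \<Longrightarrow> monomial_operator \<tau> g p \<in> L2_unit"
proof -
  assume \<tau>: "Re \<tau> \<ge> 0"
  have "(\<lambda>x. \<Sum>n\<le>degree p. (coeff p n * ((1 + of_nat n + \<tau>) / (1 + of_nat n) * g (of_nat n))) * complex_of_real x powr (of_nat n + \<tau>)) \<in> L2_unit"
    by (intro L2_unit_sum L2_unit_scale powr_L2) (use \<tau> in \<open>simp add: add_nonneg_nonneg less_le_trans[of _ 0]\<close>)
  then show ?thesis by (simp add: monomial_operator_def[abs_def] mult.assoc)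
qed

lemma integral_poly_mult:
  assumes k: "k \<in> L2_unit"
  shows "(\<integral>x. poly p (complex_of_real x) * k x \<partial>unit_leb) = (\<Sum>n\<le>degree p. coeff p n * mellin k (of_nat n))"
proof -
  have "AE x in lebesgue. x \<noteq> (0::real)" by (rule AE_completion) (rule AE_lborel_singleton)
  then have nz: "AE x in unit_leb. x \<noteq> 0" by (auto simp: AE_restrict_space_iff elim: eventually_mono)
  have i: "integrable unit_leb (\<lambda>x. coeff p n * (k x * complex_of_real x powr of_nat n))" for n
    by (intro integrable_mult_right L2_unit_mult_integrable k powr_L2) simp
  have "(\<integral>x. poly p (complex_of_real x) * k x \<partial>unit_leb)
      = (\<integral>x. (\<Sum>n\<le>degree p. coeff p n * (k x * complex_of_real x powr of_nat n)) \<partial>unit_leb)"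
  proof (rule integral_cong_AE)
    show "(\<lambda>x. poly p (complex_of_real x) * k x) \<in> borel_measurable unit_leb"
      by (intro borel_measurable_integrable L2_unit_mult_integrable L2_unit_poly k)
    show "(\<lambda>x. \<Sum>n\<le>degree p. coeff p n * (k x * complex_of_real x powr of_nat n)) \<in> borel_measurable unit_leb"
      by (intro borel_measurable_sum borel_measurable_integrable i)
    show "AE x in unit_leb. poly p (complex_of_real x) * k x = (\<Sum>n\<le>degree p. coeff p n * (k x * complex_of_real x powr of_nat n))"
      using nz by eventually_elim (simp only: poly_altdef sum_distrib_right, intro sum.cong refl, simp)
  qed
  also have "\<dots> = (\<Sum>n\<le>degree p. coeff p n * mellin k (of_nat n))"
    by (subst Bochner_Integration.integral_sum[OF i]) (simp add: mellin_def)
  finally show ?thesis .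
qed

text \<open>On both sides only the values of the transforms at $s = n$ occur.\<close>

lemma transpose_pairing:
  assumes \<tau>: "Re \<tau> \<ge> 0" and h: "h \<in> L2_unit" and k: "k \<in> L2_unit"
    and K: "\<And>s. s \<in> half_plane \<Longrightarrow> mellin k s = (1 + s + \<tau>) / (1 + s) * g s * mellin h (s + \<tau>)"
  shows "(\<integral>x. monomial_operator \<tau> g p x * h x \<partial>unit_leb) = (\<integral>x. poly p (complex_of_real x) * k x \<partial>unit_leb)"
proof -
  let ?c = "\<lambda>n. coeff p n * ((1 + of_nat n + \<tau>) / (1 + of_nat n) * g (of_nat n))"
  have i: "integrable unit_leb (\<lambda>x. ?c n * (h x * complex_of_real x powr (of_nat n + \<tau>)))" for n
    by (intro integrable_mult_right L2_unit_mult_integrable h powr_L2) (use \<tau> in \<open>simp add: add_nonneg_nonneg less_le_trans[of _ 0]\<close>)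
  have "(\<integral>x. monomial_operator \<tau> g p x * h x \<partial>unit_leb)
      = (\<integral>x. (\<Sum>n\<le>degree p. ?c n * (h x * complex_of_real x powr (of_nat n + \<tau>))) \<partial>unit_leb)"
    unfolding monomial_operator_def sum_distrib_right by (simp add: mult_ac)
  also have "\<dots> = (\<Sum>n\<le>degree p. ?c n * mellin h (of_nat n + \<tau>))"
    by (subst Bochner_Integration.integral_sum[OF i]) (simp add: mellin_def)
  also have "\<dots> = (\<Sum>n\<le>degree p. coeff p n * mellin k (of_nat n))"
    by (intro sum.cong refl) (simp add: K half_plane_def)
  finally show ?thesis by (simp add: integral_poly_mult[OF k])
qed

text \<open>The norm of $k$ is attained against its conjugate, which polynomials approximate.\<close>

lemma L2_norm_le_by_polynomials:
  assumes k: "k \<in> L2_unit" and C: "C \<ge> 0"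
    and bound: "\<And>p. cmod (\<integral>x. poly p (complex_of_real x) * k x \<partial>unit_leb) \<le> C * L2_norm_unit (poly_fun p)"
  shows "L2_norm_unit k \<le> C"
proof (cases "L2_norm_unit k = 0")
  case False
  define n where "n = L2_norm_unit k"
  have n: "n > 0" using False L2_norm_unit_nonneg[of k] by (simp add: n_def less_le)
  define kc where "kc = (\<lambda>x. cnj (k x))"
  have kc: "kc \<in> L2_unit" and kcn: "L2_norm_unit kc = n"
    unfolding kc_def n_def by (simp_all add: L2_unit_cnj[OF k] L2_norm_unit_cnj)
  have "n\<^sup>2 \<le> C * n + e" if e: "e > 0" for e
  proof -
    define d where "d = e / (C + n)"
    have d: "d > 0" "d * (C + n) = e" using e n C by (auto simp: d_def intro!: divide_pos_pos add_nonneg_pos)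
    obtain p where p: "L2_norm_unit (\<lambda>u. kc u - poly p (complex_of_real u)) < d"
      using polynomials_dense_L2_unit[OF kc d(1)] by blast
    let ?p = "\<lambda>u. poly p (complex_of_real u)"
    have dl: "(\<lambda>u. kc u - ?p u) \<in> L2_unit" by (intro L2_unit_diff kc L2_unit_poly)
    have "complex_of_real (n\<^sup>2) = (\<integral>x. complex_of_real ((cmod (k x))\<^sup>2) \<partial>unit_leb)"
      by (simp only: n_def L2_norm_unit_square integral_complex_of_real)
    also have "\<dots> = (\<integral>x. ?p x * k x + (kc x - ?p x) * k x \<partial>unit_leb)"
      by (intro Bochner_Integration.integral_cong refl) (simp only: complex_norm_square kc_def, simp add: algebra_simps)
    also have "\<dots> = (\<integral>x. ?p x * k x \<partial>unit_leb) + (\<integral>x. (kc x - ?p x) * k x \<partial>unit_leb)"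
      by (intro Bochner_Integration.integral_add L2_unit_mult_integrable L2_unit_poly dl k)
    finally have "n\<^sup>2 \<le> cmod (\<integral>x. ?p x * k x \<partial>unit_leb) + cmod (\<integral>x. (kc x - ?p x) * k x \<partial>unit_leb)"
      by (metis norm_of_real norm_triangle_ineq abs_power2)
    also have "\<dots> \<le> C * L2_norm_unit ?p + d * n"
      using bound[of p] order_trans[OF L2_unit_Cauchy_Schwarz[OF dl k] mult_right_mono[OF less_imp_le[OF p]]]
      by (intro add_mono) (auto simp: n_def)
    also have "L2_norm_unit ?p \<le> n + d"
      using L2_norm_unit_triangle[OF kc L2_unit_diff[OF L2_unit_poly[of p] kc]] p kcn
        L2_norm_unit_minus_commute[of kc ?p] by simp
    finally have "n\<^sup>2 \<le> C * (n + d) + d * n" using C by (simp add: mult_left_mono)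
    then show ?thesis using d(2) by (simp add: algebra_simps)
  qed
  then have "n\<^sup>2 \<le> C * n" by (rule field_le_epsilon)
  then show ?thesis using n by (simp add: power2_eq_square n_def)
qed (use C in simp)

section \<open>Extension from the polynomials\<close>

text \<open>The extension $Af$ is the element with $\|Tp - Af\| \le C\|p - f\|$ for all polynomials $p$. It exists by completeness, and
  linearity and the bound for $A$ follow by choosing $p$ close to $f$.\<close>

lemma extends_iff_bounded_on_polynomials:
  assumes T: "\<And>p. T p \<in> L2_unit" and add: "\<And>p q x. T (p + q) x = T p x + T q x" and smult: "\<And>c p x. T (smult c p) x = c * T p x"
  shows "extends_to_bounded_L2_operator T \<longleftrightarrow> (\<exists>C\<ge>0. \<forall>p. L2_norm_unit (T p) \<le> C * L2_norm_unit (poly_fun p))"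
proof
  assume "extends_to_bounded_L2_operator T"
  then obtain A where A: "bounded_L2_operator A" and ext: "\<And>p. AE x in unit_leb. A (poly_fun p) x = T p x"
    unfolding extends_to_bounded_L2_operator_def by blast
  obtain C where AL: "\<And>f. f \<in> L2_unit \<Longrightarrow> A f \<in> L2_unit" and C: "\<And>f. f \<in> L2_unit \<Longrightarrow> L2_norm_unit (A f) \<le> C * L2_norm_unit f"
    using A unfolding bounded_L2_operator_def by blast
  have "L2_norm_unit (T p) \<le> \<bar>C\<bar> * L2_norm_unit (poly_fun p)" for p
  proof -
    have "L2_norm_unit (T p) = L2_norm_unit (A (poly_fun p))"
      using ext[of p] by (intro L2_norm_unit_cong_AE L2_unit_measurable T AL L2_unit_poly) (auto elim: eventually_mono)
    also have "\<dots> \<le> C * L2_norm_unit (poly_fun p)" by (rule C[OF L2_unit_poly])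
    also have "\<dots> \<le> \<bar>C\<bar> * L2_norm_unit (poly_fun p)" by (intro mult_right_mono) auto
    finally show ?thesis .
  qed
  then show "\<exists>C\<ge>0. \<forall>p. L2_norm_unit (T p) \<le> C * L2_norm_unit (poly_fun p)"
    by (intro exI[of _ "\<bar>C\<bar>"]) simp
next
  assume "\<exists>C\<ge>0. \<forall>p. L2_norm_unit (T p) \<le> C * L2_norm_unit (poly_fun p)"
  then obtain C where C0: "C \<ge> 0" and C: "\<And>p. L2_norm_unit (T p) \<le> C * L2_norm_unit (poly_fun p)" by blast
  define pf where "pf p = (poly_fun p)" for p
  have pfL: "pf p \<in> L2_unit" for p unfolding pf_def by (rule L2_unit_poly)
  define N where "N = L2_norm_unit"
  have dens: "\<exists>p. N (\<lambda>x. pf p x - f x) < e" if "f \<in> L2_unit" "e > 0" for f e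
    using polynomials_dense_L2_unit[OF that] unfolding N_def pf_def by (metis L2_norm_unit_minus_commute)
  have Tdiff: "N (\<lambda>x. T p x - T q x) \<le> C * N (\<lambda>x. pf p x - pf q x)" for p q
  proof -
    have "T p x - T q x = T (p - q) x" for x
      using add[of p "smult (-1) q" x] smult[of "-1" q x] by simp
    then show ?thesis using C[of "p - q"] by (simp add: N_def pf_def)
  qed
  have tri: "N (\<lambda>x. f x - k x) \<le> N (\<lambda>x. f x - h x) + N (\<lambda>x. h x - k x)"
    if "f \<in> L2_unit" "h \<in> L2_unit" "k \<in> L2_unit" for f h k
    unfolding N_def by (rule L2_norm_unit_triangle_diff[OF that])
  have ex: "\<exists>a\<in>L2_unit. \<forall>p. N (\<lambda>x. T p x - a x) \<le> C * N (\<lambda>x. pf p x - f x)" if f: "f \<in> L2_unit" for f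
  proof -
    have "\<exists>p. N (\<lambda>x. pf p x - f x) < (1/2) ^ n" for n :: nat by (rule dens[OF f]) simp
    then obtain p where p: "\<And>n. N (\<lambda>x. pf (p n) x - f x) < (1/2) ^ n" by metis
    have pl: "(\<lambda>n. N (\<lambda>x. pf (p n) x - f x)) \<longlonglongrightarrow> 0"
    proof (rule Lim_null_comparison)
      show "\<forall>\<^sub>F n in sequentially. norm (N (\<lambda>x. pf (p n) x - f x)) \<le> (1/2) ^ n"
        using p by (auto simp: N_def less_imp_le)
      show "(\<lambda>n. (1/2::real) ^ n) \<longlonglongrightarrow> 0" by (rule LIMSEQ_realpow_zero) auto
    qed
    have "\<exists>M. \<forall>m\<ge>M. \<forall>n\<ge>M. L2_norm_unit (\<lambda>x. T (p m) x - T (p n) x) < e" if e: "e > 0" for e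
    proof -
      have x: "e / (2 * C + 1) > 0" using e C0 by simp
      then obtain M where M: "\<And>n. n \<ge> M \<Longrightarrow> N (\<lambda>x. pf (p n) x - f x) < e / (2 * C + 1)"
        using LIMSEQ_D[OF pl] by fastforce
      have "L2_norm_unit (\<lambda>x. T (p m) x - T (p n) x) < e" if mn: "m \<ge> M" "n \<ge> M" for m n
      proof -
        have "N (\<lambda>x. T (p m) x - T (p n) x) \<le> C * N (\<lambda>x. pf (p m) x - pf (p n) x)" by (rule Tdiff)
        also have "\<dots> \<le> C * (e / (2 * C + 1) + e / (2 * C + 1))"
          using tri[OF pfL f pfL, of "p m" "p n"] M[OF mn(1)] M[OF mn(2)] C0 L2_norm_unit_minus_commute[of f "pf (p n)"]
          by (intro mult_left_mono) (auto simp: N_def)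
        also have "\<dots> = e - e / (2 * C + 1)"
        proof -
          have "(2 * C + 1) * (e / (2 * C + 1)) = e" using C0 by simp
          then show ?thesis by (simp only: distrib_right distrib_left mult_1_left)
        qed
        also have "\<dots> < e" using x by simp
        finally show ?thesis by (simp add: N_def)
      qed
      then show ?thesis by blast
    qed
    from L2_unit_complete[OF T this] obtain a where a: "a \<in> L2_unit" and al: "(\<lambda>n. N (\<lambda>x. T (p n) x - a x)) \<longlonglongrightarrow> 0"
      unfolding N_def by blast
    have "N (\<lambda>x. T q x - a x) \<le> C * N (\<lambda>x. pf q x - f x)" for q
    proof -
      have "N (\<lambda>x. T q x - a x) \<le> C * (N (\<lambda>x. pf q x - f x) + N (\<lambda>x. pf (p n) x - f x)) + N (\<lambda>x. T (p n) x - a x)" for n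
      proof -
        have "N (\<lambda>x. T q x - a x) \<le> N (\<lambda>x. T q x - T (p n) x) + N (\<lambda>x. T (p n) x - a x)" by (intro tri T a)
        also have "N (\<lambda>x. T q x - T (p n) x) \<le> C * N (\<lambda>x. pf q x - pf (p n) x)" by (rule Tdiff)
        also have "\<dots> \<le> C * (N (\<lambda>x. pf q x - f x) + N (\<lambda>x. pf (p n) x - f x))"
          using tri[OF pfL f pfL, of q "p n"] C0 L2_norm_unit_minus_commute[of f "pf (p n)"]
          by (intro mult_left_mono) (auto simp: N_def)
        finally show ?thesis by simp
      qed
      moreover have "(\<lambda>n. C * (N (\<lambda>x. pf q x - f x) + N (\<lambda>x. pf (p n) x - f x)) + N (\<lambda>x. T (p n) x - a x)) \<longlonglongrightarrow> C * (N (\<lambda>x. pf q x - f x) + 0) + 0"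
        by (intro tendsto_intros pl al)
      ultimately have "N (\<lambda>x. T q x - a x) \<le> C * (N (\<lambda>x. pf q x - f x) + 0) + 0"
        by (intro LIMSEQ_le_const) blast+
      then show ?thesis by simp
    qed
    with a show ?thesis by blast
  qed
  then obtain A where A: "\<And>f. f \<in> L2_unit \<Longrightarrow> A f \<in> L2_unit"
    and AT: "\<And>f p. f \<in> L2_unit \<Longrightarrow> N (\<lambda>x. T p x - A f x) \<le> C * N (\<lambda>x. pf p x - f x)" by metis
  have AE_eq: "AE x in unit_leb. u x = v x" if u: "u \<in> L2_unit" and v: "v \<in> L2_unit" and le: "\<And>e. e > 0 \<Longrightarrow> N (\<lambda>x. u x - v x) \<le> B * e" for u v B
  proof -
    have "N (\<lambda>x. u x - v x) \<le> 0 + e" if e: "e > 0" for e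
    proof -
      have "N (\<lambda>x. u x - v x) \<le> B * (e / (\<bar>B\<bar> + 1))" by (rule le) (use e in simp)
      also have "\<dots> \<le> (\<bar>B\<bar> + 1) * (e / (\<bar>B\<bar> + 1))" using e by (intro mult_right_mono) auto
      also have "\<dots> = e" by simp
      finally show ?thesis by simp
    qed
    then have "N (\<lambda>x. u x - v x) \<le> 0" by (rule field_le_epsilon)
    then have "N (\<lambda>x. u x - v x) = 0" using L2_norm_unit_nonneg[of "\<lambda>x. u x - v x"] by (simp add: N_def)
    then show ?thesis using L2_norm_unit_eq_0_AE[OF L2_unit_diff[OF u v]] by (simp add: N_def)
  qed
  have "bounded_L2_operator A"
    unfolding bounded_L2_operator_def
  proof (intro conjI ballI allI)
    show "A f \<in> L2_unit" if "f \<in> L2_unit" for f by (rule A[OF that])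
    show "AE x in unit_leb. A (\<lambda>u. f u + h u) x = A f x + A h x" if f: "f \<in> L2_unit" and h: "h \<in> L2_unit" for f h
    proof (rule AE_eq[where B = "4 * C"])
      have fh: "(\<lambda>u. f u + h u) \<in> L2_unit" by (rule L2_unit_add[OF f h])
      show "A (\<lambda>u. f u + h u) \<in> L2_unit" "(\<lambda>x. A f x + A h x) \<in> L2_unit" by (intro A fh L2_unit_add f h)+
      fix e :: real assume e: "e > 0"
      obtain p q where p: "N (\<lambda>x. pf p x - f x) < e" and q: "N (\<lambda>x. pf q x - h x) < e" using dens[OF f e] dens[OF h e] by blast
      have sum: "N (\<lambda>x. u x + v x - (u' x + v' x)) \<le> N (\<lambda>x. u x - u' x) + N (\<lambda>x. v x - v' x)"
        if "u \<in> L2_unit" "v \<in> L2_unit" "u' \<in> L2_unit" "v' \<in> L2_unit" for u v u' v'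
        using L2_norm_unit_triangle[OF L2_unit_diff[OF that(1,3)] L2_unit_diff[OF that(2,4)]] by (simp add: N_def algebra_simps)
      have "N (\<lambda>x. T (p + q) x - A (\<lambda>u. f u + h u) x) \<le> C * N (\<lambda>x. pf (p + q) x - (f x + h x))" by (rule AT[OF fh])
      also have "\<dots> \<le> C * (N (\<lambda>x. pf p x - f x) + N (\<lambda>x. pf q x - h x))"
        using sum[OF pfL pfL f h, of p q] C0 by (intro mult_left_mono) (auto simp: pf_def)
      also have "\<dots> \<le> C * (e + e)" using p q C0 by (intro mult_left_mono) auto
      finally have 1: "N (\<lambda>x. T (p + q) x - A (\<lambda>u. f u + h u) x) \<le> C * (e + e)" .
      have "N (\<lambda>x. T (p + q) x - (A f x + A h x)) \<le> N (\<lambda>x. T p x - A f x) + N (\<lambda>x. T q x - A h x)"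
        unfolding add by (rule sum[OF T T A[OF f] A[OF h]])
      also have "\<dots> \<le> C * N (\<lambda>x. pf p x - f x) + C * N (\<lambda>x. pf q x - h x)" by (intro add_mono AT f h)
      also have "\<dots> \<le> C * e + C * e" using p q C0 by (intro add_mono mult_left_mono) auto
      finally have 2: "N (\<lambda>x. T (p + q) x - (A f x + A h x)) \<le> C * e + C * e" .
      have "N (\<lambda>x. A (\<lambda>u. f u + h u) x - (A f x + A h x)) \<le> N (\<lambda>x. A (\<lambda>u. f u + h u) x - T (p + q) x) + N (\<lambda>x. T (p + q) x - (A f x + A h x))"
        by (intro tri A fh T L2_unit_add f h)
      then show "N (\<lambda>x. A (\<lambda>u. f u + h u) x - (A f x + A h x)) \<le> 4 * C * e"
        using 1 2 L2_norm_unit_minus_commute[of "A (\<lambda>u. f u + h u)" "T (p + q)"] by (simp add: N_def algebra_simps)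
    qed
    show "AE x in unit_leb. A (\<lambda>u. c * f u) x = c * A f x" if f: "f \<in> L2_unit" for c f
    proof (rule AE_eq[where B = "2 * cmod c * C"])
      have cf: "(\<lambda>u. c * f u) \<in> L2_unit" by (rule L2_unit_scale[OF f])
      show "A (\<lambda>u. c * f u) \<in> L2_unit" "(\<lambda>x. c * A f x) \<in> L2_unit" by (intro A cf L2_unit_scale f)+
      fix e :: real assume e: "e > 0"
      obtain p where p: "N (\<lambda>x. pf p x - f x) < e" using dens[OF f e] by blast
      have sc: "N (\<lambda>x. c * u x - c * v x) = cmod c * N (\<lambda>x. u x - v x)" for u v
        using L2_norm_unit_scale[of c "\<lambda>x. u x - v x"] by (simp add: N_def right_diff_distrib)
      have "N (\<lambda>x. T (smult c p) x - A (\<lambda>u. c * f u) x) \<le> C * N (\<lambda>x. pf (smult c p) x - c * f x)" by (rule AT[OF cf])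
      also have "\<dots> = C * (cmod c * N (\<lambda>x. pf p x - f x))" using sc[of "pf p" f] by (simp add: pf_def)
      also have "\<dots> \<le> C * (cmod c * e)" using p C0 by (intro mult_left_mono) auto
      finally have 1: "N (\<lambda>x. T (smult c p) x - A (\<lambda>u. c * f u) x) \<le> C * (cmod c * e)" .
      have "N (\<lambda>x. T (smult c p) x - c * A f x) = cmod c * N (\<lambda>x. T p x - A f x)" unfolding smult by (rule sc)
      also have "\<dots> \<le> cmod c * (C * N (\<lambda>x. pf p x - f x))" by (intro mult_left_mono AT f) auto
      also have "\<dots> \<le> cmod c * (C * e)" using p C0 by (intro mult_left_mono) auto
      finally have 2: "N (\<lambda>x. T (smult c p) x - c * A f x) \<le> cmod c * (C * e)" .
      have "N (\<lambda>x. A (\<lambda>u. c * f u) x - c * A f x) \<le> N (\<lambda>x. A (\<lambda>u. c * f u) x - T (smult c p) x) + N (\<lambda>x. T (smult c p) x - c * A f x)"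
        by (intro tri A cf T L2_unit_scale f)
      then show "N (\<lambda>x. A (\<lambda>u. c * f u) x - c * A f x) \<le> 2 * cmod c * C * e"
        using 1 2 L2_norm_unit_minus_commute[of "A (\<lambda>u. c * f u)" "T (smult c p)"] by (simp add: N_def algebra_simps)
    qed
    have "L2_norm_unit (A f) \<le> C * L2_norm_unit f" if f: "f \<in> L2_unit" for f
    proof (rule field_le_epsilon)
      fix e :: real assume e: "e > 0"
      define d where "d = e / (2 * C + 1)"
      have d: "d > 0" "2 * C * d \<le> e" using e C0 by (auto simp: d_def field_simps)
      obtain p where p: "N (\<lambda>x. pf p x - f x) < d" using dens[OF f d(1)] by blast
      have "N (A f) \<le> N (\<lambda>x. A f x - T p x) + N (T p)"
        using L2_norm_unit_triangle[OF L2_unit_diff[OF A[OF f] T] T, of p p] by (simp add: N_def)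
      also have "N (\<lambda>x. A f x - T p x) \<le> C * d"
        using order_trans[OF AT[OF f, of p] mult_left_mono[OF less_imp_le[OF p] C0]]
          L2_norm_unit_minus_commute[of "A f" "T p"] by (simp add: N_def)
      also have "N (T p) \<le> C * N (pf p)" using C by (simp add: N_def pf_def)
      also have "N (pf p) \<le> N f + d"
        using L2_norm_unit_triangle[OF f L2_unit_diff[OF pfL f], of p] p by (simp add: N_def)
      finally have "N (A f) \<le> C * d + C * (N f + d)" using C0 by (simp add: mult_left_mono)
      then show "L2_norm_unit (A f) \<le> C * L2_norm_unit f + e" using d(2) by (simp add: N_def algebra_simps)
    qed
    then show "\<exists>C. \<forall>f\<in>L2_unit. L2_norm_unit (A f) \<le> C * L2_norm_unit f" by blast
  qed
  moreover have "AE x in unit_leb. A (poly_fun p) x = T p x" for p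
  proof -
    have "AE x in unit_leb. T p x = A (pf p) x"
      by (rule AE_eq[where B = 0]) (use AT[OF pfL, of p p] in \<open>auto simp: T A pfL N_def L2_norm_unit_def\<close>)
    then show ?thesis by eventually_elim (simp add: pf_def)
  qed
  ultimately show "extends_to_bounded_L2_operator T" unfolding extends_to_bounded_L2_operator_def by blast
qed

section \<open>Necessity of the boundedness conditions\<close>

text \<open>For $h = x^w$ the function $(1+s+\tau)H(s+\tau) = 1 - \frac{w}{w+s+\tau+1}$ is bounded, so $k$ exists; boundedness of $T$ on polynomials gives
  $\|k\| \le C\|h\|$ by duality.\<close>

lemma transpose_powr:
  assumes g: "g \<in> Hardy2_half_plane" and \<tau>: "Re \<tau> \<ge> 0" and w: "Re w > -1/2" and C: "C \<ge> 0"
    and bound: "\<And>p. L2_norm_unit (monomial_operator \<tau> g p) \<le> C * L2_norm_unit (poly_fun p)"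
  shows "\<exists>k\<in>L2_unit. (L2_norm_unit k)\<^sup>2 \<le> C\<^sup>2 / (2 * Re w + 1)
    \<and> (\<forall>s\<in>half_plane. mellin k s = (1 + s + \<tau>) / (1 + s) * g s * (1 / (w + (s + \<tau>) + 1)))
    \<and> (\<integral>\<^sup>+y. ennreal ((cmod ((1 + line y + \<tau>) / (1 + line y) * boundary_value g (line y) * (1 / (w + (line y + \<tau>) + 1))))\<^sup>2) \<partial>lborel)
       = ennreal (2 * pi * (L2_norm_unit k)\<^sup>2)"
proof -
  define h where "h = (\<lambda>x. complex_of_real x powr w)"
  define H where "H s = 1 / (w + s + 1)" for s
  have h: "h \<in> L2_unit" unfolding h_def by (rule powr_L2[OF w])
  have re: "Re (w + (s + \<tau>) + 1) \<ge> Re w + 1/2" if "Re s \<ge> -1/2" for s using that \<tau> by simp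
  have nz: "w + (s + \<tau>) + 1 \<noteq> 0" if "Re s \<ge> -1/2" for s using re[OF that] w by (auto simp: complex_eq_iff)
  have bnd: "cmod ((1 + s + \<tau>) * H (s + \<tau>)) \<le> 1 + cmod w / (Re w + 1/2)" if s: "s \<in> half_plane" for s
  proof -
    define v where "v = w + (s + \<tau>) + 1"
    have s': "Re s \<ge> -1/2" using s by (simp add: half_plane_def)
    have v: "cmod v \<ge> Re w + 1/2" using re[OF s'] complex_Re_le_cmod[of v] by (simp add: v_def)
    have v0: "cmod v > 0" using v w by linarith
    have "(1 + s + \<tau>) * H (s + \<tau>) = 1 - w / v"
      using nz[OF s'] unfolding H_def v_def[symmetric] by (simp add: field_simps) (simp add: v_def)
    then have "cmod ((1 + s + \<tau>) * H (s + \<tau>)) \<le> 1 + cmod w / cmod v"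
      using norm_triangle_ineq4[of 1 "w / v"] by (simp add: norm_divide)
    also have "cmod w / cmod v \<le> cmod w / (Re w + 1/2)" using v w by (intro divide_left_mono mult_pos_pos v0) auto
    finally show ?thesis by simp
  qed
  have hol: "(\<lambda>s. (1 + s + \<tau>) * H (s + \<tau>)) holomorphic_on half_plane"
      unfolding H_def using nz by (intro holomorphic_intros) (auto simp: half_plane_def)
  have lim: "((\<lambda>\<sigma>. H (line y + of_real \<sigma> + \<tau>)) \<longlongrightarrow> H (line y + \<tau>)) (at_right 0)" for y
    proof -
      have "((\<lambda>\<sigma>. H (line y + of_real \<sigma> + \<tau>)) \<longlongrightarrow> H (line y + of_real 0 + \<tau>)) (at_right 0)"
        unfolding H_def using nz[of "line y"] by (intro tendsto_intros) auto
      then show ?thesis by simp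
    qed
  obtain k where k: "k \<in> L2_unit" and K: "\<And>s. s \<in> half_plane \<Longrightarrow> mellin k s = (1 + s + \<tau>) / (1 + s) * g s * H (s + \<tau>)"
    and I: "(\<integral>\<^sup>+y. ennreal ((cmod ((1 + line y + \<tau>) / (1 + line y) * boundary_value g (line y) * H (line y + \<tau>)))\<^sup>2) \<partial>lborel)
       = ennreal (2 * pi * (L2_norm_unit k)\<^sup>2)"
    using transpose_exists[OF g \<tau> hol bnd lim] by blast
  have mh: "mellin h (s + \<tau>) = H (s + \<tau>)" if "s \<in> half_plane" for s
    unfolding h_def H_def by (rule mellin_powr) (use that \<tau> w in \<open>simp add: half_plane_def\<close>)
  have "L2_norm_unit k \<le> C * L2_norm_unit h"
  proof (rule L2_norm_le_by_polynomials[OF k])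
    fix p
    have "(\<integral>x. poly p (complex_of_real x) * k x \<partial>unit_leb) = (\<integral>x. monomial_operator \<tau> g p x * h x \<partial>unit_leb)"
      by (rule transpose_pairing[OF \<tau> h k, symmetric]) (simp add: K mh)
    also have "cmod \<dots> \<le> L2_norm_unit (monomial_operator \<tau> g p) * L2_norm_unit h"
      by (rule L2_unit_Cauchy_Schwarz[OF monomial_operator_L2[OF \<tau>] h])
    also have "\<dots> \<le> C * L2_norm_unit (poly_fun p) * L2_norm_unit h"
      by (rule mult_right_mono[OF bound]) simp
    finally show "cmod (\<integral>x. poly p (complex_of_real x) * k x \<partial>unit_leb) \<le> C * L2_norm_unit h * L2_norm_unit (poly_fun p)"
      by (simp add: mult_ac)
  qed (use C in simp)
  then have "(L2_norm_unit k)\<^sup>2 \<le> (C * L2_norm_unit h)\<^sup>2" by (intro power_mono) auto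
  also have "\<dots> = C\<^sup>2 / (2 * Re w + 1)"
    unfolding power_mult_distrib h_def powr_L2_norm[OF w] by simp
  finally show ?thesis
    using k K I unfolding H_def by (intro bexI[of _ k] conjI ballI)
qed

text \<open>Test with $x^w$ for $w = \overline{s+\tau}$: then $w+s+\tau+1 = 2\,\mathrm{Re}\,s+1$ is the reciprocal of $\|x^w\|\,\|x^s\|$, and these
  norms cancel from $|K(s)| \le \|k\|\,\|x^s\| \le C\,\|x^w\|\,\|x^s\|$.\<close>

lemma bounded_if_extends:
  assumes g: "g \<in> Hardy2_half_plane" and \<tau>: "Re \<tau> = 0" and C: "C \<ge> 0"
    and bound: "\<And>p. L2_norm_unit (monomial_operator \<tau> g p) \<le> C * L2_norm_unit (poly_fun p)"
  shows "bounded (g ` half_plane)"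
proof -
  have "cmod (g s) \<le> (1 + 2 * cmod \<tau>) * C" if s: "s \<in> half_plane" for s
  proof -
    define a where "a = 2 * Re s + 1"
    have a: "a > 0" using s by (simp add: a_def half_plane_def)
    define w where "w = cnj (s + \<tau>)"
    have w: "Re w > -1/2" "2 * Re w + 1 = a" using s \<tau> by (auto simp: w_def half_plane_def a_def)
    obtain k where k: "k \<in> L2_unit" "(L2_norm_unit k)\<^sup>2 \<le> C\<^sup>2 / (2 * Re w + 1)"
      and K: "mellin k s = (1 + s + \<tau>) / (1 + s) * g s * (1 / (w + (s + \<tau>) + 1))"
      using transpose_powr[OF g eq_refl[OF \<tau>[symmetric]] w(1) C bound] s by blast
    have "w + (s + \<tau>) + 1 = of_real a" using \<tau> by (simp add: w_def a_def complex_eq_iff)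
    then have K': "mellin k s = (1 + s + \<tau>) / (1 + s) * g s / of_real a" by (simp add: K)
    have s': "Re s > -1/2" using s by (simp add: half_plane_def)
    have "(cmod (mellin k s))\<^sup>2 \<le> (L2_norm_unit k * L2_norm_unit (\<lambda>x. complex_of_real x powr s))\<^sup>2"
      using norm_mellin_le[OF k(1) s'] by (intro power_mono) auto
    also have "\<dots> = (L2_norm_unit k)\<^sup>2 * (1 / a)" by (simp add: power_mult_distrib powr_L2_norm[OF s'] a_def)
    also have "\<dots> \<le> C\<^sup>2 / a * (1 / a)" using k(2) a unfolding w(2) by (intro mult_right_mono) auto
    also have "\<dots> = (C / a)\<^sup>2" by (simp add: power_divide power2_eq_square)
    finally have "cmod (mellin k s) \<le> C / a" by (rule power2_le_imp_le) (use C a in simp)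
    moreover have "cmod (x / of_real a) \<le> C / a \<Longrightarrow> cmod x \<le> C" for x
      using a by (simp add: norm_divide divide_le_cancel)
    ultimately have le: "cmod ((1 + s + \<tau>) / (1 + s) * g s) \<le> C" unfolding K' by blast
    have sb: "Re \<tau> \<ge> 0" "Re s \<ge> -1/2" using \<tau> s' by auto
    have "g s = (1 + s) / (1 + s + \<tau>) * ((1 + s + \<tau>) / (1 + s) * g s)"
      using shift_factor_bounds(3,4)[OF sb] by simp
    then have "cmod (g s) = cmod ((1 + s) / (1 + s + \<tau>)) * cmod ((1 + s + \<tau>) / (1 + s) * g s)"
      by (metis norm_mult)
    also have "\<dots> \<le> (1 + 2 * cmod \<tau>) * C"
      by (intro mult_mono shift_factor_bounds(2)[OF sb] le) auto
    finally show ?thesis .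
  qed
  then show ?thesis unfolding bounded_iff by blast
qed

text \<open>The test functions $x^w$ with $\mathrm{Re}\,w = -\frac12 + \sigma$ turn the boundary integral into a Poisson
  integral at height $\sigma + \mathrm{Re}\,\tau$, and comparing the two kernels brings it down to height $\sigma$.\<close>

lemma poisson_bounded_if_extends:
  assumes g: "g \<in> Hardy2_half_plane" and \<tau>: "Re \<tau> \<ge> 0" and C: "C \<ge> 0"
    and bound: "\<And>p. L2_norm_unit (monomial_operator \<tau> g p) \<le> C * L2_norm_unit (poly_fun p)"
    and \<rho>: "\<rho> > -1/2"
  shows "bounded (poisson_integral (\<lambda>z. (cmod (boundary_value g z))\<^sup>2) ` {s. Re s > \<rho>})"
proof -
  define L where "L = 1 + 2 * cmod \<tau>"
  define a where "a = Re \<tau>"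
  define B where "B = 1 / pi * (L\<^sup>2 * (pi * C\<^sup>2) * (1 + a / (\<rho> + 1/2))\<^sup>2)"
  have L1: "L \<ge> 1" by (simp add: L_def)
  define G where "G y = boundary_value g (line y)" for y
  have Gm[measurable]: "G \<in> borel_measurable borel"
    unfolding G_def[abs_def] by (intro boundary_value_borel_measurable Hardy2_half_plane_continuous_on g)
  have "\<bar>poisson_integral (\<lambda>z. (cmod (boundary_value g z))\<^sup>2) s\<bar> \<le> B" if s: "Re s > \<rho>" for s
  proof -
    define \<sigma> where "\<sigma> = Re s + 1/2"
    define t where "t = Im s"
    have \<sigma>: "\<sigma> > 0" "\<rho> + 1/2 \<le> \<sigma>" "\<rho> + 1/2 > 0" using s \<rho> by (auto simp: \<sigma>_def)
    define A where "A = a + \<sigma>"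
    have A: "A \<ge> \<sigma>" "a \<ge> 0" using \<tau> by (auto simp: A_def a_def)
    \<comment> \<open>Chosen so that \<open>w + (z + \<tau>) + 1 = A + i(y - t)\<close> on the boundary line.\<close>
    define w where "w = Complex (-1/2 + \<sigma>) (- Im \<tau> - t)"
    have w: "Re w > -1/2" "2 * Re w + 1 = 2 * \<sigma>" using \<sigma> by (auto simp: w_def)
    define R where "R y = (1 + line y + \<tau>) / (1 + line y)" for y
    obtain k where kC: "(L2_norm_unit k)\<^sup>2 \<le> C\<^sup>2 / (2 * Re w + 1)"
      and I: "(\<integral>\<^sup>+y. ennreal ((cmod (R y * G y * (1 / (w + (line y + \<tau>) + 1))))\<^sup>2) \<partial>lborel) = ennreal (2 * pi * (L2_norm_unit k)\<^sup>2)"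
      unfolding R_def G_def using transpose_powr[OF g \<tau> w(1) C bound] by blast
    have [measurable]: "R \<in> borel_measurable borel"
      unfolding R_def[abs_def] Complex_eq by measurable
    have pt: "\<sigma> / (\<sigma>\<^sup>2 + (y - t)\<^sup>2) * (cmod (G y))\<^sup>2 \<le> (\<sigma> * (A / \<sigma>)\<^sup>2 * L\<^sup>2) * (cmod (R y * G y * (1 / (w + (line y + \<tau>) + 1))))\<^sup>2" for y
    proof -
      have sb: "Re (line y) \<ge> -1/2" by simp
      have RL: "1 \<le> L\<^sup>2 * (cmod (R y))\<^sup>2"
      proof -
        have "1 = cmod ((1 + line y) / (1 + line y + \<tau>)) * cmod (R y)"
          unfolding R_def using shift_factor_bounds(3,4)[OF \<tau> sb] by (simp flip: norm_mult)
        also have "\<dots> \<le> L * cmod (R y)" unfolding L_def by (intro mult_right_mono shift_factor_bounds(2)[OF \<tau> sb]) simp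
        finally have "1\<^sup>2 \<le> (L * cmod (R y))\<^sup>2" by (intro power_mono) auto
        then show ?thesis by (simp add: power_mult_distrib)
      qed
      have wd: "w + (line y + \<tau>) + 1 = Complex A (y - t)"
        by (simp add: w_def complex_eq_iff A_def a_def)
      have den: "(cmod (1 / (w + (line y + \<tau>) + 1)))\<^sup>2 = 1 / (A\<^sup>2 + (y - t)\<^sup>2)"
        unfolding wd norm_divide power_divide cmod_power2 by simp
      have A0: "A > 0" using A \<sigma> by simp
      have p1: "\<sigma>\<^sup>2 + (y - t)\<^sup>2 > 0" "A\<^sup>2 + (y - t)\<^sup>2 > 0" using \<sigma> A0 by (auto simp: add_pos_nonneg)
      have "\<sigma>\<^sup>2 * (A\<^sup>2 + (y - t)\<^sup>2) \<le> A\<^sup>2 * (\<sigma>\<^sup>2 + (y - t)\<^sup>2)"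
        using mult_right_mono[OF power_mono[OF A(1), of 2], of "(y - t)\<^sup>2"] \<sigma> by (simp add: algebra_simps)
      then have "1 / (\<sigma>\<^sup>2 + (y - t)\<^sup>2) \<le> (A / \<sigma>)\<^sup>2 * (1 / (A\<^sup>2 + (y - t)\<^sup>2))"
        using p1 \<sigma> by (simp add: power_divide divide_simps)
      then have "\<sigma> * (1 / (\<sigma>\<^sup>2 + (y - t)\<^sup>2)) * (cmod (G y))\<^sup>2 * 1 \<le> \<sigma> * ((A / \<sigma>)\<^sup>2 * (1 / (A\<^sup>2 + (y - t)\<^sup>2))) * (cmod (G y))\<^sup>2 * (L\<^sup>2 * (cmod (R y))\<^sup>2)"
        using \<sigma> RL p1 by (intro mult_mono mult_nonneg_nonneg) auto
      then show ?thesis unfolding norm_mult power_mult_distrib den by (simp add: mult_ac)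
    qed
    have c0: "\<sigma> * (A / \<sigma>)\<^sup>2 * L\<^sup>2 \<ge> 0" using \<sigma> by simp
    have "(\<integral>\<^sup>+y. ennreal (\<sigma> / (\<sigma>\<^sup>2 + (y - t)\<^sup>2) * (cmod (G y))\<^sup>2) \<partial>lborel)
        \<le> (\<integral>\<^sup>+y. ennreal (\<sigma> * (A / \<sigma>)\<^sup>2 * L\<^sup>2) * ennreal ((cmod (R y * G y * (1 / (w + (line y + \<tau>) + 1))))\<^sup>2) \<partial>lborel)"
      using pt c0 by (intro nn_integral_mono) (simp only: ennreal_mult'[symmetric] ennreal_leI)
    also have "\<dots> = ennreal (\<sigma> * (A / \<sigma>)\<^sup>2 * L\<^sup>2) * ennreal (2 * pi * (L2_norm_unit k)\<^sup>2)"
      unfolding I[symmetric] by (rule nn_integral_cmult) (unfold Complex_eq, measurable)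
    also have "\<dots> = ennreal ((\<sigma> * (A / \<sigma>)\<^sup>2 * L\<^sup>2) * (2 * pi * (L2_norm_unit k)\<^sup>2))"
      using c0 by (intro ennreal_mult[symmetric]) auto
    also have "\<dots> \<le> ennreal (L\<^sup>2 * (pi * C\<^sup>2) * (1 + a / (\<rho> + 1/2))\<^sup>2)"
    proof (rule ennreal_leI)
      have "(\<sigma> * (A / \<sigma>)\<^sup>2 * L\<^sup>2) * (2 * pi * (L2_norm_unit k)\<^sup>2) \<le> (\<sigma> * (A / \<sigma>)\<^sup>2 * L\<^sup>2) * (2 * pi * (C\<^sup>2 / (2 * \<sigma>)))"
        using kC unfolding w(2) by (intro mult_left_mono c0) auto
      also have "\<dots> = L\<^sup>2 * (pi * C\<^sup>2) * (A / \<sigma>)\<^sup>2" using \<sigma> by (simp add: field_simps)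
      also have "\<dots> \<le> L\<^sup>2 * (pi * C\<^sup>2) * (1 + a / (\<rho> + 1/2))\<^sup>2"
      proof (intro mult_left_mono power_mono)
        have "A / \<sigma> = 1 + a / \<sigma>" using \<sigma> by (simp add: A_def field_simps)
        also have "a / \<sigma> \<le> a / (\<rho> + 1/2)" using \<sigma> A by (intro divide_left_mono) auto
        finally show "A / \<sigma> \<le> 1 + a / (\<rho> + 1/2)" by simp
      qed (use \<sigma> A in auto)
      finally show "(\<sigma> * (A / \<sigma>)\<^sup>2 * L\<^sup>2) * (2 * pi * (L2_norm_unit k)\<^sup>2) \<le> L\<^sup>2 * (pi * C\<^sup>2) * (1 + a / (\<rho> + 1/2))\<^sup>2" .
    qed
    finally have ub: "(\<integral>y. \<sigma> / (\<sigma>\<^sup>2 + (y - t)\<^sup>2) * (cmod (G y))\<^sup>2 \<partial>lborel) \<le> L\<^sup>2 * (pi * C\<^sup>2) * (1 + a / (\<rho> + 1/2))\<^sup>2"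
      by (intro integral_real_bounded) auto
    have "1 / pi * (\<integral>y. \<sigma> / (\<sigma>\<^sup>2 + (y - t)\<^sup>2) * (cmod (G y))\<^sup>2 \<partial>lborel) \<ge> 0"
      using \<sigma> by (intro mult_nonneg_nonneg Bochner_Integration.integral_nonneg) auto
    moreover have "1 / pi * (\<integral>y. \<sigma> / (\<sigma>\<^sup>2 + (y - t)\<^sup>2) * (cmod (G y))\<^sup>2 \<partial>lborel) \<le> B"
      unfolding B_def by (rule mult_left_mono[OF ub]) simp
    moreover have "poisson_integral (\<lambda>z. (cmod (boundary_value g z))\<^sup>2) s = 1 / pi * (\<integral>y. \<sigma> / (\<sigma>\<^sup>2 + (y - t)\<^sup>2) * (cmod (G y))\<^sup>2 \<partial>lborel)"
      by (simp add: poisson_integral_def \<sigma>_def t_def G_def)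
    ultimately show ?thesis by (simp only: abs_of_nonneg)
  qed
  then show ?thesis unfolding bounded_iff by auto
qed

section \<open>Sufficiency of the boundedness conditions\<close>

text \<open>By duality $\|Tp\|$ is the supremum of $|\int p\,k|$ over the $k$ that belong to polynomials $q$ of norm $1$, and the boundary estimate
  bounds $\|k\|$ through Plancherel's formula.\<close>

lemma bounded_on_polynomials_if_boundary_estimate:
  assumes g: "g \<in> Hardy2_half_plane" and \<tau>: "Re \<tau> \<ge> 0" and D: "D \<ge> 0"
    and est: "\<And>q. (\<integral>\<^sup>+y. ennreal ((cmod (boundary_value g (line y)))\<^sup>2) * ennreal ((cmod (poly_mellin q (line y + \<tau>)))\<^sup>2) \<partial>lborel)
       \<le> ennreal (D * (2 * pi * (L2_norm_unit (poly_fun q))\<^sup>2))"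
  shows "\<exists>C\<ge>0. \<forall>p. L2_norm_unit (monomial_operator \<tau> g p) \<le> C * L2_norm_unit (poly_fun p)"
proof -
  define L where "L = 1 + 2 * cmod \<tau>"
  have L0: "L \<ge> 0" by (simp add: L_def)
  define pf where "pf p = (poly_fun p)" for p
  have pfL: "pf p \<in> L2_unit" for p unfolding pf_def by (rule L2_unit_poly)
  define G where "G y = boundary_value g (line y)" for y
  have Gm[measurable]: "G \<in> borel_measurable borel"
    unfolding G_def[abs_def] by (intro boundary_value_borel_measurable Hardy2_half_plane_continuous_on g)
  have nz: "of_nat m + 1 + (s + \<tau>) \<noteq> 0" if "Re s \<ge> -1/2" for s and m :: nat
    using that \<tau> by (auto simp: complex_eq_iff)
  have main: "cmod (\<integral>x. pf q x * monomial_operator \<tau> g p x \<partial>unit_leb) \<le> (L * sqrt D * L2_norm_unit (pf p)) * L2_norm_unit (pf q)" for p q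
  proof -
    define M where "M = (\<Sum>m\<le>degree q. cmod (coeff q m))"
    have bnd: "cmod ((1 + s + \<tau>) * poly_mellin q (s + \<tau>)) \<le> M" if s: "s \<in> half_plane" for s
    proof -
      define v where "v = 1 + s + \<tau>"
      have v: "Re v > 0" using s \<tau> by (simp add: v_def half_plane_def)
      have "(1 + s + \<tau>) * poly_mellin q (s + \<tau>) = (\<Sum>m\<le>degree q. coeff q m * (v / (of_nat m + v)))"
        unfolding poly_mellin_def sum_distrib_left by (intro sum.cong refl) (simp add: v_def add_ac)
      also have "cmod \<dots> \<le> (\<Sum>m\<le>degree q. cmod (coeff q m) * 1)"
      proof (intro order_trans[OF norm_sum] sum_mono)
        fix m
        have "(cmod v)\<^sup>2 \<le> (cmod (of_nat m + v))\<^sup>2"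
          unfolding cmod_power2 using v by (simp add: power_mono)
        then have "cmod v \<le> cmod (of_nat m + v)" by (rule power2_le_imp_le) simp
        moreover have "cmod (of_nat m + v) > 0" using v by (auto simp: complex_eq_iff)
        ultimately have "cmod (v / (of_nat m + v)) \<le> 1" by (simp add: norm_divide)
        then show "cmod (coeff q m * (v / (of_nat m + v))) \<le> cmod (coeff q m) * 1"
          unfolding norm_mult by (intro mult_left_mono) auto
      qed
      finally show ?thesis by (simp add: M_def)
    qed
    have hol: "(\<lambda>s. (1 + s + \<tau>) * poly_mellin q (s + \<tau>)) holomorphic_on half_plane"
        unfolding poly_mellin_def using nz by (intro holomorphic_intros) (auto simp: half_plane_def)
    have lim: "((\<lambda>\<sigma>. poly_mellin q (line y + of_real \<sigma> + \<tau>)) \<longlongrightarrow> poly_mellin q (line y + \<tau>)) (at_right 0)" for y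
      proof -
        have "((\<lambda>\<sigma>. poly_mellin q (line y + of_real \<sigma> + \<tau>)) \<longlongrightarrow> poly_mellin q (line y + of_real 0 + \<tau>)) (at_right 0)"
          unfolding poly_mellin_def using nz[of "line y"] by (intro tendsto_intros) auto
        then show ?thesis by simp
      qed
    obtain k where k: "k \<in> L2_unit" and K: "\<And>s. s \<in> half_plane \<Longrightarrow> mellin k s = (1 + s + \<tau>) / (1 + s) * g s * poly_mellin q (s + \<tau>)"
      and I: "(\<integral>\<^sup>+y. ennreal ((cmod ((1 + line y + \<tau>) / (1 + line y) * boundary_value g (line y) * poly_mellin q (line y + \<tau>)))\<^sup>2) \<partial>lborel)
         = ennreal (2 * pi * (L2_norm_unit k)\<^sup>2)"
      using transpose_exists[OF g \<tau> hol bnd lim] by blast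
    have "ennreal (2 * pi * (L2_norm_unit k)\<^sup>2) \<le> (\<integral>\<^sup>+y. ennreal (L\<^sup>2) * (ennreal ((cmod (G y))\<^sup>2) * ennreal ((cmod (poly_mellin q (line y + \<tau>)))\<^sup>2)) \<partial>lborel)"
      unfolding I[symmetric]
    proof (intro nn_integral_mono)
      fix y
      have "(cmod ((1 + line y + \<tau>) / (1 + line y)))\<^sup>2 \<le> L\<^sup>2"
        unfolding L_def by (intro power_mono shift_factor_bounds(1)[OF \<tau>]) auto
      then have "(cmod ((1 + line y + \<tau>) / (1 + line y) * G y * poly_mellin q (line y + \<tau>)))\<^sup>2
          \<le> L\<^sup>2 * ((cmod (G y))\<^sup>2 * (cmod (poly_mellin q (line y + \<tau>)))\<^sup>2)"
        unfolding norm_mult power_mult_distrib mult.assoc by (intro mult_right_mono) auto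
      then show "ennreal ((cmod ((1 + line y + \<tau>) / (1 + line y) * boundary_value g (line y) * poly_mellin q (line y + \<tau>)))\<^sup>2)
         \<le> ennreal (L\<^sup>2) * (ennreal ((cmod (G y))\<^sup>2) * ennreal ((cmod (poly_mellin q (line y + \<tau>)))\<^sup>2))"
        unfolding G_def by (simp only: ennreal_mult[symmetric] zero_le_power2 mult_nonneg_nonneg ennreal_leI)
    qed
    also have "\<dots> = ennreal (L\<^sup>2) * (\<integral>\<^sup>+y. ennreal ((cmod (G y))\<^sup>2) * ennreal ((cmod (poly_mellin q (line y + \<tau>)))\<^sup>2) \<partial>lborel)"
      by (rule nn_integral_cmult) (unfold poly_mellin_def Complex_eq, measurable)
    also have "\<dots> \<le> ennreal (L\<^sup>2) * ennreal (D * (2 * pi * (L2_norm_unit (pf q))\<^sup>2))"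
      unfolding G_def pf_def by (intro mult_left_mono est) simp
    also have "\<dots> = ennreal (L\<^sup>2 * (D * (2 * pi * (L2_norm_unit (pf q))\<^sup>2)))"
      using D by (intro ennreal_mult[symmetric]) auto
    finally have "2 * pi * (L2_norm_unit k)\<^sup>2 \<le> L\<^sup>2 * (D * (2 * pi * (L2_norm_unit (pf q))\<^sup>2))"
      using D by (subst (asm) ennreal_le_iff) auto
    then have "2 * pi * (L2_norm_unit k)\<^sup>2 \<le> 2 * pi * (L * sqrt D * L2_norm_unit (pf q))\<^sup>2"
      using D by (simp add: power_mult_distrib mult_ac)
    then have "(L2_norm_unit k)\<^sup>2 \<le> (L * sqrt D * L2_norm_unit (pf q))\<^sup>2" by simp
    then have kq: "L2_norm_unit k \<le> L * sqrt D * L2_norm_unit (pf q)"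
      by (rule power2_le_imp_le) (use L0 D in auto)
    have "(\<integral>x. monomial_operator \<tau> g p x * pf q x \<partial>unit_leb) = (\<integral>x. poly p (complex_of_real x) * k x \<partial>unit_leb)"
    proof (rule transpose_pairing[OF \<tau> pfL k])
      fix s assume s: "s \<in> half_plane"
      have "mellin (pf q) (s + \<tau>) = poly_mellin q (s + \<tau>)"
        unfolding pf_def by (rule mellin_poly) (use s \<tau> in \<open>simp add: half_plane_def\<close>)
      then show "mellin k s = (1 + s + \<tau>) / (1 + s) * g s * mellin (pf q) (s + \<tau>)" by (simp add: K[OF s])
    qed
    then have "cmod (\<integral>x. pf q x * monomial_operator \<tau> g p x \<partial>unit_leb) = cmod (\<integral>x. pf p x * k x \<partial>unit_leb)"
      by (simp add: pf_def mult.commute)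
    also have "\<dots> \<le> L2_norm_unit (pf p) * L2_norm_unit k" by (rule L2_unit_Cauchy_Schwarz[OF pfL k])
    also have "\<dots> \<le> L2_norm_unit (pf p) * (L * sqrt D * L2_norm_unit (pf q))" by (intro mult_left_mono kq) simp
    finally show ?thesis by (simp add: mult_ac)
  qed
  have "L2_norm_unit (monomial_operator \<tau> g p) \<le> L * sqrt D * L2_norm_unit (pf p)" for p
    by (rule L2_norm_le_by_polynomials[OF monomial_operator_L2[OF \<tau>]]) (use main L0 D in \<open>auto simp: pf_def\<close>)
  then show ?thesis using L0 D unfolding pf_def by (intro exI[of _ "L * sqrt D"]) auto
qed

text \<open>Adding $\tau$ merely translates the line along itself, and Plancherel's formula is invariant under that.\<close>

lemma boundary_estimate_bounded:
  assumes g: "g \<in> Hardy2_half_plane" and \<tau>: "Re \<tau> = 0" and M: "\<And>s. s \<in> half_plane \<Longrightarrow> cmod (g s) \<le> M"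
  shows "(\<integral>\<^sup>+y. ennreal ((cmod (boundary_value g (line y)))\<^sup>2) * ennreal ((cmod (poly_mellin q (line y + \<tau>)))\<^sup>2) \<partial>lborel)
       \<le> ennreal (M\<^sup>2 * (2 * pi * (L2_norm_unit (poly_fun q))\<^sup>2))"
proof -
  have [measurable]: "(\<lambda>y. poly_mellin q (line y)) \<in> borel_measurable borel"
    unfolding poly_mellin_def Complex_eq by measurable
  have "AE y in lborel. ennreal ((cmod (boundary_value g (line y)))\<^sup>2) * ennreal ((cmod (poly_mellin q (line y + \<tau>)))\<^sup>2)
      \<le> ennreal (M\<^sup>2) * ennreal ((cmod (poly_mellin q (line (Im \<tau> + 1 * y))))\<^sup>2)"
    using Hardy2_half_plane_boundary(1)[OF g]
  proof eventually_elim
    case (elim y)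
    have "cmod (boundary_value g (line y)) \<le> M"
    proof (rule tendsto_upperbound[OF tendsto_norm[OF elim]])
      show "\<forall>\<^sub>F \<sigma> in at_right 0. cmod (g (line y + of_real \<sigma>)) \<le> M"
        using eventually_at_right_less[of "0::real"] by eventually_elim (auto intro!: M simp: half_plane_def)
    qed simp
    then have "(cmod (boundary_value g (line y)))\<^sup>2 \<le> M\<^sup>2" by (intro power_mono) auto
    moreover have "line y + \<tau> = line (Im \<tau> + 1 * y)" using \<tau> by (simp add: complex_eq_iff)
    ultimately show ?case by (auto intro!: mult_right_mono ennreal_leI)
  qed
  then have "(\<integral>\<^sup>+y. ennreal ((cmod (boundary_value g (line y)))\<^sup>2) * ennreal ((cmod (poly_mellin q (line y + \<tau>)))\<^sup>2) \<partial>lborel)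
      \<le> (\<integral>\<^sup>+y. ennreal (M\<^sup>2) * ennreal ((cmod (poly_mellin q (line (Im \<tau> + 1 * y))))\<^sup>2) \<partial>lborel)"
    by (rule nn_integral_mono_AE)
  also have "\<dots> = ennreal (M\<^sup>2) * (\<integral>\<^sup>+y. ennreal ((cmod (poly_mellin q (line (Im \<tau> + 1 * y))))\<^sup>2) \<partial>lborel)"
    by (rule nn_integral_cmult) measurable
  also have "(\<integral>\<^sup>+y. ennreal ((cmod (poly_mellin q (line (Im \<tau> + 1 * y))))\<^sup>2) \<partial>lborel) = (\<integral>\<^sup>+y. ennreal ((cmod (poly_mellin q (line y)))\<^sup>2) \<partial>lborel)"
  proof -
    have "(\<lambda>y. ennreal ((cmod (poly_mellin q (line y)))\<^sup>2)) \<in> borel_measurable borel" by measurable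
    from nn_integral_real_affine[OF this, of 1 "Im \<tau>"] show ?thesis by simp
  qed
  also have "\<dots> = ennreal (2 * pi * (L2_norm_unit (poly_fun q))\<^sup>2)"
    unfolding poly_mellin_Plancherel(2)[symmetric]
    by (rule nn_integral_eq_integral[OF poly_mellin_Plancherel(1)]) simp
  finally show ?thesis by (simp add: ennreal_mult)
qed

text \<open>A Bochner integral of a function that is not integrable is $0$. The boundary values of $g$ satisfy
  $\int |g|^2/(\frac14+y^2)\,dy < \infty$, which dominates every Poisson kernel and so makes the Poisson integral a genuine one.\<close>

lemma poisson_integral_eq_nn_integral:
  assumes g: "g \<in> Hardy2_half_plane" and \<sigma>: "\<sigma> > 0"
  shows "(\<integral>\<^sup>+y. ennreal (poisson_kernel \<sigma> (y - t)) * ennreal ((cmod (boundary_value g (line y)))\<^sup>2) \<partial>lborel)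
    = ennreal (poisson_integral (\<lambda>z. (cmod (boundary_value g z))\<^sup>2) (Complex (-1/2 + \<sigma>) t))"
proof -
  define G where "G y = boundary_value g (line y)" for y
  have Gm[measurable]: "G \<in> borel_measurable borel"
    unfolding G_def[abs_def] by (intro boundary_value_borel_measurable Hardy2_half_plane_continuous_on g)
  have i0: "integrable lborel (\<lambda>y. (cmod (G y))\<^sup>2 / (1/4 + y\<^sup>2))"
    using Hardy2_half_plane_boundary(2)[OF g] unfolding G_def[symmetric]
    by (intro integrableI_bounded) (auto simp: norm_divide add_nonneg_nonneg)
  define c where "c = (2 + (1/4 + 2 * t\<^sup>2) / \<sigma>\<^sup>2) * (\<sigma> / pi)"
  have pk: "poisson_kernel \<sigma> (y - t) \<le> c * (1 / (1/4 + y\<^sup>2))" for y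
  proof -
    have p: "\<sigma>\<^sup>2 + (y - t)\<^sup>2 > 0" "1/4 + y\<^sup>2 > 0" using \<sigma> by (auto simp: add_pos_nonneg)
    have "0 \<le> (y - 2 * t)\<^sup>2" by simp
    then have y2: "y\<^sup>2 \<le> 2 * (y - t)\<^sup>2 + 2 * t\<^sup>2" by (simp add: power2_eq_square algebra_simps)
    define X where "X = (1/4 + 2 * t\<^sup>2) * ((\<sigma>\<^sup>2 + (y - t)\<^sup>2) / \<sigma>\<^sup>2)"
    have "(1/4 + 2 * t\<^sup>2) * 1 \<le> X"
      unfolding X_def using \<sigma> by (intro mult_left_mono) (auto simp: field_simps)
    then have X: "1/4 + 2 * t\<^sup>2 \<le> X" unfolding mult_1_right .
    have "1/4 + y\<^sup>2 \<le> 1/4 + (2 * (y - t)\<^sup>2 + 2 * t\<^sup>2)" using y2 by (rule add_left_mono)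
    also have "\<dots> = 2 * (y - t)\<^sup>2 + (1/4 + 2 * t\<^sup>2)" by (simp only: add_ac)
    also have "\<dots> \<le> 2 * (\<sigma>\<^sup>2 + (y - t)\<^sup>2) + X" using X by (intro add_mono) auto
    finally have "1/4 + y\<^sup>2 \<le> 2 * (\<sigma>\<^sup>2 + (y - t)\<^sup>2) + X" .
    also have "2 * (\<sigma>\<^sup>2 + (y - t)\<^sup>2) + X = (2 + (1/4 + 2 * t\<^sup>2) / \<sigma>\<^sup>2) * (\<sigma>\<^sup>2 + (y - t)\<^sup>2)"
      unfolding X_def distrib_right[of 2] by simp
    finally have "1/4 + y\<^sup>2 \<le> (2 + (1/4 + 2 * t\<^sup>2) / \<sigma>\<^sup>2) * (\<sigma>\<^sup>2 + (y - t)\<^sup>2)" .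
    then have "1 / (\<sigma>\<^sup>2 + (y - t)\<^sup>2) \<le> (2 + (1/4 + 2 * t\<^sup>2) / \<sigma>\<^sup>2) * (1 / (1/4 + y\<^sup>2))"
      using p by (simp add: divide_le_eq pos_le_divide_eq mult.commute)
    then have "(\<sigma> / pi) * (1 / (\<sigma>\<^sup>2 + (y - t)\<^sup>2)) \<le> (\<sigma> / pi) * ((2 + (1/4 + 2 * t\<^sup>2) / \<sigma>\<^sup>2) * (1 / (1/4 + y\<^sup>2)))"
      using \<sigma> by (intro mult_left_mono) auto
    then show ?thesis by (simp add: poisson_kernel_def c_def mult_ac)
  qed
  have k0: "poisson_kernel \<sigma> v \<ge> 0" for v by (rule poisson_kernel_nonneg[OF \<sigma>])
  have i: "integrable lborel (\<lambda>y. poisson_kernel \<sigma> (y - t) * (cmod (G y))\<^sup>2)"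
  proof (rule Bochner_Integration.integrable_bound)
    show "integrable lborel (\<lambda>y. c * ((cmod (G y))\<^sup>2 / (1/4 + y\<^sup>2)))" by (rule integrable_mult_right[OF i0])
    show "AE y in lborel. norm (poisson_kernel \<sigma> (y - t) * (cmod (G y))\<^sup>2) \<le> norm (c * ((cmod (G y))\<^sup>2 / (1/4 + y\<^sup>2)))"
    proof (rule AE_I2)
      fix y
      have "poisson_kernel \<sigma> (y - t) * (cmod (G y))\<^sup>2 \<le> c * (1 / (1/4 + y\<^sup>2)) * (cmod (G y))\<^sup>2"
        by (rule mult_right_mono[OF pk]) simp
      also have "\<dots> = c * ((cmod (G y))\<^sup>2 / (1/4 + y\<^sup>2))" by simp
      also have "\<dots> \<le> norm (c * ((cmod (G y))\<^sup>2 / (1/4 + y\<^sup>2)))" unfolding real_norm_def by (rule abs_ge_self)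
      finally show "norm (poisson_kernel \<sigma> (y - t) * (cmod (G y))\<^sup>2) \<le> norm (c * ((cmod (G y))\<^sup>2 / (1/4 + y\<^sup>2)))"
        using k0[of "y - t"] by (simp only: real_norm_def abs_of_nonneg mult_nonneg_nonneg zero_le_power2)
    qed
  qed measurable
  have "(\<integral>\<^sup>+y. ennreal (poisson_kernel \<sigma> (y - t)) * ennreal ((cmod (G y))\<^sup>2) \<partial>lborel)
      = (\<integral>\<^sup>+y. ennreal (poisson_kernel \<sigma> (y - t) * (cmod (G y))\<^sup>2) \<partial>lborel)"
    by (intro nn_integral_cong) (simp add: ennreal_mult k0)
  also have "\<dots> = ennreal (\<integral>y. poisson_kernel \<sigma> (y - t) * (cmod (G y))\<^sup>2 \<partial>lborel)"
    by (rule nn_integral_eq_integral[OF i]) (simp add: k0)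
  also have "(\<integral>y. poisson_kernel \<sigma> (y - t) * (cmod (G y))\<^sup>2 \<partial>lborel)
      = (\<integral>y. (1 / pi) * (\<sigma> / (\<sigma>\<^sup>2 + (y - t)\<^sup>2) * (cmod (G y))\<^sup>2) \<partial>lborel)"
    by (intro Bochner_Integration.integral_cong refl) (simp add: poisson_kernel_def)
  also have "\<dots> = (1 / pi) * (\<integral>y. \<sigma> / (\<sigma>\<^sup>2 + (y - t)\<^sup>2) * (cmod (G y))\<^sup>2 \<partial>lborel)"
    by (rule integral_mult_right_zero)
  also have "\<dots> = poisson_integral (\<lambda>z. (cmod (boundary_value g z))\<^sup>2) (Complex (-1/2 + \<sigma>) t)"
    by (simp add: poisson_integral_def G_def)
  finally show ?thesis by (simp add: G_def)
qed

text \<open>The square of $|Q(s+\tau)|$ is at most its Poisson average over the line; by Tonelli and the symmetry of the kernel the average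
  can be moved onto $|g|^2$.\<close>

lemma boundary_estimate_poisson:
  assumes g: "g \<in> Hardy2_half_plane" and \<tau>: "Re \<tau> > 0"
    and M: "\<And>t. poisson_integral (\<lambda>z. (cmod (boundary_value g z))\<^sup>2) (Complex (-1/2 + Re \<tau>) t) \<le> M"
  shows "(\<integral>\<^sup>+y. ennreal ((cmod (boundary_value g (line y)))\<^sup>2) * ennreal ((cmod (poly_mellin q (line y + \<tau>)))\<^sup>2) \<partial>lborel)
       \<le> ennreal (M * (2 * pi * (L2_norm_unit (poly_fun q))\<^sup>2))"
proof -
  define G where "G y = ennreal ((cmod (boundary_value g (line y)))\<^sup>2)" for y
  define Q where "Q u = ennreal ((cmod (poly_mellin q (line u)))\<^sup>2)" for u
  define a where "a = Re \<tau>"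
  define b where "b = Im \<tau>"
  have a: "a > 0" using \<tau> by (simp add: a_def)
  have [measurable]: "(\<lambda>y. boundary_value g (line y)) \<in> borel_measurable borel"
    by (intro boundary_value_borel_measurable Hardy2_half_plane_continuous_on g)
  have Gm[measurable]: "G \<in> borel_measurable borel" unfolding G_def[abs_def] by measurable
  have Qm[measurable]: "Q \<in> borel_measurable borel" unfolding Q_def[abs_def] poly_mellin_def Complex_eq by measurable
  have k0: "poisson_kernel a v \<ge> 0" for v by (rule poisson_kernel_nonneg[OF a])
  have "(\<integral>\<^sup>+y. G y * ennreal ((cmod (poly_mellin q (line y + \<tau>)))\<^sup>2) \<partial>lborel)
      \<le> (\<integral>\<^sup>+y. (\<integral>\<^sup>+u. G y * (ennreal (poisson_kernel a (u - (y + b))) * Q u) \<partial>lborel) \<partial>lborel)"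
  proof (rule nn_integral_mono)
    fix y
    have "line y + \<tau> = line (y + b) + of_real a" by (simp add: complex_eq_iff a_def b_def)
    then have "ennreal ((cmod (poly_mellin q (line y + \<tau>)))\<^sup>2) \<le> (\<integral>\<^sup>+u. ennreal (poisson_kernel a (u - (y + b)) * (cmod (poly_mellin q (line u)))\<^sup>2) \<partial>lborel)"
      using poly_mellin_square_le_poisson[OF a, of q "y + b"] by simp
    also have "\<dots> = (\<integral>\<^sup>+u. ennreal (poisson_kernel a (u - (y + b))) * Q u \<partial>lborel)"
      by (intro nn_integral_cong) (simp add: Q_def ennreal_mult k0)
    finally have "G y * ennreal ((cmod (poly_mellin q (line y + \<tau>)))\<^sup>2) \<le> G y * (\<integral>\<^sup>+u. ennreal (poisson_kernel a (u - (y + b))) * Q u \<partial>lborel)"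
      by (intro mult_left_mono) auto
    also have "\<dots> = (\<integral>\<^sup>+u. G y * (ennreal (poisson_kernel a (u - (y + b))) * Q u) \<partial>lborel)"
      by (rule nn_integral_cmult[symmetric]) measurable
    finally show "G y * ennreal ((cmod (poly_mellin q (line y + \<tau>)))\<^sup>2) \<le> (\<integral>\<^sup>+u. G y * (ennreal (poisson_kernel a (u - (y + b))) * Q u) \<partial>lborel)" .
  qed
  also have "\<dots> = (\<integral>\<^sup>+u. (\<integral>\<^sup>+y. G y * (ennreal (poisson_kernel a (u - (y + b))) * Q u) \<partial>lborel) \<partial>lborel)"
    by (rule lborel_pair.Fubini') measurable
  also have "\<dots> \<le> (\<integral>\<^sup>+u. ennreal M * Q u \<partial>lborel)"
  proof (rule nn_integral_mono)
    fix u
    have "(\<integral>\<^sup>+y. G y * (ennreal (poisson_kernel a (u - (y + b))) * Q u) \<partial>lborel) = (\<integral>\<^sup>+y. (ennreal (poisson_kernel a (y - (u - b))) * G y) * Q u \<partial>lborel)"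
    proof (intro nn_integral_cong)
      fix y
      have "poisson_kernel a (u - (y + b)) = poisson_kernel a (y - (u - b))"
        using poisson_kernel_minus[of a "y - (u - b)"] by (simp add: algebra_simps)
      then show "G y * (ennreal (poisson_kernel a (u - (y + b))) * Q u) = (ennreal (poisson_kernel a (y - (u - b))) * G y) * Q u"
        by (simp add: mult_ac)
    qed
    also have "\<dots> = (\<integral>\<^sup>+y. ennreal (poisson_kernel a (y - (u - b))) * G y \<partial>lborel) * Q u"
      by (rule nn_integral_multc) measurable
    also have "\<dots> \<le> ennreal M * Q u"
    proof (rule mult_right_mono)
      show "(\<integral>\<^sup>+y. ennreal (poisson_kernel a (y - (u - b))) * G y \<partial>lborel) \<le> ennreal M"
        unfolding G_def poisson_integral_eq_nn_integral[OF g a] by (rule ennreal_leI, unfold a_def, rule M)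
    qed simp
    finally show "(\<integral>\<^sup>+y. G y * (ennreal (poisson_kernel a (u - (y + b))) * Q u) \<partial>lborel) \<le> ennreal M * Q u" .
  qed
  also have "\<dots> = ennreal M * (\<integral>\<^sup>+u. Q u \<partial>lborel)" by (rule nn_integral_cmult) measurable
  also have "(\<integral>\<^sup>+u. Q u \<partial>lborel) = ennreal (2 * pi * (L2_norm_unit (poly_fun q))\<^sup>2)"
    unfolding Q_def poly_mellin_Plancherel(2)[symmetric]
    by (rule nn_integral_eq_integral[OF poly_mellin_Plancherel(1)]) simp
  finally show ?thesis unfolding G_def by (simp add: ennreal_mult'')
qed

section \<open>Bounded monomial operators\<close>

theorem theorem1p12:
  fixes \<tau> :: complex and g :: "complex \<Rightarrow> complex"
  assumes "Re \<tau> \<ge> 0" and "g \<in> Hardy2_half_plane"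
  shows "(Re \<tau> > 0 \<longrightarrow>
            (extends_to_bounded_L2_operator (monomial_operator \<tau> g) \<longleftrightarrow>
             (\<forall>\<rho>>-1/2. bounded (poisson_integral (\<lambda>z. (cmod (boundary_value g z))\<^sup>2) ` {s. Re s > \<rho>}))))
       \<and> (Re \<tau> = 0 \<longrightarrow>
            (extends_to_bounded_L2_operator (monomial_operator \<tau> g) \<longleftrightarrow>
             bounded (g ` half_plane)))"
proof -
  note g = assms(2)
  let ?bounded_on_polynomials = "\<exists>C\<ge>0. \<forall>p. L2_norm_unit (monomial_operator \<tau> g p) \<le> C * L2_norm_unit (poly_fun p)"
  have ext: "extends_to_bounded_L2_operator (monomial_operator \<tau> g) \<longleftrightarrow> ?bounded_on_polynomials"
    by (rule extends_iff_bounded_on_polynomials[OF monomial_operator_L2[OF assms(1)] monomial_operator_add monomial_operator_smult])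
  show ?thesis unfolding ext
  proof (intro conjI impI iffI)
    assume \<tau>: "Re \<tau> > 0"
    { assume ?bounded_on_polynomials
      then show "\<forall>\<rho>>-1/2. bounded (poisson_integral (\<lambda>z. (cmod (boundary_value g z))\<^sup>2) ` {s. Re s > \<rho>})"
        using poisson_bounded_if_extends[OF g assms(1)] by blast }
    { assume bd: "\<forall>\<rho>>-1/2. bounded (poisson_integral (\<lambda>z. (cmod (boundary_value g z))\<^sup>2) ` {s. Re s > \<rho>})"
      \<comment> \<open>A half-plane that contains the line \<open>Re s = -1/2 + Re \<tau>\<close>.\<close>
      have "-1/2 + Re \<tau> / 2 > -1/2" using \<tau> by simp
      with bd have "bounded (poisson_integral (\<lambda>z. (cmod (boundary_value g z))\<^sup>2) ` {s. Re s > -1/2 + Re \<tau> / 2})" by blast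
      then obtain M where M: "\<And>s. Re s > -1/2 + Re \<tau> / 2 \<Longrightarrow> \<bar>poisson_integral (\<lambda>z. (cmod (boundary_value g z))\<^sup>2) s\<bar> \<le> M"
        unfolding bounded_iff by auto
      have Mt: "\<bar>poisson_integral (\<lambda>z. (cmod (boundary_value g z))\<^sup>2) (Complex (-1/2 + Re \<tau>) t)\<bar> \<le> M" for t
        by (rule M) (use \<tau> in simp)
      show ?bounded_on_polynomials
      proof (rule bounded_on_polynomials_if_boundary_estimate[OF g assms(1)])
        show "M \<ge> 0" using Mt[of 0] by linarith
        show "(\<integral>\<^sup>+y. ennreal ((cmod (boundary_value g (line y)))\<^sup>2) * ennreal ((cmod (poly_mellin q (line y + \<tau>)))\<^sup>2) \<partial>lborel)
          \<le> ennreal (M * (2 * pi * (L2_norm_unit (poly_fun q))\<^sup>2))" for q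
          by (rule boundary_estimate_poisson[OF g \<tau>]) (use Mt in \<open>simp add: abs_le_iff\<close>)
      qed }
  next
    assume \<tau>: "Re \<tau> = 0"
    { assume ?bounded_on_polynomials
      then show "bounded (g ` half_plane)" using bounded_if_extends[OF g \<tau>] by blast }
    { assume "bounded (g ` half_plane)"
      then obtain M where M: "\<And>s. s \<in> half_plane \<Longrightarrow> cmod (g s) \<le> M" unfolding bounded_iff by auto
      show ?bounded_on_polynomials
        by (rule bounded_on_polynomials_if_boundary_estimate[OF g assms(1) _ boundary_estimate_bounded[OF g \<tau> M]]) auto }
  qed
qed

end
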